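(* Let $c_n = \frac{1}{2}\int_{\mathbb{S}^{n-1}} |w_1|\, d\sigma(w)$, where $w_1$ is the first coordinate of $w$. Let $\Omega \subset \mathbb{R}^n$ be a convex, bounded domain with $C^1$-boundary $\partial\Omega$. Then for all $x \in \partial\Omega$, $$ \int_{\partial \Omega} \frac{\left|\left\langle n(x), y - x \right\rangle \left\langle y - x, n(y) \right\rangle \right|}{\|x - y\|^{n+1}}\, d\sigma(y) = c_n. $$ Moreover, if $x \in \Omega \setminus \partial\Omega$ and $w \in \mathbb{S}^{n-1}$ is an arbitrary unit vector, then $$ \int_{\partial \Omega} \frac{\left|\left\langle w, y - x \right\rangle \left\langle y - x, n(y) \right\rangle \right|}{\|x - y\|^{n+1}}\, d\sigma(y) = 2 \cdot c_n. $$
   Context: A domain is a nonempty connected open set. $\Omega$ has $C^1$-boundary if, near each boundary point and after a rigid motion, $\Omega$ is the region on one side of the graph of a $C^1$ function. For $x \in \partial\Omega$, $n(x)$ denotes the unit (outward) normal vector to $\partial\Omega$ at $x$. $\sigma$ is the $(n-1)$-dimensional Hausdorff measure (on $\partial\Omega$, respectively on the unit sphere $\mathbb{S}^{n-1}\subset\mathbb{R}^n$). $\langle\cdot,\cdot\rangle$ and $\|\cdot\|$ are the Euclidean inner product and norm. In the first integral the integrand is considered for $y \neq x$. *)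

theory Defs
  imports "HOL-Analysis.Analysis"
begin

section \<open>Hausdorff measure\<close>

text \<open>The factor \<open>unit_ball_vol d / 2 ^ d\<close> makes \<open>d\<close>-dimensional Hausdorff measure agree
  with Lebesgue measure on \<open>d\<close>-dimensional Euclidean space. The case distinction
  matters only for \<open>d = 0\<close>, where it makes the measure the counting measure.\<close>

definition hausdorff_gauge :: "nat \<Rightarrow> 'a::metric_space set \<Rightarrow> ennreal" where
  "hausdorff_gauge d U =
     (if U = {} then 0 else ennreal (unit_ball_vol (real d) * (diameter U / 2) ^ d))"

text \<open>Boundedness is required explicitly because \<^const>\<open>diameter\<close> is real-valued and
  meaningless on unbounded sets.\<close>

definition hausdorff_covers :: "real \<Rightarrow> 'a::metric_space set \<Rightarrow> (nat \<Rightarrow> 'a set) set" where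
  "hausdorff_covers \<delta> A =
     {U. A \<subseteq> (\<Union>i. U i) \<and> (\<forall>i. bounded (U i) \<and> diameter (U i) \<le> \<delta>)}"

definition hausdorff_content :: "nat \<Rightarrow> real \<Rightarrow> 'a::metric_space set \<Rightarrow> ennreal" where
  "hausdorff_content d \<delta> A = (INF U\<in>hausdorff_covers \<delta> A. \<Sum>i. hausdorff_gauge d (U i))"

definition hausdorff_outer :: "nat \<Rightarrow> 'a::metric_space set \<Rightarrow> ennreal" where
  "hausdorff_outer d A = (SUP \<delta>\<in>{0<..}. hausdorff_content d \<delta> A)"

definition hausdorff_measure :: "nat \<Rightarrow> 'a::metric_space measure" where
  "hausdorff_measure d = measure_of UNIV (sets borel) (hausdorff_outer d)"

lemma hausdorff_gauge_empty [simp]: "hausdorff_gauge d {} = 0"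
  by (simp add: hausdorff_gauge_def)

lemma hausdorff_content_antimono:
  "\<delta> \<le> \<delta>' \<Longrightarrow> hausdorff_content d \<delta>' A \<le> hausdorff_content d \<delta> A"
  unfolding hausdorff_content_def hausdorff_covers_def
  by (rule INF_superset_mono) (auto intro: order_trans)

lemma hausdorff_content_subadditive:
  "hausdorff_content d \<delta> (\<Union>i. A i) \<le> (\<Sum>i::nat. hausdorff_content d \<delta> (A i))"
proof (rule ennreal_le_epsilon)
  let ?h = "hausdorff_gauge d"
  fix e :: real assume e: "0 < e" and fin: "(\<Sum>n. hausdorff_content d \<delta> (A n)) < top"
  have *: "hausdorff_content d \<delta> (A n) < hausdorff_content d \<delta> (A n) + e * (1/2)^Suc n" for n
    using e fin by (auto simp add: less_top dest!: ennreal_suminf_lessD)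
  have "\<exists>B\<in>hausdorff_covers \<delta> (A n). (\<Sum>i. ?h (B i)) < hausdorff_content d \<delta> (A n) + e * (1/2)^Suc n" for n
    using *[of n] unfolding hausdorff_content_def INF_less_iff by auto
  then obtain B where B: "\<And>n. B n \<in> hausdorff_covers \<delta> (A n)"
    and Ble: "\<And>n. (\<Sum>i. ?h (B n i)) \<le> hausdorff_content d \<delta> (A n) + e * (1/2)^Suc n"
    by (metis less_imp_le)
  define C where "C = case_prod B o prod_decode"
  have C: "C \<in> hausdorff_covers \<delta> (\<Union>i. A i)"
  proof -
    have "(\<Union>i. A i) \<subseteq> (\<Union>i. C i)"
    proof
      fix x assume "x \<in> (\<Union>i. A i)"
      then obtain i j where "x \<in> B i j" using B by (fastforce simp: hausdorff_covers_def)
      then have "x \<in> C (prod_encode (i,j))" by (simp add: C_def)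
      then show "x \<in> (\<Union>i. C i)" by blast
    qed
    moreover have "bounded (C i) \<and> diameter (C i) \<le> \<delta>" for i
      using B by (auto simp: C_def hausdorff_covers_def split: prod.split)
    ultimately show ?thesis by (auto simp: hausdorff_covers_def)
  qed
  have "hausdorff_content d \<delta> (\<Union>i. A i) \<le> (\<Sum>i. ?h (C i))"
    unfolding hausdorff_content_def by (rule INF_lower[OF C])
  also have "\<dots> = (\<Sum>n. \<Sum>i. ?h (B n i))"
    unfolding C_def comp_def by (subst suminf_ennreal_2dimen[symmetric, where f="\<lambda>p. ?h (case_prod B p)"]) auto
  also have "\<dots> \<le> (\<Sum>n. hausdorff_content d \<delta> (A n) + e * (1/2) ^ Suc n)"
    by (intro suminf_le suminf_nonneg allI Ble) auto
  also have "... = (\<Sum>n. hausdorff_content d \<delta> (A n)) + (\<Sum>n. ennreal e * ennreal ((1/2) ^ Suc n))"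
    using \<open>0 < e\<close> by (subst suminf_add[symmetric])
                     (auto simp del: ennreal_suminf_cmult simp add: ennreal_mult[symmetric])
  also have "\<dots> = (\<Sum>n. hausdorff_content d \<delta> (A n)) + e"
    unfolding ennreal_suminf_cmult
    by (subst suminf_ennreal_eq[OF zero_le_power power_half_series]) auto
  finally show "hausdorff_content d \<delta> (\<Union>i. A i) \<le> (\<Sum>n. hausdorff_content d \<delta> (A n)) + e" .
qed

lemma hausdorff_outer_subadditive:
  "hausdorff_outer d (\<Union>i. A i) \<le> (\<Sum>i::nat. hausdorff_outer d (A i))"
  unfolding hausdorff_outer_def
  by (auto intro!: SUP_least order_trans[OF hausdorff_content_subadditive] suminf_le SUP_upper)

lemma outer_measure_space_hausdorff:
  "outer_measure_space (Pow UNIV) (hausdorff_outer d :: 'a::metric_space set \<Rightarrow> ennreal)"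
  unfolding outer_measure_space_def
proof (intro conjI)
  have "hausdorff_content d \<delta> ({} :: 'a set) = 0" if "\<delta> > 0" for \<delta>
  proof -
    have "hausdorff_content d \<delta> ({} :: 'a set) \<le> (\<Sum>i::nat. hausdorff_gauge d ({} :: 'a set))"
      unfolding hausdorff_content_def using that
      by (intro INF_lower2[of "\<lambda>_. {}"]) (auto simp: hausdorff_covers_def)
    then show ?thesis by simp
  qed
  then have "hausdorff_outer d ({} :: 'a set) \<le> 0"
    unfolding hausdorff_outer_def by (intro SUP_least) simp
  then show "positive (Pow UNIV) (hausdorff_outer d :: 'a set \<Rightarrow> ennreal)"
    by (simp add: positive_def)
  show "increasing (Pow UNIV) (hausdorff_outer d)"
    unfolding increasing_def hausdorff_outer_def hausdorff_content_def hausdorff_covers_def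
    by (intro ballI impI SUP_mono' INF_superset_mono) auto
  show "countably_subadditive (Pow UNIV) (hausdorff_outer d)"
    unfolding countably_subadditive_def by (auto intro: hausdorff_outer_subadditive)
qed

lemma hausdorff_outer_mono: "A \<subseteq> B \<Longrightarrow> hausdorff_outer d A \<le> hausdorff_outer d B"
  using outer_measure_space_hausdorff[of d]
  by (auto simp: outer_measure_space_def increasing_def)

lemma hausdorff_outer_empty [simp]: "hausdorff_outer d {} = 0"
  using outer_measure_space_hausdorff[of d]
  by (auto simp: outer_measure_space_def positive_def)

lemma hausdorff_outer_Un: "hausdorff_outer d (A \<union> B) \<le> hausdorff_outer d A + hausdorff_outer d B"
proof -
  have "A \<union> B = (\<Union>i. binaryset A B i)" by (simp add: UN_binaryset_eq)
  then have "hausdorff_outer d (A \<union> B) \<le> (\<Sum>i. hausdorff_outer d (binaryset A B i))"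
    using hausdorff_outer_subadditive[of d "binaryset A B"] by simp
  also have "\<dots> = hausdorff_outer d A + hausdorff_outer d B"
    by (rule suminf_binaryset_eq) simp
  finally show ?thesis .
qed

lemma hausdorff_content_separated:
  assumes sep: "\<And>x y. x \<in> A \<Longrightarrow> y \<in> B \<Longrightarrow> \<delta> < dist x y"
  shows "hausdorff_content d \<delta> A + hausdorff_content d \<delta> B \<le> hausdorff_content d \<delta> (A \<union> B)"
  unfolding hausdorff_content_def[of d \<delta> "A \<union> B"]
proof (rule INF_greatest)
  fix U assume U: "U \<in> hausdorff_covers \<delta> (A \<union> B)"
  let ?h = "hausdorff_gauge d"
  define V where "V X i = (if U i \<inter> X \<noteq> {} then U i else {})" for X i
  have \<delta>: "\<delta> \<ge> 0" using U diameter_ge_0[of "U 0"]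
    by (auto simp: hausdorff_covers_def) (meson order_trans)
  have V: "V X \<in> hausdorff_covers \<delta> X" if "X \<subseteq> A \<union> B" for X
  proof -
    have "X \<subseteq> (\<Union>i. V X i)"
      using U that unfolding V_def hausdorff_covers_def by fastforce
    then show ?thesis using U \<delta> by (auto simp: V_def hausdorff_covers_def)
  qed
  have disj: "U i \<inter> A = {} \<or> U i \<inter> B = {}" for i
  proof (rule ccontr)
    assume "\<not> ?thesis"
    then obtain x y where "x \<in> U i" "x \<in> A" "y \<in> U i" "y \<in> B" by blast
    moreover have "bounded (U i)" "diameter (U i) \<le> \<delta>" using U by (auto simp: hausdorff_covers_def)
    ultimately have "dist x y \<le> \<delta>" using diameter_bounded_bound by (metis order_trans)
    with sep \<open>x \<in> A\<close> \<open>y \<in> B\<close> show False by force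
  qed
  have "hausdorff_content d \<delta> A + hausdorff_content d \<delta> B \<le> (\<Sum>i. ?h (V A i)) + (\<Sum>i. ?h (V B i))"
    unfolding hausdorff_content_def by (intro add_mono INF_lower V) auto
  also have "\<dots> = (\<Sum>i. ?h (V A i) + ?h (V B i))" by (simp add: suminf_add)
  also have "\<dots> \<le> (\<Sum>i. ?h (U i))"
    using disj by (intro suminf_le) (auto simp: V_def)
  finally show "hausdorff_content d \<delta> A + hausdorff_content d \<delta> B \<le> (\<Sum>i. ?h (U i))" .
qed

lemma hausdorff_outer_separated:
  assumes "r > 0" and sep: "\<And>x y. x \<in> A \<Longrightarrow> y \<in> B \<Longrightarrow> r \<le> dist x y"
  shows "hausdorff_outer d (A \<union> B) = hausdorff_outer d A + hausdorff_outer d B"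
proof (rule antisym[OF hausdorff_outer_Un])
  let ?c = "hausdorff_content d"
  have "hausdorff_outer d A + hausdorff_outer d B = (SUP \<delta>\<in>{0<..}. ?c \<delta> A + ?c \<delta> B)"
    unfolding hausdorff_outer_def
  proof (rule SUP_add_directed_ennreal[symmetric])
    fix i j :: real assume "i \<in> {0<..}" "j \<in> {0<..}"
    then show "\<exists>k\<in>{0<..}. ?c i A + ?c j B \<le> ?c k A + ?c k B"
      by (intro bexI[of _ "min i j"] add_mono hausdorff_content_antimono) auto
  qed
  also have "\<dots> \<le> hausdorff_outer d (A \<union> B)"
  proof (rule SUP_least)
    fix \<delta> :: real assume \<delta>: "\<delta> \<in> {0<..}"
    let ?e = "min \<delta> (r/2)"
    have "?c \<delta> A + ?c \<delta> B \<le> ?c ?e A + ?c ?e B"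
      by (intro add_mono hausdorff_content_antimono) auto
    also have "\<dots> \<le> ?c ?e (A \<union> B)"
      using sep \<open>r > 0\<close> by (intro hausdorff_content_separated) (smt (verit) field_sum_of_halves)
    also have "\<dots> \<le> hausdorff_outer d (A \<union> B)"
      unfolding hausdorff_outer_def using \<delta> \<open>r > 0\<close> by (intro SUP_upper) auto
    finally show "?c \<delta> A + ?c \<delta> B \<le> hausdorff_outer d (A \<union> B)" .
  qed
  finally show "hausdorff_outer d A + hausdorff_outer d B \<le> hausdorff_outer d (A \<union> B)" .
qed

lemma closed_caratheodory_hausdorff:
  fixes C :: "'a::metric_space set"
  assumes "closed C"
  shows "hausdorff_outer d (X \<inter> C) + hausdorff_outer d (X - C) \<le> hausdorff_outer d X"
proof (cases "C = {} \<or> hausdorff_outer d X = top")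
  case True
  then show ?thesis by auto
next
  case False
  let ?m = "hausdorff_outer d"
  define r where "r n = 1 / real (Suc n)" for n
  define S where "S n = {x \<in> X. r n \<le> infdist x C}" for n
  define R where "R n = {x \<in> X. r (Suc n) \<le> infdist x C \<and> infdist x C < r n}" for n
  have fin: "?m X < top" using False by (simp add: less_top)
  have rpos: "r n > 0" for n by (simp add: r_def)
  have rmono: "m \<le> n \<Longrightarrow> r n \<le> r m" for m n by (simp add: r_def frac_le)
  have rstrict: "r (Suc n) < r n" for n by (simp add: r_def frac_less2)
  have inf_diff: "infdist x C - infdist y C \<le> dist x y" for x y
    using infdist_triangle[of x C y] by simp
  have sum_sep: "(\<Sum>k<n. ?m (R (2 * k + b))) = ?m (\<Union>k<n. R (2 * k + b))" for n b
  proof (induction n)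
    case 0 then show ?case by simp
  next
    case (Suc n)
    have "?m ((\<Union>k<n. R (2 * k + b)) \<union> R (2 * n + b)) =
        ?m (\<Union>k<n. R (2 * k + b)) + ?m (R (2 * n + b))"
    proof (cases n)
      case 0 then show ?thesis by simp
    next
      case (Suc m)
      let ?q = "2 * m + b"
      show ?thesis
      proof (rule hausdorff_outer_separated[of "r (Suc ?q) - r (2 * n + b)"])
        show "0 < r (Suc ?q) - r (2 * n + b)" using rstrict[of "Suc ?q"] Suc by simp
        fix x y assume "x \<in> (\<Union>k<n. R (2 * k + b))" "y \<in> R (2 * n + b)"
        then obtain k where "k < n" "x \<in> R (2 * k + b)" by blast
        then have "r (Suc ?q) \<le> infdist x C"
          using rmono[of "Suc (2 * k + b)" "Suc ?q"] Suc by (auto simp: R_def)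
        moreover have "infdist y C < r (2 * n + b)" using \<open>y \<in> R (2 * n + b)\<close> by (simp add: R_def)
        ultimately show "r (Suc ?q) - r (2 * n + b) \<le> dist x y" using inf_diff[of x y] by linarith
      qed
    qed
    moreover have "(\<Union>k<Suc n. R (2 * k + b)) = (\<Union>k<n. R (2 * k + b)) \<union> R (2 * n + b)"
      by (auto simp: less_Suc_eq)
    ultimately show ?case using Suc by simp
  qed
  have sum_fin: "(\<Sum>k. ?m (R (2 * k + b))) \<le> ?m X" for b
  proof (rule suminf_le_const)
    fix n show "(\<Sum>k<n. ?m (R (2 * k + b))) \<le> ?m X"
      unfolding sum_sep by (rule hausdorff_outer_mono) (auto simp: R_def)
  qed simp
  have tail: "X - C \<subseteq> S n \<union> (\<Union>k. R (k + n))" for n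
  proof
    fix x assume x: "x \<in> X - C"
    then have pos: "infdist x C > 0"
      using False \<open>closed C\<close> by (metis DiffD2 in_closed_iff_infdist_zero infdist_nonneg less_le)
    show "x \<in> S n \<union> (\<Union>k. R (k + n))"
    proof (cases "r n \<le> infdist x C")
      case True then show ?thesis using x by (simp add: S_def)
    next
      case False
      obtain N where N: "r N < infdist x C"
        using reals_Archimedean[OF pos] by (auto simp: r_def inverse_eq_divide)
      define M where "M = (LEAST m. r m \<le> infdist x C)"
      have M: "r M \<le> infdist x C" unfolding M_def by (rule LeastI[of _ N]) (use N in simp)
      have "n < M" using False M rmono[of M n] by (meson leI order_trans)
      then obtain k where k: "M = Suc (k + n)" by (metis add.commute less_iff_Suc_add)
      have "\<not> r (k + n) \<le> infdist x C" using not_less_Least[of "k + n"] k M_def by force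
      then have "x \<in> R (k + n)" using M k x by (auto simp: R_def)
      then show ?thesis by blast
    qed
  qed
  define f where "f k = ?m (R k)" for k
  have f_fin: "(\<Sum>k. f k) < top"
  proof -
    have "(\<Sum>k<n. f k) \<le> ?m X + ?m X" for n
    proof -
      have "(\<Sum>k<n. f k) \<le> (\<Sum>k<2 * n. f k)" by (intro sum_mono2) auto
      also have "\<dots> = (\<Sum>k<n. f (2 * k + 0)) + (\<Sum>k<n. f (2 * k + 1))"
        by (induction n) (auto simp: algebra_simps)
      also have "\<dots> \<le> (\<Sum>k. f (2 * k + 0)) + (\<Sum>k. f (2 * k + 1))"
        by (intro add_mono sum_le_suminf) auto
      also have "\<dots> \<le> ?m X + ?m X" unfolding f_def by (intro add_mono sum_fin)
      finally show ?thesis .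
    qed
    then have "(\<Sum>k. f k) \<le> ?m X + ?m X" by (intro suminf_le_const) auto
    then show ?thesis using fin by (auto simp: less_top[symmetric] top_unique)
  qed
  have tail0: "(\<lambda>n. \<Sum>k. f (k + n)) \<longlonglongrightarrow> 0"
  proof -
    have fk: "f k < top" for k using ennreal_suminf_lessD[OF f_fin] .
    define g where "g k = enn2real (f k)" for k
    have fg: "f k = ennreal (g k)" for k using fk by (simp add: g_def)
    have g0: "g k \<ge> 0" for k by (simp add: g_def)
    have sg: "summable g"
      using f_fin g0 by (intro summable_suminf_not_top) (auto simp: fg)
    have "(\<Sum>k. f (k + n)) = ennreal (\<Sum>k. g (k + n))" for n
      unfolding fg using g0 sg by (intro suminf_ennreal2) (auto simp: summable_iff_shift)
    moreover have "(\<lambda>n. ennreal (\<Sum>k. g (k + n))) \<longlonglongrightarrow> ennreal 0"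
      using suminf_exist_split2[OF sg] by (intro tendsto_ennrealI)
    ultimately show ?thesis by simp
  qed
  have bound: "?m (X \<inter> C) + ?m (X - C) \<le> ?m X + (\<Sum>k. f (k + n))" for n
  proof -
    have "?m (X - C) \<le> ?m (S n \<union> (\<Union>k. R (k + n)))" by (intro hausdorff_outer_mono tail)
    also have "\<dots> \<le> ?m (S n) + ?m (\<Union>k. R (k + n))" by (rule hausdorff_outer_Un)
    also have "\<dots> \<le> ?m (S n) + (\<Sum>k. f (k + n))"
      unfolding f_def by (intro add_left_mono hausdorff_outer_subadditive)
    finally have "?m (X \<inter> C) + ?m (X - C) \<le> ?m (X \<inter> C) + (?m (S n) + (\<Sum>k. f (k + n)))"
      by (rule add_left_mono)
    also have "\<dots> = ?m (X \<inter> C \<union> S n) + (\<Sum>k. f (k + n))"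
    proof -
      have "?m (X \<inter> C \<union> S n) = ?m (X \<inter> C) + ?m (S n)"
      proof (rule hausdorff_outer_separated[OF rpos[of n]])
        fix x y assume "x \<in> X \<inter> C" "y \<in> S n"
        then show "r n \<le> dist x y"
          using infdist_le[of x C y] by (auto simp: S_def dist_commute)
      qed
      then show ?thesis by (simp add: add.assoc)
    qed
    also have "\<dots> \<le> ?m X + (\<Sum>k. f (k + n))"
      by (intro add_right_mono hausdorff_outer_mono) (auto simp: S_def)
    finally show ?thesis .
  qed
  have "(\<lambda>n. ?m X + (\<Sum>k. f (k + n))) \<longlonglongrightarrow> ?m X + 0"
    by (intro tendsto_add tendsto_const tail0)
  then show ?thesis using bound by (intro LIMSEQ_le_const[of _ "?m X"]) auto
qed

text \<open>The following shows that \<^const>\<open>measure_of\<close> does not degenerate in the definition of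
  \<^const>\<open>hausdorff_measure\<close>.\<close>

lemma measure_space_hausdorff:
  "measure_space UNIV (sets borel) (hausdorff_outer d)"
proof -
  interpret P: sigma_algebra UNIV "Pow UNIV :: 'a set set" by (rule sigma_algebra_Pow)
  let ?L = "lambda_system UNIV (Pow UNIV) (hausdorff_outer d) :: 'a set set"
  have L: "measure_space UNIV ?L (hausdorff_outer d)"
    by (rule P.caratheodory_lemma[OF outer_measure_space_hausdorff])
  then interpret L: sigma_algebra UNIV ?L by (simp add: measure_space_def)
  have "C \<in> ?L" if "closed C" for C
  proof -
    have "hausdorff_outer d (X \<inter> C) + hausdorff_outer d (X - C) = hausdorff_outer d X" for X
      using closed_caratheodory_hausdorff[OF that, of d X]
        hausdorff_outer_Un[of d "X \<inter> C" "X - C"] by (simp add: Int_Diff_Un antisym)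
    then show ?thesis by (simp add: P.lambda_system_eq del: Pow_UNIV)
  qed
  then have sub: "sets borel \<subseteq> ?L"
    unfolding borel_eq_closed
    by (subst sets_measure_of) (auto intro!: L.sigma_sets_subset simp del: Pow_UNIV)
  have bor: "sigma_algebra UNIV (sets borel :: 'a set set)"
    using sets.sigma_algebra_axioms[of borel] by simp
  show ?thesis
    using L sub bor by (auto simp: measure_space_def positive_def countably_additive_def)
qed

lemma sets_hausdorff_measure [simp]: "sets (hausdorff_measure d) = sets borel"
  unfolding hausdorff_measure_def
  by (metis sets.sigma_sets_eq sets_measure_of space_borel subset_UNIV Pow_UNIV)

lemma space_hausdorff_measure [simp]: "space (hausdorff_measure d) = UNIV"
  unfolding hausdorff_measure_def by (simp add: space_measure_of)

lemma emeasure_hausdorff_measure: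
  "A \<in> sets borel \<Longrightarrow> emeasure (hausdorff_measure d) A = hausdorff_outer d A"
  using measure_space_hausdorff[of d] unfolding hausdorff_measure_def measure_space_def
  by (intro emeasure_measure_of_sigma) auto


section \<open>Open sets with \<open>C\<^sup>1\<close> boundary\<close>

definition C1_function :: "('a::euclidean_space \<Rightarrow> real) \<Rightarrow> bool" where
  "C1_function g \<longleftrightarrow>
     (\<exists>G. continuous_on UNIV G \<and> (\<forall>u. (g has_derivative (\<lambda>h. G u \<bullet> h)) (at u)))"

definition rigid_motion :: "('a::euclidean_space \<Rightarrow> 'a) \<Rightarrow> bool" where
  "rigid_motion T \<longleftrightarrow> (\<exists>f a. orthogonal_transformation f \<and> T = (\<lambda>y. f y + a))"

text \<open>A function of the \<open>n - 1\<close> coordinates other than the \<open>k\<close>-th is encoded as a function on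
  the whole space that does not depend on the \<open>k\<close>-th coordinate.\<close>

definition C1_boundary :: "(real ^ 'n) set \<Rightarrow> bool" where
  "C1_boundary \<Omega> \<longleftrightarrow>
     (\<forall>x\<in>frontier \<Omega>. \<exists>r>0. \<exists>T k g. rigid_motion T \<and> C1_function g \<and>
        (\<forall>u t. g (u + t *\<^sub>R axis k 1) = g u) \<and>
        \<Omega> \<inter> ball x r = {y \<in> ball x r. T y $ k > g (T y)})"

definition tangent_vector :: "'a::euclidean_space set \<Rightarrow> 'a \<Rightarrow> 'a \<Rightarrow> bool" where
  "tangent_vector S x v \<longleftrightarrow>
     (\<exists>\<gamma> \<epsilon>. \<epsilon> > 0 \<and> \<gamma> 0 = x \<and> (\<forall>t. \<bar>t\<bar> < \<epsilon> \<longrightarrow> \<gamma> t \<in> S) \<and>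
            (\<gamma> has_vector_derivative v) (at (0::real)))"

definition is_outward_unit_normal :: "'a::euclidean_space set \<Rightarrow> 'a \<Rightarrow> 'a \<Rightarrow> bool" where
  "is_outward_unit_normal \<Omega> x \<nu> \<longleftrightarrow>
     norm \<nu> = 1 \<and>
     (\<forall>v. tangent_vector (frontier \<Omega>) x v \<longrightarrow> \<nu> \<bullet> v = 0) \<and>
     (\<forall>\<^sub>F t in at_right 0. x + t *\<^sub>R \<nu> \<notin> closure \<Omega>)"

definition outward_unit_normal :: "'a::euclidean_space set \<Rightarrow> 'a \<Rightarrow> 'a" where
  "outward_unit_normal \<Omega> x = (THE \<nu>. is_outward_unit_normal \<Omega> x \<nu>)"

end

theory Submission
  imports Defs
begin

text \<open>Radial projection \<open>p y = (y - x) / norm (y - x)\<close> maps a hypersurface with unit normal \<open>\<nu>\<close> into the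
  unit sphere with Jacobian \<open>\<bar>\<langle>p y, \<nu> y\<rangle>\<bar> / norm (y - x) ^ (n - 1)\<close>, so both integrals become integrals of
  \<open>\<bar>\<langle>w, v\<rangle>\<bar>\<close> over the set of directions \<open>v\<close> pointing from \<open>x\<close> into \<open>\<Omega>\<close>: the whole sphere for an
  interior point, an open hemisphere for a boundary point. Rotation invariance and reflection finish
  the proof.

  The Jacobian formula is obtained without comparing Hausdorff and Lebesgue normalisations: on a
  hyperplane Hausdorff measure is translation invariant, hence some multiple of Lebesgue measure, which
  is enough to see how it changes under a linear map; and near each point \<open>p\<close> agrees, up to a
  bi-Lipschitz factor close to 1, with its derivative composed with the projection to the tangent
  hyperplane. Flatness of the boundary at small scales follows from convexity and continuity of the
  normal, the latter from uniqueness of supporting hyperplanes.\<close>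

section \<open>Hausdorff measure under Lipschitz maps\<close>

text \<open>All identities are proved for nonnegative integrals with values in
  \<open>ennreal\<close>, where additivity and change of variables ask for no integrability.
  Finiteness of the measure of the sphere is then a separate input: without it the Bochner integrals
  of the statement could be the default value 0. The technical obstacle is measurability of images,
  since a continuous image of a Borel set need not be Borel. Hence the seen part of the boundary is
  written as a countable union of compact sets, and injectivity of the projection is proved before
  any measure is computed. For a boundary point x, the boundary points not seen from x lie in the
  tangent hyperplane at x, where the integrand vanishes. That every direction at an obtuse angle to
  the normal does enter \<Omega> is again uniqueness of the supporting hyperplane, applied to a
  hyperplane separating \<Omega> from a ray. Every local comparison loses a fixed power of some q >
  1. Countable additivity glues the comparisons with the same loss, and only then does q tend to
  1.\<close>

lemma ennreal_le_mult_INF: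
  fixes X :: ennreal
  assumes "c > 0" and le: "\<And>u. u \<in> I \<Longrightarrow> X \<le> ennreal c * g u"
  shows "X \<le> ennreal c * (INF u\<in>I. g u)"
proof -
  have inv: "ennreal c * (ennreal (1 / c) * Y) = Y" "ennreal (1 / c) * (ennreal c * Y) = Y" for Y
    using \<open>c > 0\<close> by (simp_all add: mult.assoc[symmetric] ennreal_mult'[symmetric])
  have "ennreal (1 / c) * X \<le> (INF u\<in>I. g u)"
    using mult_left_mono[OF le, of _ "ennreal (1 / c)"] by (intro INF_greatest) (simp add: inv)
  then have "ennreal c * (ennreal (1 / c) * X) \<le> ennreal c * (INF u\<in>I. g u)"
    by (intro mult_left_mono) auto
  then show ?thesis by (simp add: inv)
qed

lemma diameter_image_le:
  fixes f :: "'a::metric_space \<Rightarrow> 'b::metric_space"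
  assumes "C \<ge> 0" "bounded B" and lip: "\<And>x y. x \<in> B \<Longrightarrow> y \<in> B \<Longrightarrow> dist (f x) (f y) \<le> C * dist x y"
  shows "diameter (f ` B) \<le> C * diameter B" "bounded (f ` B)"
proof -
  have le: "dist (f x) (f y) \<le> C * diameter B" if "x \<in> B" "y \<in> B" for x y
    using lip[OF that] diameter_bounded_bound[OF \<open>bounded B\<close> that] \<open>C \<ge> 0\<close>
    by (meson mult_left_mono order_trans)
  show "diameter (f ` B) \<le> C * diameter B"
  proof (cases "B = {}")
    case False
    then show ?thesis
      unfolding diameter_def[of "f ` B"] using le by (auto intro!: cSUP_least)
  qed simp
  show "bounded (f ` B)"
    using le by (auto simp: bounded_two_points)
qed

text \<open>A cover of \<open>A\<close> of mesh \<delta> is mapped to a cover of the image of mesh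
  \<open>C * \<delta>\<close>; diameters grow by at most the factor \<open>C\<close>, gauges by
  \<open>C ^ d\<close>. The supremum over all \<delta> absorbs the change of mesh.\<close>

lemma hausdorff_outer_image_le:
  fixes f :: "'a::metric_space \<Rightarrow> 'b::metric_space"
  assumes C: "C > 0" and lip: "\<And>x y. x \<in> A \<Longrightarrow> y \<in> A \<Longrightarrow> dist (f x) (f y) \<le> C * dist x y"
  shows "hausdorff_outer d (f ` A) \<le> ennreal (C ^ d) * hausdorff_outer d A"
proof -
  have content: "hausdorff_content d (C * \<delta>) (f ` A) \<le> ennreal (C ^ d) * hausdorff_content d \<delta> A" for \<delta>
  proof -
    have "hausdorff_content d (C * \<delta>) (f ` A) \<le> ennreal (C ^ d) * (\<Sum>i. hausdorff_gauge d (U i))"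
      if U: "U \<in> hausdorff_covers \<delta> A" for U
    proof -
      \<comment> \<open>\<open>f\<close> is Lipschitz on \<open>A\<close> only, so the covering sets
        are cut down to \<open>A\<close> before being mapped.\<close>
      define V where "V i = f ` (U i \<inter> A)" for i
      have bU: "bounded (U i \<inter> A)" for i using U by (auto simp: hausdorff_covers_def)
      have dU: "diameter (U i \<inter> A) \<le> diameter (U i)" for i
        using U by (intro diameter_subset) (auto simp: hausdorff_covers_def)
      have dV: "diameter (V i) \<le> C * diameter (U i)" "bounded (V i)" for i
        using diameter_image_le[OF less_imp_le[OF C] bU[of i], where f=f] lip
          mult_left_mono[OF dU[of i] less_imp_le[OF C]]
        by (fastforce simp: V_def)+
      have "V \<in> hausdorff_covers (C * \<delta>) (f ` A)"
        using U dV C by (fastforce simp: hausdorff_covers_def V_def intro: order_trans mult_left_mono)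
      then have "hausdorff_content d (C * \<delta>) (f ` A) \<le> (\<Sum>i. hausdorff_gauge d (V i))"
        unfolding hausdorff_content_def by (rule INF_lower)
      also have "\<dots> \<le> (\<Sum>i. ennreal (C ^ d) * hausdorff_gauge d (U i))"
      proof (intro suminf_le summableI)
        fix i
        show "hausdorff_gauge d (V i) \<le> ennreal (C ^ d) * hausdorff_gauge d (U i)"
        proof (cases "V i = {}")
          case False
          then have ne: "U i \<noteq> {}" by (auto simp: V_def)
          have "0 \<le> diameter (V i)" using diameter_ge_0 dV(2) by blast
          then have "(diameter (V i) / 2) ^ d \<le> C ^ d * (diameter (U i) / 2) ^ d"
            unfolding power_mult_distrib[symmetric] using dV(1)[of i] by (intro power_mono) auto
          then have "unit_ball_vol (real d) * (diameter (V i) / 2) ^ d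
              \<le> C ^ d * (unit_ball_vol (real d) * (diameter (U i) / 2) ^ d)"
            using unit_ball_vol_nonneg[of d] by (simp add: mult_left_mono mult.left_commute)
          then show ?thesis
            using False ne C by (simp add: hausdorff_gauge_def ennreal_mult'[symmetric] ennreal_leI)
        qed simp
      qed
      also have "\<dots> = ennreal (C ^ d) * (\<Sum>i. hausdorff_gauge d (U i))" by simp
      finally show ?thesis .
    qed
    then show ?thesis
      unfolding hausdorff_content_def[of d \<delta> A] using C by (intro ennreal_le_mult_INF) auto
  qed
  show ?thesis
    unfolding hausdorff_outer_def[of d "f ` A"]
  proof (rule SUP_least)
    fix \<delta> :: real assume "\<delta> \<in> {0<..}"
    then have "hausdorff_content d \<delta> (f ` A) \<le> ennreal (C ^ d) * hausdorff_content d (\<delta> / C) A"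
      using content[of "\<delta> / C"] C by simp
    also have "\<dots> \<le> ennreal (C ^ d) * hausdorff_outer d A"
      unfolding hausdorff_outer_def using C \<open>\<delta> \<in> {0<..}\<close>
      by (intro mult_left_mono SUP_upper) auto
    finally show "hausdorff_content d \<delta> (f ` A) \<le> ennreal (C ^ d) * hausdorff_outer d A" .
  qed
qed

text \<open>On \<open>A\<close> the map \<open>f\<close> factors through \<open>g\<close>, because
  equal values of \<open>g\<close> force equal values of \<open>f\<close>; the factor
  \<open>h\<close> is Lipschitz on the image of \<open>g\<close>. Comparing two images of one set
  spares the construction of inverse maps later.\<close>

lemma hausdorff_outer_image_compare:
  assumes C: "C > 0" and le: "\<And>x y. x \<in> A \<Longrightarrow> y \<in> A \<Longrightarrow> dist (f x) (f y) \<le> C * dist (g x) (g y)"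
  shows "hausdorff_outer d (f ` A) \<le> ennreal (C ^ d) * hausdorff_outer d (g ` A)"
proof -
  define h where "h z = f (SOME x. x \<in> A \<and> g x = z)" for z
  have h: "h (g x) = f x" if "x \<in> A" for x
  proof -
    have "(SOME y. y \<in> A \<and> g y = g x) \<in> A \<and> g (SOME y. y \<in> A \<and> g y = g x) = g x"
      by (rule someI[of "\<lambda>y. y \<in> A \<and> g y = g x"]) (use that in simp)
    then have "dist (h (g x)) (f x) \<le> C * 0"
      unfolding h_def using le[of "SOME y. y \<in> A \<and> g y = g x" x] that by simp
    then show ?thesis by simp
  qed
  have "hausdorff_outer d (h ` (g ` A)) \<le> ennreal (C ^ d) * hausdorff_outer d (g ` A)"
    using le h by (intro hausdorff_outer_image_le[OF C]) auto
  moreover have "h ` (g ` A) = f ` A" using h by force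
  ultimately show ?thesis by simp
qed

lemma hausdorff_outer_image_isometric:
  assumes eq: "\<And>x y. x \<in> A \<Longrightarrow> y \<in> A \<Longrightarrow> dist (f x) (f y) = dist (g x) (g y)"
  shows "hausdorff_outer d (f ` A) = hausdorff_outer d (g ` A)"
  using hausdorff_outer_image_compare[of 1 A f g d] hausdorff_outer_image_compare[of 1 A g f d] eq
  by (auto intro: antisym)

lemma hausdorff_outer_isometry:
  assumes "\<And>x y. x \<in> A \<Longrightarrow> y \<in> A \<Longrightarrow> dist (f x) (f y) = dist x y"
  shows "hausdorff_outer d (f ` A) = hausdorff_outer d A"
  using hausdorff_outer_image_isometric[of A f "\<lambda>x. x" d] assms by simp

lemma hausdorff_outer_scaleR:
  fixes A :: "'a::real_normed_vector set"
  assumes "c > 0"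
  shows "hausdorff_outer d ((\<lambda>x. c *\<^sub>R x) ` A) = ennreal (c ^ d) * hausdorff_outer d A"
proof (rule antisym)
  have "dist (c *\<^sub>R x) (c *\<^sub>R y) = c * dist x y" for x y :: 'a
    using assms by (simp add: dist_norm scaleR_diff_right[symmetric])
  then show "hausdorff_outer d ((\<lambda>x. c *\<^sub>R x) ` A) \<le> ennreal (c ^ d) * hausdorff_outer d A"
    using assms by (intro hausdorff_outer_image_le) auto
  have "hausdorff_outer d A \<le> ennreal ((1/c) ^ d) * hausdorff_outer d ((\<lambda>x. c *\<^sub>R x) ` A)"
    using hausdorff_outer_image_compare[of "1/c" A "\<lambda>x. x" "\<lambda>x. c *\<^sub>R x" d] assms
      \<open>\<And>x y. dist (c *\<^sub>R x) (c *\<^sub>R y) = c * dist x y\<close> by simp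
  then have "ennreal (c ^ d) * hausdorff_outer d A
      \<le> ennreal (c ^ d) * (ennreal ((1/c) ^ d) * hausdorff_outer d ((\<lambda>x. c *\<^sub>R x) ` A))"
    by (intro mult_left_mono) auto
  also have "\<dots> = hausdorff_outer d ((\<lambda>x. c *\<^sub>R x) ` A)"
    using assms by (simp add: mult.assoc[symmetric] ennreal_mult'[symmetric] power_mult_distrib[symmetric])
  finally show "ennreal (c ^ d) * hausdorff_outer d A \<le> hausdorff_outer d ((\<lambda>x. c *\<^sub>R x) ` A)" .
qed

lemma hausdorff_outer_UN_le:
  assumes "finite I"
  shows "hausdorff_outer d (\<Union>i\<in>I. A i) \<le> (\<Sum>i\<in>I. hausdorff_outer d (A i))"
  using assms
proof (induction I rule: finite_induct)
  case (insert i I)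
  then show ?case
    using hausdorff_outer_Un[of d "A i" "\<Union>i\<in>I. A i"] by (auto intro: order_trans add_left_mono)
qed simp

section \<open>Finiteness on bounded parts of hyperplanes and on the sphere\<close>

lemma hausdorff_content_finite_cover:
  assumes "finite I" and cov: "A \<subseteq> (\<Union>i\<in>I. U i)" and "\<delta> \<ge> 0"
    and bd: "\<And>i. i \<in> I \<Longrightarrow> bounded (U i)" and dm: "\<And>i. i \<in> I \<Longrightarrow> diameter (U i) \<le> \<delta>"
  shows "hausdorff_content d \<delta> A \<le> ennreal (real (card I) * (unit_ball_vol (real d) * (\<delta> / 2) ^ d))"
proof -
  obtain h where h: "bij_betw h {0..<card I} I"
    using ex_bij_betw_nat_finite[OF \<open>finite I\<close>] by blast
  define V where "V i = (if i < card I then U (h i) else {})" for i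
  have hI: "h i \<in> I" if "i < card I" for i using h that by (auto simp: bij_betw_def)
  have "V \<in> hausdorff_covers \<delta> A"
  proof -
    have "A \<subseteq> (\<Union>i. V i)"
    proof
      fix x assume "x \<in> A"
      then obtain j where "j \<in> I" "x \<in> U j" using cov by blast
      obtain i where "i < card I" "h i = j" using h \<open>j \<in> I\<close> by (force simp: bij_betw_def)
      with \<open>x \<in> U j\<close> have "x \<in> V i" by (simp add: V_def)
      then show "x \<in> (\<Union>i. V i)" by blast
    qed
    then show ?thesis using hI bd dm \<open>\<delta> \<ge> 0\<close> by (auto simp: hausdorff_covers_def V_def)
  qed
  then have "hausdorff_content d \<delta> A \<le> (\<Sum>i. hausdorff_gauge d (V i))"
    unfolding hausdorff_content_def by (rule INF_lower)
  also have "\<dots> = (\<Sum>i<card I. hausdorff_gauge d (V i))"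
    by (rule suminf_finite) (auto simp: V_def)
  also have "\<dots> \<le> (\<Sum>i<card I. ennreal (unit_ball_vol (real d) * (\<delta> / 2) ^ d))"
  proof (rule sum_mono)
    fix i assume i: "i \<in> {..<card I}"
    show "hausdorff_gauge d (V i) \<le> ennreal (unit_ball_vol (real d) * (\<delta> / 2) ^ d)"
      using i hI[of i] bd dm diameter_ge_0[OF bd[OF hI[of i]]]
      by (auto simp: hausdorff_gauge_def V_def intro!: ennreal_leI mult_left_mono power_mono)
  qed
  also have "\<dots> = ennreal (real (card I) * (unit_ball_vol (real d) * (\<delta> / 2) ^ d))"
    using \<open>\<delta> \<ge> 0\<close> by (simp add: ennreal_mult' ennreal_of_nat_eq_real_of_nat)
  finally show ?thesis .
qed

text \<open>A grid with N cells per direction has \<open>N ^ (n - 1)\<close> cells in the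
  hyperplane, each of gauge proportional to \<open>(1 / N) ^ (n - 1)\<close>. The total
  \<open>K\<close> is therefore the same for every N.\<close>

lemma hausdorff_outer_bounded_hyperplane_finite:
  fixes A :: "(real ^ 'n) set"
  assumes "bounded A" and A: "\<And>x. x \<in> A \<Longrightarrow> x $ k = 0"
  shows "hausdorff_outer (CARD('n) - 1) A < \<infinity>"
proof -
  let ?d = "CARD('n) - 1"
  obtain R0 where R0: "\<And>x. x \<in> A \<Longrightarrow> norm x \<le> R0" using \<open>bounded A\<close> by (auto simp: bounded_iff)
  define R where "R = max R0 0 + 1"
  have R: "R > 0" by (simp add: R_def)
  have cR: "- R < x $ i" "x $ i < R" if "x \<in> A" for x i
    using R0[OF that] component_le_norm_cart[of x i] by (auto simp: R_def)
  define K where "K = unit_ball_vol (real ?d) * (real CARD('n) * R) ^ ?d"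
  have grid: "hausdorff_content ?d (real CARD('n) * (2 * R / real N)) A \<le> ennreal K" if N: "N > 0" for N :: nat
  proof -
    \<comment> \<open>The k-th value of an index is forced to be 0, which makes the number of cells
      \<open>N ^ (CARD('n) - 1)\<close>.\<close>
    define I where "I = PiE (UNIV :: 'n set) (\<lambda>i. if i = k then {0} else {..<N})"
    define U where "U f = {x. x $ k = 0 \<and> (\<forall>i. i \<noteq> k \<longrightarrow>
        x $ i \<in> {- R + 2 * R / real N * real (f i) .. - R + 2 * R / real N * (real (f i) + 1)})}"
      for f :: "'n \<Rightarrow> nat"
    have diff: "norm (x - y) \<le> real CARD('n) * (2 * R / real N)" if "x \<in> U f" "y \<in> U f" for x y f
    proof -
      have "\<bar>(x - y) $ i\<bar> \<le> 2 * R / real N" for i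
      proof (cases "i = k")
        case True
        then show ?thesis using that R by (simp add: U_def)
      next
        case False
        then have "x $ i \<in> {- R + 2 * R / real N * real (f i) .. - R + 2 * R / real N * (real (f i) + 1)}"
          "y $ i \<in> {- R + 2 * R / real N * real (f i) .. - R + 2 * R / real N * (real (f i) + 1)}"
          using that by (auto simp: U_def)
        then show ?thesis by (simp add: distrib_left abs_le_iff)
      qed
      then have "(\<Sum>i\<in>UNIV. \<bar>(x - y) $ i\<bar>) \<le> (\<Sum>i\<in>(UNIV :: 'n set). 2 * R / real N)" by (intro sum_mono)
      with norm_le_l1_cart[of "x - y"] show ?thesis by simp
    qed
    have "hausdorff_content ?d (real CARD('n) * (2 * R / real N)) A
        \<le> ennreal (real (card I) * (unit_ball_vol (real ?d) * (real CARD('n) * (2 * R / real N) / 2) ^ ?d))"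
    proof (rule hausdorff_content_finite_cover[where U = U])
      show "finite I" by (auto simp: I_def intro!: finite_PiE)
      show "0 \<le> real CARD('n) * (2 * R / real N)" using R by simp
      fix f
      show "bounded (U f)"
        using diff[of _ f] by (auto simp: bounded_two_points dist_norm)
      show "diameter (U f) \<le> real CARD('n) * (2 * R / real N)"
        using diff[of _ f] R by (intro diameter_le) auto
    next
      show "A \<subseteq> (\<Union>f\<in>I. U f)"
      proof
        fix x assume x: "x \<in> A"
        \<comment> \<open>Coordinates are strictly below \<open>R\<close>, so \<open>t i < N\<close>
          and the floor is a legal cell index.\<close>
        define t where "t i = (x $ i + R) * real N / (2 * R)" for i
        define f where "f i = (if i = k then 0 else nat \<lfloor>t i\<rfloor>)" for i
        have t: "0 \<le> t i" "t i < real N" for i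
          using cR[OF x, of i] R N mult_strict_right_mono[of "x $ i + R" "2 * R" "real N"]
          by (auto simp: t_def pos_divide_less_eq mult.commute)
        have xt: "x $ i = - R + 2 * R / real N * t i" for i
          using R N by (simp add: t_def field_simps)
        have "f \<in> I" using t by (auto simp: I_def f_def floor_less_iff nat_less_iff)
        moreover have "x \<in> U f"
        proof -
          have "x $ i \<in> {- R + 2 * R / real N * real (f i) .. - R + 2 * R / real N * (real (f i) + 1)}"
            if "i \<noteq> k" for i
          proof -
            have "real (f i) \<le> t i" "t i \<le> real (f i) + 1"
              using that t(1)[of i] by (auto simp: f_def)
            then show ?thesis
              using R N mult_left_mono[of "real (f i)" "t i" "2 * R / real N"]
                mult_left_mono[of "t i" "real (f i) + 1" "2 * R / real N"]
              by (simp add: xt[of i])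
          qed
          then show ?thesis using A[OF x] by (auto simp: U_def)
        qed
        ultimately show "x \<in> (\<Union>f\<in>I. U f)" by blast
      qed
    qed
    also have "real (card I) = real N ^ ?d"
    proof -
      have "card I = (\<Prod>i\<in>(UNIV :: 'n set). if i = k then 1 else N)"
        unfolding I_def by (subst card_PiE) (auto intro!: prod.cong)
      also have "\<dots> = N ^ ?d"
        by (subst prod.remove[of _ k]) auto
      finally show ?thesis by simp
    qed
    also have "real N ^ ?d * (unit_ball_vol (real ?d) * (real CARD('n) * (2 * R / real N) / 2) ^ ?d) = K"
      using N by (simp add: K_def power_mult_distrib power_divide)
    finally show ?thesis .
  qed
  have "hausdorff_outer ?d A \<le> ennreal K"
    unfolding hausdorff_outer_def
  proof (rule SUP_least)
    fix \<delta> :: real assume "\<delta> \<in> {0<..}"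
    obtain N :: nat where N0: "real N > max 0 (real CARD('n) * (2 * R) / \<delta>)"
      using reals_Archimedean2 by blast
    then have N: "real CARD('n) * (2 * R) / \<delta> < real N" "N > 0" by linarith+
    then have "real CARD('n) * (2 * R) \<le> \<delta> * real N"
      using \<open>\<delta> \<in> {0<..}\<close> by (simp add: pos_divide_less_eq mult.commute)
    then have "real CARD('n) * (2 * R / real N) \<le> \<delta>"
      using N(2) by (simp add: pos_divide_le_eq)
    then show "hausdorff_content ?d \<delta> A \<le> ennreal K"
      using grid[OF N(2)] hausdorff_content_antimono order_trans by blast
  qed
  then show ?thesis using le_less_trans by (auto simp: less_top[symmetric] top_unique)
qed

text \<open>The difference splits into a change of the vector and a change of its length; each part
  is at most \<open>dist y z\<close> because both norms are at least 1. The constant is crude, as it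
  serves only to show finiteness.\<close>

lemma dist_normalized_le:
  fixes y z :: "'a::real_inner"
  assumes "norm y \<ge> 1" "norm z \<ge> 1"
  shows "dist (y /\<^sub>R norm y) (z /\<^sub>R norm z) \<le> 2 * dist y z"
proof -
  have eq: "y /\<^sub>R norm y - z /\<^sub>R norm z = (y - z) /\<^sub>R norm y + ((norm z - norm y) / (norm y * norm z)) *\<^sub>R z"
  proof -
    have "norm y > 0" "norm z > 0" using assms by linarith+
    then have "(norm z - norm y) / (norm y * norm z) = inverse (norm y) - inverse (norm z)"
      by (simp add: field_simps)
    then show ?thesis by (simp add: scaleR_diff_right scaleR_diff_left)
  qed
  have "norm (y /\<^sub>R norm y - z /\<^sub>R norm z) \<le> norm (y - z) / norm y + \<bar>norm z - norm y\<bar> / norm y"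
  proof -
    have "y \<noteq> 0" "z \<noteq> 0" using assms by auto
    then have "norm (((norm z - norm y) / (norm y * norm z)) *\<^sub>R z) = \<bar>norm z - norm y\<bar> / norm y"
      by (simp add: abs_mult)
    moreover have "norm ((y - z) /\<^sub>R norm y) = norm (y - z) / norm y"
      by (simp add: divide_inverse_commute)
    ultimately show ?thesis
      using eq norm_triangle_ineq[of "(y - z) /\<^sub>R norm y" "((norm z - norm y) / (norm y * norm z)) *\<^sub>R z"]
      by simp
  qed
  also have "\<dots> \<le> norm (y - z) / norm y + norm (y - z) / norm y"
    using assms norm_triangle_ineq3[of z y] by (intro add_left_mono divide_right_mono) (auto simp: norm_minus_commute)
  also have "\<dots> \<le> norm (y - z) + norm (y - z)"
    using assms by (intro add_mono) (auto simp: divide_le_eq intro: mult_left_mono[of 1 "norm y" "norm (y-z)", simplified])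
  finally show ?thesis by (simp add: dist_norm)
qed

text \<open>The sphere is covered by radial projections of flat discs, two opposite ones for each
  coordinate. The discs stay outside the open unit ball, where the projection is Lipschitz.\<close>

lemma hausdorff_outer_sphere_finite:
  "hausdorff_outer (CARD('n) - 1) (sphere (0 :: real ^ 'n) 1) < \<infinity>"
proof -
  let ?d = "CARD('n) - 1"
  \<comment> \<open>The radius is \<open>CARD('n)\<close> because a unit vector has a coordinate of
    absolute value at least \<open>1 / CARD('n)\<close>, and dividing by it leaves a vector of norm
    at most \<open>CARD('n)\<close>.\<close>
  define B where "B k = {u :: real ^ 'n. u $ k = 0 \<and> norm u \<le> real CARD('n)}" for k
  define g where "g k s u = (s *\<^sub>R axis k 1 + u) /\<^sub>R norm (s *\<^sub>R axis k 1 + u)" for k :: 'n and s :: real and u :: "real ^ 'n"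
  define I where "I = (UNIV :: 'n set) \<times> {-1, 1 :: real}"
  have ge1: "norm (s *\<^sub>R axis k 1 + u) \<ge> 1" if "u \<in> B k" "s \<in> {-1, 1}" for k s u
    using component_le_norm_cart[of "s *\<^sub>R axis k 1 + u" k] that by (auto simp: B_def)
  have fin: "hausdorff_outer ?d (g k s ` B k) < \<infinity>" if "s \<in> {-1, 1}" for k s
  proof -
    have "dist (g k s u) (g k s v) \<le> 2 * dist u v" if "u \<in> B k" "v \<in> B k" for u v
      unfolding g_def using dist_normalized_le[OF ge1[OF that(1) \<open>s \<in> _\<close>] ge1[OF that(2) \<open>s \<in> _\<close>]]
      by simp
    then have "hausdorff_outer ?d (g k s ` B k) \<le> ennreal (2 ^ ?d) * hausdorff_outer ?d (B k)"
      by (intro hausdorff_outer_image_le) auto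
    also have "hausdorff_outer ?d (B k) < \<infinity>"
      by (rule hausdorff_outer_bounded_hyperplane_finite[where k = k]) (auto simp: B_def bounded_iff)
    then have "ennreal (2 ^ ?d) * hausdorff_outer ?d (B k) < \<infinity>"
      by (simp add: ennreal_mult_less_top)
    finally show ?thesis .
  qed
  have "sphere (0 :: real ^ 'n) 1 \<subseteq> (\<Union>(k, s)\<in>I. g k s ` B k)"
  proof
    fix v :: "real ^ 'n" assume "v \<in> sphere 0 1"
    then have nv: "norm v = 1" by simp
    have "\<exists>k. \<bar>v $ k\<bar> \<ge> 1 / real CARD('n)"
    proof (rule ccontr)
      assume "\<not> ?thesis"
      then have "(\<Sum>i\<in>UNIV. \<bar>v $ i\<bar>) < (\<Sum>i\<in>(UNIV :: 'n set). 1 / real CARD('n))"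
        by (intro sum_strict_mono) (auto simp: not_le)
      with norm_le_l1_cart[of v] nv show False by simp
    qed
    then obtain k where k: "\<bar>v $ k\<bar> \<ge> 1 / real CARD('n)" by blast
    then have "\<bar>v $ k\<bar> > 0" by (smt (verit) divide_pos_pos of_nat_0_less_iff zero_less_card_finite)
    define s where "s = sgn (v $ k)"
    define u where "u = v /\<^sub>R \<bar>v $ k\<bar> - s *\<^sub>R axis k 1"
    have s: "s \<in> {-1, 1}" using \<open>\<bar>v $ k\<bar> > 0\<close> by (auto simp: s_def sgn_real_def)
    have uk: "u $ k = 0" using \<open>\<bar>v $ k\<bar> > 0\<close>
      by (simp add: u_def s_def sgn_real_def abs_if split: if_splits)
    have "norm u \<le> norm (v /\<^sub>R \<bar>v $ k\<bar>)"
    proof (rule norm_le_componentwise_cart)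
      fix i show "norm (u $ i) \<le> norm ((v /\<^sub>R \<bar>v $ k\<bar>) $ i)"
        using uk by (cases "i = k") (auto simp: u_def axis_def)
    qed
    also have "\<dots> \<le> real CARD('n)"
      using k \<open>\<bar>v $ k\<bar> > 0\<close> nv by (simp add: field_simps)
    finally have "u \<in> B k" using uk by (simp add: B_def)
    moreover have "g k s u = v"
      using \<open>\<bar>v $ k\<bar> > 0\<close> nv by (simp add: g_def u_def)
    ultimately show "v \<in> (\<Union>(k, s)\<in>I. g k s ` B k)" using s by (force simp: I_def)
  qed
  then have "hausdorff_outer ?d (sphere (0 :: real ^ 'n) 1) \<le> hausdorff_outer ?d (\<Union>(k, s)\<in>I. g k s ` B k)"
    by (rule hausdorff_outer_mono)
  also have "\<dots> \<le> (\<Sum>i\<in>I. hausdorff_outer ?d (case i of (k, s) \<Rightarrow> g k s ` B k))"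
    by (rule hausdorff_outer_UN_le) (auto simp: I_def)
  also have "\<dots> < \<infinity>"
    using fin by (auto simp: I_def less_top[symmetric])
  finally show ?thesis .
qed

section \<open>Hausdorff measure on hyperplanes\<close>

definition drop_coord :: "'n \<Rightarrow> real ^ 'n \<Rightarrow> real ^ 'n" where
  "drop_coord k z = z - (z $ k) *\<^sub>R axis k 1"

text \<open>A cylinder of thickness 1. For \<open>A\<close> inside the hyperplane
  \<open>x $ k = 0\<close>, its volume is the (n-1)-dimensional Lebesgue measure of
  \<open>A\<close>, expressed without leaving the type \<open>real ^ 'n\<close>.\<close>

definition slab :: "'n \<Rightarrow> (real ^ 'n) set \<Rightarrow> (real ^ 'n) set" where
  "slab k A = {z. drop_coord k z \<in> A \<and> z $ k \<in> {0..1}}"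

lemma drop_coord_nth [simp]: "drop_coord k z $ i = (if i = k then 0 else z $ i)"
  by (simp add: drop_coord_def axis_def)

lemma drop_coord_add: "drop_coord k (x + y) = drop_coord k x + drop_coord k y"
  by (simp add: vec_eq_iff)

lemma drop_coord_id: "x $ k = 0 \<Longrightarrow> drop_coord k x = x"
  by (simp add: vec_eq_iff)

lemma borel_measurable_drop_coord [measurable]: "drop_coord k \<in> borel_measurable borel"
  unfolding drop_coord_def
  by (intro borel_measurable_continuous_onI continuous_intros)

lemma borel_measurable_vec_nth' [measurable]: "(\<lambda>x :: real ^ 'n. x $ i) \<in> borel_measurable borel"
  by (intro borel_measurable_continuous_onI continuous_intros)

lemma sets_slab [measurable]: "A \<in> sets borel \<Longrightarrow> slab k A \<in> sets borel"
proof -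
  assume [measurable]: "A \<in> sets borel"
  have "slab k A = drop_coord k -` A \<inter> (\<lambda>z. z $ k) -` {0..1}" by (auto simp: slab_def)
  moreover have "drop_coord k -` A \<in> sets borel" by (rule measurable_sets_borel) measurable
  moreover have "(\<lambda>z :: real ^ 'a. z $ k) -` {0..1} \<in> sets borel" by (rule measurable_sets_borel) measurable
  ultimately show ?thesis by auto
qed

lemma hausdorff_outer_translation:
  fixes A :: "'a::real_normed_vector set"
  shows "hausdorff_outer d ((\<lambda>x. x + a) ` A) = hausdorff_outer d A"
  by (rule hausdorff_outer_isometry) (simp add: dist_norm)

text \<open>Translation invariance determines a locally finite measure on a hyperplane up to a factor:
  evaluate the double integral of \<open>1\<^sub>A (x + y) 1\<^sub>B (y)\<close> in both orders.\<close>

lemma hausdorff_outer_hyperplane_slab: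
  obtains \<kappa> where "\<And>A. A \<in> sets borel \<Longrightarrow> (\<And>x. x \<in> A \<Longrightarrow> x $ k = 0) \<Longrightarrow>
     hausdorff_outer (CARD('n) - 1) A = \<kappa> * emeasure lborel (slab k (A :: (real ^ 'n) set))"
proof -
  let ?d = "CARD('n) - 1"
  let ?P = "drop_coord k :: real ^ 'n \<Rightarrow> real ^ 'n"
  define T where "T = {x :: real ^ 'n. x $ k = 0}"
  define B where "B = cbox 0 (1 :: real ^ 'n)"
  \<comment> \<open>Restriction to the hyperplane makes the measure sigma-finite, as Fubini
    requires; on the whole space it is not.\<close>
  define M where "M = density (hausdorff_measure ?d) (indicator T :: real ^ 'n \<Rightarrow> ennreal)"
  have [measurable]: "T \<in> sets borel"
    using measurable_sets_borel[OF borel_measurable_vec_nth'[of k], of "{0}"] by (simp add: T_def vimage_def)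
  have [measurable]: "B \<in> sets borel" by (simp add: B_def)
  have memB: "x \<in> B \<longleftrightarrow> (\<forall>i. 0 \<le> x $ i \<and> x $ i \<le> 1)" for x by (simp add: B_def mem_box_cart)
  have B1: "emeasure lborel B = 1"
    by (simp add: B_def emeasure_lborel_cbox_eq Basis_vec_def inner_axis prod.neutral)
  have sM [measurable_cong]: "sets M = sets borel" by (simp add: M_def)
  have eM: "emeasure M X = hausdorff_outer ?d (T \<inter> X)" if "X \<in> sets borel" for X
    using that by (simp add: M_def emeasure_restricted emeasure_hausdorff_measure)
  have nnM: "(\<integral>\<^sup>+x. indicator X x \<partial>M) = hausdorff_outer ?d (T \<inter> X)" if "X \<in> sets borel" for X
    using eM[OF that] that by (simp add: sM)
  interpret M: sigma_finite_measure M
  proof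
    have "emeasure M (ball 0 (real n)) \<noteq> \<infinity>" for n
    proof -
      have "hausdorff_outer ?d (T \<inter> ball 0 (real n)) < \<infinity>"
        by (rule hausdorff_outer_bounded_hyperplane_finite[where k = k]) (auto simp: T_def)
      then show ?thesis by (simp add: eM)
    qed
    moreover have "(\<Union>n. ball 0 (real n)) = (UNIV :: (real ^ 'n) set)"
      by (force intro: reals_Archimedean2)
    moreover have "space M = UNIV" by (simp add: M_def)
    ultimately show "\<exists>A. countable A \<and> A \<subseteq> sets M \<and> \<Union>A = space M \<and> (\<forall>a\<in>A. emeasure M a \<noteq> \<infinity>)"
      by (intro exI[of _ "range (\<lambda>n. ball 0 (real n))"]) (auto simp: sM)
  qed
  interpret P: pair_sigma_finite M "lborel :: (real ^ 'n) measure" ..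
  \<comment> \<open>The reflection comes from the substitution \<open>y = z - x\<close> below. The
    value of \<kappa> is never computed: later comparisons carry it on both sides.\<close>
  define \<kappa> where "\<kappa> = emeasure M {x. - x \<in> B}"
  show ?thesis
  proof (rule that[of \<kappa>])
    fix A :: "(real ^ 'n) set" assume [measurable]: "A \<in> sets borel" and A: "\<And>x. x \<in> A \<Longrightarrow> x $ k = 0"
    have inner: "(\<integral>\<^sup>+x. indicator A (?P x + ?P y) \<partial>M) = hausdorff_outer ?d A" for y
    proof -
      have "(\<integral>\<^sup>+x. indicator A (?P x + ?P y) \<partial>M) = (\<integral>\<^sup>+x. indicator {x. ?P x + ?P y \<in> A} x \<partial>M)"
        by (intro nn_integral_cong) (auto split: split_indicator)
      also have "\<dots> = hausdorff_outer ?d (T \<inter> {x. ?P x + ?P y \<in> A})"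
        by (rule nnM) measurable
      also have "\<dots> = hausdorff_outer ?d ((\<lambda>x. x + ?P y) ` (T \<inter> {x. ?P x + ?P y \<in> A}))"
        by (rule hausdorff_outer_translation[symmetric])
      also have "(\<lambda>x. x + ?P y) ` (T \<inter> {x. ?P x + ?P y \<in> A}) = A"
      proof
        show "A \<subseteq> (\<lambda>x. x + ?P y) ` (T \<inter> {x. ?P x + ?P y \<in> A})"
        proof
          fix a assume "a \<in> A"
          then show "a \<in> (\<lambda>x. x + ?P y) ` (T \<inter> {x. ?P x + ?P y \<in> A})"
            using A[of a] by (intro image_eqI[of _ _ "a - ?P y"]) (auto simp: T_def drop_coord_id)
        qed
      qed (auto simp: T_def drop_coord_id)
      finally show ?thesis .
    qed
    have shift: "(\<integral>\<^sup>+y. indicator A (?P x + ?P y) * indicator B y \<partial>lborel)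
        = (\<integral>\<^sup>+z. indicator A (?P z) * indicator B (z - x) \<partial>lborel)" for x
    proof -
      have "(\<integral>\<^sup>+z. indicator A (?P z) * indicator B (z - x) \<partial>lborel)
          = (\<integral>\<^sup>+z. indicator A (?P z) * indicator B (z - x) \<partial>distr lborel borel ((+) x))"
        by (simp add: lborel_distr_plus)
      also have "\<dots> = (\<integral>\<^sup>+y. indicator A (?P (x + y)) * indicator B (x + y - x) \<partial>lborel)"
        by (subst nn_integral_distr) auto
      finally show ?thesis by (simp add: drop_coord_add)
    qed
    \<comment> \<open>For fixed \<open>z\<close>, the points \<open>x\<close> of the hyperplane with
      \<open>z - x\<close> in the cube form a translate of the set measured by \<kappa> if the k-th
      coordinate of \<open>z\<close> is in [0, 1], and do not exist otherwise. This produces the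
      slab.\<close>
    have slice: "(\<integral>\<^sup>+x. indicator A (?P z) * indicator B (z - x) \<partial>M) = \<kappa> * indicator (slab k A) z" for z
    proof (cases "z \<in> slab k A")
      case True
      then have z: "?P z \<in> A" "0 \<le> z $ k" "z $ k \<le> 1" by (auto simp: slab_def)
      have "(\<integral>\<^sup>+x. indicator A (?P z) * indicator B (z - x) \<partial>M) = (\<integral>\<^sup>+x. indicator {x. z - x \<in> B} x \<partial>M)"
        using z by (intro nn_integral_cong) (auto split: split_indicator)
      also have "\<dots> = hausdorff_outer ?d (T \<inter> {x. z - x \<in> B})"
        by (rule nnM) measurable
      also have "T \<inter> {x. z - x \<in> B} = (\<lambda>x. x + ?P z) ` (T \<inter> {x. - x \<in> B})"
      proof (intro equalityI subsetI)
        fix x assume x: "x \<in> T \<inter> {x. z - x \<in> B}"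
        have "- (x - ?P z) \<in> B"
          unfolding memB
        proof
          fix i show "0 \<le> (- (x - ?P z)) $ i \<and> (- (x - ?P z)) $ i \<le> 1"
            using x z by (cases "i = k") (auto simp: T_def memB)
        qed
        then show "x \<in> (\<lambda>x. x + ?P z) ` (T \<inter> {x. - x \<in> B})"
          using x by (intro image_eqI[of _ _ "x - ?P z"]) (auto simp: T_def)
      next
        fix x assume "x \<in> (\<lambda>x. x + ?P z) ` (T \<inter> {x. - x \<in> B})"
        then obtain u where u: "x = u + ?P z" "u $ k = 0" "- u \<in> B" by (auto simp: T_def)
        have "z - x \<in> B"
          unfolding memB
        proof
          fix i show "0 \<le> (z - x) $ i \<and> (z - x) $ i \<le> 1"
            using u z by (cases "i = k") (auto simp: memB)
        qed
        then show "x \<in> T \<inter> {x. z - x \<in> B}" using u by (simp add: T_def)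
      qed
      also have "hausdorff_outer ?d \<dots> = \<kappa>"
        unfolding hausdorff_outer_translation \<kappa>_def by (intro eM[symmetric]) measurable
      finally show ?thesis using True by simp
    next
      case False
      show ?thesis
      proof (cases "?P z \<in> A")
        case True
        with False have "\<not> (0 \<le> z $ k \<and> z $ k \<le> 1)" by (auto simp: slab_def)
        then have "T \<inter> {x. z - x \<in> B} = {}"
          by (auto simp: T_def memB dest: spec[of _ k])
        moreover have "(\<integral>\<^sup>+x. indicator A (?P z) * indicator B (z - x) \<partial>M) = (\<integral>\<^sup>+x. indicator {x. z - x \<in> B} x \<partial>M)"
          using True by (intro nn_integral_cong) (auto split: split_indicator)
        moreover have "\<dots> = hausdorff_outer ?d (T \<inter> {x. z - x \<in> B})"
          by (rule nnM) measurable
        ultimately show ?thesis using False by simp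
      qed (use False in simp)
    qed
    \<comment> \<open>The cube has volume 1, so its indicator can be inserted at no cost.\<close>
    have "hausdorff_outer ?d A = (\<integral>\<^sup>+y. hausdorff_outer ?d A * indicator B y \<partial>lborel)"
      by (subst nn_integral_cmult_indicator) (auto simp: B1)
    also have "\<dots> = (\<integral>\<^sup>+y. (\<integral>\<^sup>+x. indicator A (?P x + ?P y) * indicator B y \<partial>M) \<partial>lborel)"
      by (subst nn_integral_multc) (auto simp: inner)
    also have "\<dots> = (\<integral>\<^sup>+x. (\<integral>\<^sup>+y. indicator A (?P x + ?P y) * indicator B y \<partial>lborel) \<partial>M)"
      by (rule P.Fubini') measurable
    also have "\<dots> = (\<integral>\<^sup>+x. (\<integral>\<^sup>+z. indicator A (?P z) * indicator B (z - x) \<partial>lborel) \<partial>M)"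
      by (simp add: shift)
    also have "\<dots> = (\<integral>\<^sup>+z. (\<integral>\<^sup>+x. indicator A (?P z) * indicator B (z - x) \<partial>M) \<partial>lborel)"
      by (rule P.Fubini'[symmetric]) measurable
    also have "\<dots> = \<kappa> * emeasure lborel (slab k A)"
      unfolding slice by (subst nn_integral_cmult_indicator) auto
    finally show "hausdorff_outer ?d A = \<kappa> * emeasure lborel (slab k A)" .
  qed
qed

lemma lborel_scale_coord:
  fixes X :: "(real ^ 'n) set"
  assumes [measurable]: "X \<in> sets borel" and "c > 0"
  shows "emeasure lborel X = ennreal c * emeasure lborel ((\<lambda>x. x + ((c - 1) * x $ j) *\<^sub>R axis j 1) -` X)"
proof -
  define b where "b i = (if i = axis j 1 then c else 1)" for i :: "real ^ 'n"
  define D where "D = (\<lambda>x :: real ^ 'n. x + ((c - 1) * x $ j) *\<^sub>R axis j 1)"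
  have D: "D = (\<lambda>x. 0 + (\<Sum>i\<in>Basis. (b i * (x \<bullet> i)) *\<^sub>R i))"
  proof
    fix x
    have J: "axis j 1 \<in> (Basis :: (real ^ 'n) set)" by (simp add: axis_in_Basis_iff)
    have "(\<Sum>i\<in>Basis. (b i * (x \<bullet> i)) *\<^sub>R i)
        = (\<Sum>i\<in>Basis. (x \<bullet> i) *\<^sub>R i + (if i = axis j 1 then ((c - 1) * (x \<bullet> i)) *\<^sub>R i else 0))"
      by (intro sum.cong) (auto simp: b_def algebra_simps)
    also have "\<dots> = x + ((c - 1) * (x \<bullet> axis j 1)) *\<^sub>R axis j 1"
      unfolding sum.distrib using J by (simp add: euclidean_representation)
    finally show "D x = 0 + (\<Sum>i\<in>Basis. (b i * (x \<bullet> i)) *\<^sub>R i)"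
      by (simp add: D_def inner_axis)
  qed
  have [measurable]: "D \<in> borel_measurable borel"
    unfolding D_def by (intro borel_measurable_continuous_onI continuous_intros)
  have prod: "(\<Prod>i\<in>Basis. \<bar>b i\<bar>) = c"
    using \<open>c > 0\<close> by (subst prod.remove[of _ "axis j 1"]) (auto simp: b_def axis_in_Basis_iff intro!: prod.neutral)
  have "lborel = density (distr lborel borel D) (\<lambda>_. \<Prod>i\<in>Basis. \<bar>b i\<bar>)"
    unfolding D by (rule lborel_affine_euclidean) (use \<open>c > 0\<close> in \<open>auto simp: b_def\<close>)
  then have "emeasure lborel X = emeasure (density (distr lborel borel D) (\<lambda>_. ennreal c)) X"
    by (simp add: prod)
  also have "\<dots> = ennreal c * emeasure lborel (D -` X)"
    by (subst emeasure_density_const) (auto simp: emeasure_distr)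
  finally show ?thesis by (simp add: D_def)
qed

text \<open>The stretch commutes with \<open>drop_coord k\<close> and keeps the k-th coordinate, so
  the slab over the image is the stretched slab, whose volume is known. The factor \<kappa> is
  common to both sides and is never divided by.\<close>

lemma hausdorff_outer_scale_coord:
  fixes A :: "(real ^ 'n) set"
  assumes [measurable]: "A \<in> sets borel" and A: "\<And>x. x \<in> A \<Longrightarrow> x $ k = 0" and "j \<noteq> k" and c: "c > 0"
  shows "hausdorff_outer (CARD('n) - 1) ((\<lambda>x. x + ((c - 1) * x $ j) *\<^sub>R axis j 1) ` A)
       = ennreal c * hausdorff_outer (CARD('n) - 1) A"
proof -
  obtain \<kappa> where \<kappa>: "\<And>A. A \<in> sets borel \<Longrightarrow> (\<And>x. x \<in> A \<Longrightarrow> x $ k = 0) \<Longrightarrow>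
     hausdorff_outer (CARD('n) - 1) A = \<kappa> * emeasure lborel (slab k (A :: (real ^ 'n) set))"
    using hausdorff_outer_hyperplane_slab[of k] by blast
  define D where "D c = (\<lambda>x :: real ^ 'n. x + ((c - 1) * x $ j) *\<^sub>R axis j 1)" for c
  have [measurable]: "D c \<in> borel_measurable borel" for c
    unfolding D_def by (intro borel_measurable_continuous_onI continuous_intros)
  have inv: "D (1/c) (D c x) = x" "D c (D (1/c) x) = x" for x
    using c by (auto simp: D_def vec_eq_iff axis_def field_simps)
  have im: "D c ` A = D (1/c) -` A"
  proof (intro equalityI subsetI)
    fix y assume "y \<in> D (1/c) -` A"
    then show "y \<in> D c ` A" using inv(2)[of y] by (intro image_eqI[of _ _ "D (1/c) y"]) auto
  qed (use inv(1) in auto)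
  have DA: "D c ` A \<in> sets borel" unfolding im using measurable_sets[of "D (1/c)" borel borel A] by simp
  have D0: "x $ k = 0" if "x \<in> D c ` A" for x using that A \<open>j \<noteq> k\<close> by (auto simp: D_def axis_def)
  have "hausdorff_outer (CARD('n) - 1) (D c ` A) = \<kappa> * emeasure lborel (slab k (D c ` A))"
    by (rule \<kappa>[OF DA D0])
  also have "emeasure lborel (slab k (D c ` A)) = ennreal c * emeasure lborel (D c -` slab k (D c ` A))"
    unfolding D_def by (rule lborel_scale_coord[OF _ c]) (use DA in \<open>simp add: D_def sets_slab\<close>)
  also have "D c -` slab k (D c ` A) = slab k A"
  proof -
    have "drop_coord k (D c x) = D c (drop_coord k x)" for x
      using \<open>j \<noteq> k\<close> by (simp add: D_def vec_eq_iff axis_def)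
    moreover have "D c y \<in> D c ` A \<longleftrightarrow> y \<in> A" for y using inv by (metis image_iff)
    ultimately show ?thesis using \<open>j \<noteq> k\<close> by (auto simp: slab_def) (auto simp: D_def axis_def)
  qed
  also have "\<kappa> * (ennreal c * emeasure lborel (slab k A)) = ennreal c * hausdorff_outer (CARD('n) - 1) A"
    using \<kappa>[of A] A by (simp add: mult.left_commute)
  finally show ?thesis by (simp add: D_def)
qed

section \<open>Reflections, and linear maps on hyperplanes\<close>

lemma orthogonal_transformation_swap:
  fixes u v :: "'a::real_inner"
  assumes "norm u = norm v"
  shows "\<exists>f. orthogonal_transformation f \<and> f u = v \<and> (\<forall>z. z \<bullet> u = z \<bullet> v \<longrightarrow> f z = z)"
proof -
  define e where "e = u - v"
  \<comment> \<open>Reflection in the hyperplane orthogonal to \<open>u - v\<close>. If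
    \<open>u = v\<close>, division by 0 yields 0 and \<open>f\<close> is the identity.\<close>
  define f where "f z = z - (2 * (z \<bullet> e) / (e \<bullet> e)) *\<^sub>R e" for z
  have "linear f"
    by (rule linearI) (auto simp: f_def inner_add_left algebra_simps add_divide_distrib)
  moreover have "f z \<bullet> f w = z \<bullet> w" for z w
  proof (cases "e = 0")
    case False
    define s t q where "s = z \<bullet> e" and "t = w \<bullet> e" and "q = e \<bullet> e"
    have "q \<noteq> 0" using False by (simp add: q_def)
    have "f z \<bullet> f w = z \<bullet> w - 2 * t / q * s - (2 * s / q * t - 2 * s / q * (2 * t / q * q))"
      unfolding f_def inner_diff_left inner_diff_right inner_scaleR_left inner_scaleR_right
      by (simp add: s_def t_def q_def inner_commute[of e w])
    also have "\<dots> = z \<bullet> w" using \<open>q \<noteq> 0\<close> by (simp add: field_simps)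
    finally show ?thesis .
  qed (simp add: f_def)
  ultimately have "orthogonal_transformation f" by (simp add: orthogonal_transformation_def)
  moreover have "f u = v"
  proof (cases "e = 0")
    case False
    have "u \<bullet> u = v \<bullet> v" using assms by (simp add: norm_eq_sqrt_inner)
    then have "2 * (u \<bullet> e) = e \<bullet> e"
      by (simp add: e_def inner_diff_left inner_diff_right inner_commute)
    then show ?thesis using False by (simp add: f_def e_def)
  qed (simp add: f_def e_def)
  moreover have "f z = z" if "z \<bullet> u = z \<bullet> v" for z
    using that by (simp add: f_def e_def inner_diff_right)
  ultimately show ?thesis by blast
qed

lemma orthogonal_transformation_dist:
  "orthogonal_transformation f \<Longrightarrow> dist (f x) (f y) = dist x y"
  by (metis dist_norm linear_diff orthogonal_transformation orthogonal_transformation_linear)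

lemma orthogonal_transformation_inner:
  "orthogonal_transformation f \<Longrightarrow> f x \<bullet> f y = x \<bullet> y"
  by (simp add: orthogonal_transformation_def)

lemma hausdorff_outer_orthogonal_image:
  "orthogonal_transformation f \<Longrightarrow> hausdorff_outer d (f ` A) = hausdorff_outer d A"
  by (rule hausdorff_outer_isometry) (rule orthogonal_transformation_dist)

lemma borel_orthogonal_image:
  fixes f :: "'a::euclidean_space \<Rightarrow> 'a"
  assumes f: "orthogonal_transformation f" and A: "A \<in> sets borel"
  shows "f ` A \<in> sets borel"
proof -
  have "f ` A = inv f -` A"
    using bij_vimage_eq_inv_image[of "inv f" A] orthogonal_transformation_bij[OF f]
    by (simp add: bij_imp_bij_inv inv_inv_eq)
  moreover have "inv f \<in> borel_measurable borel"
    using orthogonal_transformation_inv[OF f]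
    by (intro borel_measurable_continuous_onI linear_continuous_on linear_linear[THEN iffD2]
        orthogonal_transformation_linear)
  ultimately show ?thesis using A measurable_sets_borel by metis
qed

text \<open>Two reflections reduce this to stretching a coordinate: the first takes \<nu> to an
  axis, the second takes the image of \<open>a\<close> to another axis.\<close>

lemma hausdorff_outer_stretch:
  fixes A :: "(real ^ 'n) set"
  assumes A: "A \<in> sets borel" and perp: "\<And>x. x \<in> A \<Longrightarrow> x \<bullet> \<nu> = 0"
    and unit: "norm \<nu> = 1" "norm a = 1" "a \<bullet> \<nu> = 0" and c: "c > 0"
  shows "hausdorff_outer (CARD('n) - 1) ((\<lambda>x. x + ((c - 1) * (x \<bullet> a)) *\<^sub>R a) ` A)
       = ennreal c * hausdorff_outer (CARD('n) - 1) A"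
proof -
  fix k :: 'n
  have n1: "norm \<nu> = norm (axis k 1 :: real ^ 'n)" using unit by (simp add: norm_axis_1)
  obtain f1 :: "real ^ 'n \<Rightarrow> real ^ 'n" where f1: "orthogonal_transformation f1" "f1 \<nu> = axis k 1"
    using orthogonal_transformation_swap[OF n1] by auto
  have a1k: "f1 a $ k = 0"
    using orthogonal_transformation_inner[OF f1(1), of a \<nu>] f1(2) unit by (simp add: inner_axis)
  have "f1 a \<noteq> 0" using orthogonal_transformation_norm[OF f1(1), of a] unit by auto
  then obtain j where "f1 a $ j \<noteq> 0" by (auto simp: vec_eq_iff)
  with a1k have "j \<noteq> k" by auto
  have n2: "norm (f1 a) = norm (axis j 1 :: real ^ 'n)"
    using orthogonal_transformation_norm[OF f1(1), of a] unit by (simp add: norm_axis_1)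
  obtain f2 :: "real ^ 'n \<Rightarrow> real ^ 'n" where f2: "orthogonal_transformation f2" "f2 (f1 a) = axis j 1"
      and "\<And>z. z \<bullet> f1 a = z \<bullet> axis j 1 \<Longrightarrow> f2 z = z"
    using orthogonal_transformation_swap[OF n2] by auto
  \<comment> \<open>The axis reached first is orthogonal to both vectors exchanged by the second
    reflection and hence is fixed by it.\<close>
  moreover have "axis k 1 \<bullet> f1 a = 0" using a1k by (simp add: inner_axis')
  moreover have "axis k 1 \<bullet> (axis j 1 :: real ^ 'n) = 0" using \<open>j \<noteq> k\<close> by (simp add: inner_axis_axis)
  ultimately have f2k: "f2 (axis k 1) = axis k 1" by metis
  define F where "F = f2 \<circ> f1"
  have F: "orthogonal_transformation F" unfolding F_def
    by (rule orthogonal_transformation_compose[OF f2(1) f1(1)])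
  have Fa: "F a = axis j 1" and F\<nu>: "F \<nu> = axis k 1" using f1 f2 f2k by (auto simp: F_def)
  define D where "D x = x + ((c - 1) * (x \<bullet> a)) *\<^sub>R a" for x
  have FD: "F (D x) = F x + ((c - 1) * F x $ j) *\<^sub>R axis j 1" for x
  proof -
    have "F x $ j = x \<bullet> a"
      using orthogonal_transformation_inner[OF F, of x a] by (simp add: Fa inner_axis)
    then show ?thesis
      using orthogonal_transformation_linear[OF F] by (simp add: D_def linear_add linear_scale Fa)
  qed
  have "hausdorff_outer (CARD('n) - 1) (D ` A) = hausdorff_outer (CARD('n) - 1) (F ` D ` A)"
    by (rule hausdorff_outer_orthogonal_image[OF F, symmetric])
  also have "F ` D ` A = (\<lambda>x. x + ((c - 1) * x $ j) *\<^sub>R axis j 1) ` F ` A"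
    by (simp add: image_image FD)
  also have "hausdorff_outer (CARD('n) - 1) \<dots> = ennreal c * hausdorff_outer (CARD('n) - 1) (F ` A)"
  proof (rule hausdorff_outer_scale_coord[OF borel_orthogonal_image[OF F A] _ \<open>j \<noteq> k\<close> c])
    fix x assume "x \<in> F ` A"
    then show "x $ k = 0"
      using perp orthogonal_transformation_inner[OF F, of _ \<nu>] by (auto simp: F\<nu> inner_axis)
  qed
  also have "hausdorff_outer (CARD('n) - 1) (F ` A) = hausdorff_outer (CARD('n) - 1) A"
    by (rule hausdorff_outer_orthogonal_image[OF F])
  finally show ?thesis by (simp add: D_def)
qed

text \<open>On the hyperplane orthogonal to \<nu>, projecting along \<open>p\<close> changes norms
  exactly as scaling by \<open>\<bar>p \<bullet> \<nu>\<bar>\<close> along the tangential component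
  of \<open>p\<close> does. Equal distances give equal Hausdorff measures, so the two images need
  not be identified.\<close>

lemma hausdorff_outer_project:
  fixes A :: "(real ^ 'n) set"
  assumes A: "A \<in> sets borel" and perp: "\<And>x. x \<in> A \<Longrightarrow> x \<bullet> \<nu> = 0"
    and unit: "norm \<nu> = 1" "norm p = 1" and c: "p \<bullet> \<nu> \<noteq> 0"
  shows "hausdorff_outer (CARD('n) - 1) ((\<lambda>x. x - (x \<bullet> p) *\<^sub>R p) ` A)
       = ennreal \<bar>p \<bullet> \<nu>\<bar> * hausdorff_outer (CARD('n) - 1) A"
proof -
  define c where "c = p \<bullet> \<nu>"
  define q where "q = p - c *\<^sub>R \<nu>"
  have nn: "\<nu> \<bullet> \<nu> = 1" "p \<bullet> p = 1" using unit by (simp_all add: norm_eq_1)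
  have qq: "q \<bullet> q = 1 - c\<^sup>2"
    using nn by (simp add: q_def c_def inner_diff_left inner_diff_right inner_commute power2_eq_square)
  have hq: "h \<bullet> p = h \<bullet> q" if "h \<bullet> \<nu> = 0" for h
    using that by (simp add: q_def inner_diff_right)
  show ?thesis
  proof (cases "q = 0")
    \<comment> \<open>Now \<open>p\<close> is \<nu> or its negative, and the projection fixes every
      point of \<open>A\<close>; there is no tangential direction to scale.\<close>
    case True
    then have "(\<lambda>x. x - (x \<bullet> p) *\<^sub>R p) ` A = (\<lambda>x. x) ` A"
      using hq perp by (intro image_cong) auto
    moreover have "c\<^sup>2 = 1" using qq True by simp
    then have "\<bar>c\<bar> = 1" by (auto simp: power2_eq_1_iff)
    ultimately show ?thesis by (simp add: c_def)
  next
    case False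
    define a where "a = q /\<^sub>R norm q"
    have a: "norm a = 1" "a \<bullet> \<nu> = 0"
      using False nn by (auto simp: a_def q_def c_def inner_diff_left)
    have aq: "(h \<bullet> q)\<^sup>2 = (1 - c\<^sup>2) * (h \<bullet> a)\<^sup>2" for h
    proof -
      have "h \<bullet> q = norm q * (h \<bullet> a)" using False by (simp add: a_def)
      then show ?thesis using qq by (simp add: power_mult_distrib power2_norm_eq_inner)
    qed
    define D where "D x = x + ((\<bar>c\<bar> - 1) * (x \<bullet> a)) *\<^sub>R a" for x
    have "hausdorff_outer (CARD('n) - 1) ((\<lambda>x. x - (x \<bullet> p) *\<^sub>R p) ` A) = hausdorff_outer (CARD('n) - 1) (D ` A)"
    proof (rule hausdorff_outer_image_isometric)
      fix x y assume "x \<in> A" "y \<in> A"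
      define h where "h = x - y"
      have h: "h \<bullet> \<nu> = 0" using perp \<open>x \<in> A\<close> \<open>y \<in> A\<close> by (simp add: h_def inner_diff_left)
      have aa: "a \<bullet> a = 1" using a by (simp add: norm_eq_1)
      have "(norm (h - (h \<bullet> p) *\<^sub>R p))\<^sup>2 = h \<bullet> h - (h \<bullet> p)\<^sup>2"
        unfolding power2_norm_eq_inner using nn
        by (simp add: inner_diff_left inner_diff_right inner_commute power2_eq_square)
      also have "\<dots> = h \<bullet> h - (1 - c\<^sup>2) * (h \<bullet> a)\<^sup>2" using hq[OF h] aq[of h] by simp
      also have "\<dots> = (norm (h + ((\<bar>c\<bar> - 1) * (h \<bullet> a)) *\<^sub>R a))\<^sup>2"
      proof -
        have "(norm (h + ((\<bar>c\<bar> - 1) * (h \<bullet> a)) *\<^sub>R a))\<^sup>2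
            = h \<bullet> h + (2 * (\<bar>c\<bar> - 1) + (\<bar>c\<bar> - 1)\<^sup>2) * (h \<bullet> a)\<^sup>2"
          unfolding power2_norm_eq_inner using aa
          by (simp add: inner_add_left inner_add_right inner_commute power2_eq_square algebra_simps)
        also have "2 * (\<bar>c\<bar> - 1) + (\<bar>c\<bar> - 1)\<^sup>2 = \<bar>c\<bar>\<^sup>2 - 1" by (simp add: power2_eq_square algebra_simps)
        finally show ?thesis by (simp add: algebra_simps)
      qed
      finally have "norm (h - (h \<bullet> p) *\<^sub>R p) = norm (h + ((\<bar>c\<bar> - 1) * (h \<bullet> a)) *\<^sub>R a)"
        by (simp add: power2_eq_iff_nonneg)
      moreover have "x - (x \<bullet> p) *\<^sub>R p - (y - (y \<bullet> p) *\<^sub>R p) = h - (h \<bullet> p) *\<^sub>R p"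
        "D x - D y = h + ((\<bar>c\<bar> - 1) * (h \<bullet> a)) *\<^sub>R a"
        by (simp_all add: h_def D_def inner_diff_left algebra_simps)
      ultimately show "dist (x - (x \<bullet> p) *\<^sub>R p) (y - (y \<bullet> p) *\<^sub>R p) = dist (D x) (D y)"
        by (simp add: dist_norm)
    qed
    also have "\<dots> = ennreal \<bar>c\<bar> * hausdorff_outer (CARD('n) - 1) A"
      unfolding D_def using c by (intro hausdorff_outer_stretch[OF A perp unit(1) a]) (auto simp: c_def)
    finally show ?thesis by (simp add: c_def)
  qed
qed

section \<open>An area formula for Hausdorff measure\<close>

lemma measurable_hausdorff_measure [simp]: "measurable (hausdorff_measure d) N = measurable borel N"
  by (rule measurable_cong_sets) simp_all

text \<open>Sigma-compactness turns images of closed sets into countable unions of compact sets, and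
  injectivity lets images commute with complements. So the sets with Borel image form a
  sigma-algebra containing the closed sets.\<close>

lemma borel_continuous_inj_image:
  fixes f :: "'a::metric_space \<Rightarrow> 'b::metric_space" and K :: "nat \<Rightarrow> 'a set"
  assumes K: "\<And>n. compact (K n)" and S: "S = (\<Union>n. K n)"
    and f: "continuous_on S f" "inj_on f S" and A: "A \<in> sets borel"
  shows "f ` (A \<inter> S) \<in> sets borel"
proof -
  have "A \<in> sigma_sets UNIV {C. closed C}"
    using A unfolding borel_eq_closed by (subst (asm) sets_measure_of) auto
  then show ?thesis
  proof (induction A rule: sigma_sets.induct)
    case (Basic C)
    have "compact (f ` (C \<inter> K n))" for n
      using Basic K[of n] f(1) S
      by (intro compact_continuous_image closed_Int_compact) (auto intro: continuous_on_subset)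
    moreover have "f ` (C \<inter> S) = (\<Union>n. f ` (C \<inter> K n))" by (auto simp: S)
    ultimately show ?case by (auto intro!: sets.countable_UN intro: borel_compact)
  next
    case (Compl A)
    have "compact (f ` K n)" for n
      using K[of n] f(1) S by (intro compact_continuous_image) (auto intro: continuous_on_subset)
    moreover have "f ` S = (\<Union>n. f ` K n)" by (auto simp: S)
    ultimately have "f ` S \<in> sets borel" by (auto intro!: sets.countable_UN intro: borel_compact)
    moreover have "f ` ((UNIV - A) \<inter> S) = f ` S - f ` (A \<inter> S)"
      using f(2) by (auto dest: inj_onD)
    ultimately show ?case using Compl by auto
  next
    case (Union A)
    have "f ` (\<Union> (range A) \<inter> S) = (\<Union>n. f ` (A n \<inter> S))" by auto
    then show ?case using Union by auto
  qed simp
qed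

text \<open>By Lindelof, countably many of the neighbourhoods cover \<open>S\<close>. Made disjoint,
  they cut \<open>A\<close> into Borel pieces on which the inequality holds with the same constant,
  and summation loses nothing.\<close>

lemma locally_dominated_imp_dominated:
  fixes \<mu> \<eta> :: "'a::second_countable_topology set \<Rightarrow> ennreal"
  assumes empty: "\<mu> {} = 0"
    and sub: "\<And>D :: nat \<Rightarrow> 'a set. disjoint_family D \<Longrightarrow> (\<And>i. D i \<in> sets borel \<and> D i \<subseteq> S) \<Longrightarrow>
      \<mu> (\<Union>i. D i) \<le> (\<Sum>i. \<mu> (D i))"
    and sup: "\<And>D :: nat \<Rightarrow> 'a set. disjoint_family D \<Longrightarrow> (\<And>i. D i \<in> sets borel \<and> D i \<subseteq> S) \<Longrightarrow>
      (\<Sum>i. \<eta> (D i)) \<le> \<eta> (\<Union>i. D i)"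
    and loc: "\<And>y. y \<in> S \<Longrightarrow> \<exists>U. open U \<and> y \<in> U \<and>
      (\<forall>A\<in>sets borel. A \<subseteq> S \<inter> U \<longrightarrow> \<mu> A \<le> C * \<eta> A)"
    and A: "A \<in> sets borel" "A \<subseteq> S"
  shows "\<mu> A \<le> C * \<eta> A"
proof -
  obtain U where U: "\<And>y. y \<in> S \<Longrightarrow> open (U y) \<and> y \<in> U y \<and>
      (\<forall>A\<in>sets borel. A \<subseteq> S \<inter> U y \<longrightarrow> \<mu> A \<le> C * \<eta> A)"
    using loc by metis
  obtain \<F> where \<F>: "\<F> \<subseteq> U ` S" "countable \<F>" "\<Union>\<F> = \<Union>(U ` S)"
    using Lindelof[of "U ` S"] U by blast
  \<comment> \<open>The empty set is added so that an enumeration by natural numbers exists even if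
    \<F> is empty.\<close>
  define V where "V = from_nat_into (insert {} \<F>)"
  have rV: "range V = insert {} \<F>"
    unfolding V_def using \<F>(2) by (intro range_from_nat_into) auto
  define D where "D = disjointed (\<lambda>i. A \<inter> V i)"
  have VU: "V i = {} \<or> (\<exists>y\<in>S. V i = U y)" for i
  proof -
    have "V i \<in> insert {} (U ` S)" using rV \<F>(1) by (metis insert_mono rangeI subsetD)
    then show ?thesis by auto
  qed
  have oV: "open (V i)" for i using VU[of i] U by auto
  have Dsub: "D i \<subseteq> A \<inter> V i" for i unfolding D_def by (rule disjointed_subset)
  have Dm: "D i \<in> sets borel" for i
  proof -
    have "range (\<lambda>i. A \<inter> V i) \<subseteq> sets borel" using A(1) oV by auto
    then show ?thesis unfolding D_def by (rule sets.range_disjointed_sets[THEN subsetD]) simp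
  qed
  have "(\<Union>i. D i) = A"
  proof -
    have "(\<Union>i. D i) = A \<inter> \<Union>(range V)" unfolding D_def UN_disjointed_eq by auto
    also have "\<Union>(range V) = \<Union>(U ` S)" using rV \<F>(3) by simp
    also have "A \<inter> \<Union>(U ` S) = A" using A(2) U by blast
    finally show ?thesis .
  qed
  moreover have dis: "disjoint_family D" unfolding D_def by (rule disjoint_family_disjointed)
  moreover have DS: "D i \<in> sets borel \<and> D i \<subseteq> S" for i using Dm[of i] Dsub[of i] A(2) by auto
  ultimately have "\<mu> A \<le> (\<Sum>i. \<mu> (D i))" "(\<Sum>i. \<eta> (D i)) \<le> \<eta> A"
    using sub[OF dis DS] sup[OF dis DS] by simp_all
  note this(1)
  also have "(\<Sum>i. \<mu> (D i)) \<le> (\<Sum>i. C * \<eta> (D i))"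
  proof (intro suminf_le summableI)
    fix i
    show "\<mu> (D i) \<le> C * \<eta> (D i)"
    proof (cases "D i = {}")
      case True
      then show ?thesis by (simp add: empty)
    next
      case False
      then obtain y where "y \<in> S" "V i = U y" using VU[of i] Dsub[of i] by auto
      then show ?thesis using U[of y] Dm[of i] Dsub[of i] A(2) by blast
    qed
  qed
  also have "\<dots> = C * (\<Sum>i. \<eta> (D i))" by simp
  also have "\<dots> \<le> C * \<eta> A" using \<open>(\<Sum>i. \<eta> (D i)) \<le> \<eta> A\<close> by (rule mult_left_mono) simp
  finally show ?thesis .
qed

lemma ennreal_le_of_le_power_mult:
  fixes X Y :: ennreal
  assumes "\<And>q :: real. q > 1 \<Longrightarrow> X \<le> ennreal (q ^ m) * Y"
  shows "X \<le> Y"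
proof (cases "Y = top")
  case False
  have "(\<lambda>n. ennreal ((1 + 1 / real (Suc n)) ^ m)) \<longlonglongrightarrow> ennreal ((1 + 0) ^ m)"
    by (intro tendsto_ennrealI tendsto_intros LIMSEQ_Suc[OF lim_1_over_n])
  then have "(\<lambda>n. ennreal ((1 + 1 / real (Suc n)) ^ m) * Y) \<longlonglongrightarrow> ennreal ((1 + 0) ^ m) * Y"
    using False by (intro tendsto_mult_ennreal tendsto_const) (auto simp: less_top)
  then show ?thesis
    using assms by (intro LIMSEQ_le_const[of _ Y X]) auto
qed simp

text \<open>Both sides are countably additive on Borel subsets of \<open>S\<close>, the left one
  because \<open>f\<close> is injective with Borel images. The local comparison therefore globalises
  in both directions. The Jacobian enters only through that comparison; the free exponent
  \<open>m\<close> lets several factors q accumulate before q tends to 1.\<close>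

lemma hausdorff_area_formula:
  fixes f :: "'a::{metric_space,second_countable_topology} \<Rightarrow> 'b::metric_space" and K :: "nat \<Rightarrow> 'a set"
    and J :: "'a \<Rightarrow> ennreal" and d :: nat
  defines "I \<equiv> \<lambda>A. \<integral>\<^sup>+y. J y * indicator A y \<partial>hausdorff_measure d"
  assumes K: "\<And>n. compact (K n)" and S: "S = (\<Union>n. K n)"
    and f: "continuous_on S f" "inj_on f S"
    and J: "(\<lambda>y. J y * indicator S y) \<in> borel_measurable borel"
    and loc: "\<And>y q. y \<in> S \<Longrightarrow> q > 1 \<Longrightarrow> \<exists>U. open U \<and> y \<in> U \<and> (\<forall>A\<in>sets borel. A \<subseteq> S \<inter> U \<longrightarrow>
        hausdorff_outer d (f ` A) \<le> ennreal (q ^ m) * I A \<and> I A \<le> ennreal (q ^ m) * hausdorff_outer d (f ` A))"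
    and A: "A \<in> sets borel" "A \<subseteq> S"
  shows "hausdorff_outer d (f ` A) = I A"
proof -
  let ?H = "\<lambda>A. hausdorff_outer d (f ` A)"
  have H_add: "?H (\<Union>i. D i) = (\<Sum>i. ?H (D i))"
    if D: "disjoint_family D" "\<And>i. D i \<in> sets borel \<and> D i \<subseteq> S" for D :: "nat \<Rightarrow> 'a set"
  proof -
    have m: "f ` D i \<in> sets borel" for i
      using borel_continuous_inj_image[OF K S f, of "D i"] D(2)[of i] by (simp add: Int_absorb2)
    have "disjoint_family (\<lambda>i. f ` D i)"
      using D f(2) unfolding disjoint_family_on_def by (metis image_empty inj_on_image_Int)
    then have "(\<Sum>i. emeasure (hausdorff_measure d) (f ` D i)) = emeasure (hausdorff_measure d) (\<Union>i. f ` D i)"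
      using m by (intro suminf_emeasure) auto
    moreover have "(\<Union>i. f ` D i) \<in> sets borel" using m by auto
    ultimately show ?thesis using m by (simp add: emeasure_hausdorff_measure image_UN)
  qed
  have I_eq: "I B = emeasure (density (hausdorff_measure d) (\<lambda>y. J y * indicator S y)) B"
    if "B \<in> sets borel" "B \<subseteq> S" for B
    unfolding I_def using that J
    by (subst emeasure_density) (auto intro!: nn_integral_cong split: split_indicator)
  have I_add: "I (\<Union>i. D i) = (\<Sum>i. I (D i))"
    if D: "disjoint_family D" "\<And>i. D i \<in> sets borel \<and> D i \<subseteq> S" for D :: "nat \<Rightarrow> 'a set"
  proof -
    have "(\<Union>i. D i) \<in> sets borel" "(\<Union>i. D i) \<subseteq> S" using D by auto
    moreover have "(\<Sum>i. emeasure (density (hausdorff_measure d) (\<lambda>y. J y * indicator S y)) (D i))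
        = emeasure (density (hausdorff_measure d) (\<lambda>y. J y * indicator S y)) (\<Union>i. D i)"
      using D by (intro suminf_emeasure) auto
    ultimately show ?thesis using D(2) by (simp add: I_eq)
  qed
  show ?thesis
  proof (rule antisym)
    show "?H A \<le> I A"
    proof (rule ennreal_le_of_le_power_mult[of _ m])
      fix q :: real assume "q > 1"
      show "?H A \<le> ennreal (q ^ m) * I A"
      proof (rule locally_dominated_imp_dominated[where S = S and \<mu> = ?H, OF _ _ _ _ A])
        fix y assume "y \<in> S"
        then show "\<exists>U. open U \<and> y \<in> U \<and> (\<forall>A\<in>sets borel. A \<subseteq> S \<inter> U \<longrightarrow> ?H A \<le> ennreal (q ^ m) * I A)"
          using loc[OF _ \<open>q > 1\<close>] by meson
      qed (use H_add I_add in \<open>auto simp: I_def\<close>)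
    qed
    show "I A \<le> ?H A"
    proof (rule ennreal_le_of_le_power_mult[of _ m])
      fix q :: real assume "q > 1"
      show "I A \<le> ennreal (q ^ m) * ?H A"
      proof (rule locally_dominated_imp_dominated[where S = S and \<eta> = ?H, OF _ _ _ _ A])
        fix y assume "y \<in> S"
        then show "\<exists>U. open U \<and> y \<in> U \<and> (\<forall>A\<in>sets borel. A \<subseteq> S \<inter> U \<longrightarrow> I A \<le> ennreal (q ^ m) * ?H A)"
          using loc[OF _ \<open>q > 1\<close>] by meson
      qed (use H_add I_add in \<open>auto simp: I_def\<close>)
    qed
  qed
qed

section \<open>Radial projection near a point\<close>

text \<open>The two-point form of differentiability is needed because a Lipschitz comparison
  concerns pairs of points near \<open>u0\<close>. The subtracted term is the derivative of radial
  projection at \<open>u0\<close>: the projection orthogonal to \<open>u0\<close>, divided by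
  \<open>norm u0\<close>.\<close>

lemma sgn_strictly_differentiable:
  fixes u0 :: "'a::real_inner"
  assumes "u0 \<noteq> 0" "\<epsilon> > 0"
  shows "\<exists>\<delta>>0. \<forall>u\<in>ball u0 \<delta>. \<forall>v\<in>ball u0 \<delta>.
    norm (sgn u - sgn v - ((u - v) - ((u - v) \<bullet> sgn u0) *\<^sub>R sgn u0) /\<^sub>R norm u0) \<le> \<epsilon> * norm (u - v)"
proof -
  \<comment> \<open>Chosen so that \<open>(u - v) \<bullet> W (u, v)\<close> is exactly
    \<open>norm u - norm v\<close>, by the difference of squares; on the diagonal it becomes
    \<open>sgn u0\<close>.\<close>
  define W where "W z = (fst z + snd z) /\<^sub>R (norm (fst z) + norm (snd z))" for z :: "'a \<times> 'a"
  \<comment> \<open>The sum of the coefficients of \<open>norm (u - v)\<close> in the error estimate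
    below; it is continuous and vanishes at \<open>(u0, u0)\<close>.\<close>
  define \<Phi> where "\<Phi> z = \<bar>inverse (norm (fst z)) - inverse (norm u0)\<bar>
      + norm (sgn (snd z) /\<^sub>R norm (fst z) - sgn u0 /\<^sub>R norm u0) + norm (W z - sgn u0) / norm u0"
    for z :: "'a \<times> 'a"
  have W0: "W (u0, u0) = sgn u0"
    using assms(1) by (simp add: W_def sgn_div_norm scaleR_2[symmetric])
  have "isCont W (u0, u0)"
    unfolding W_def using assms(1) by (intro continuous_intros) auto
  then have "isCont \<Phi> (u0, u0)"
    unfolding \<Phi>_def sgn_div_norm using assms(1) by (intro continuous_intros) auto
  then have "(\<Phi> \<longlongrightarrow> \<Phi> (u0, u0)) (nhds (u0, u0))"
    by (simp add: isCont_def tendsto_nhds_iff)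
  moreover have "\<Phi> (u0, u0) = 0" by (simp add: \<Phi>_def W0)
  ultimately have "eventually (\<lambda>z. \<Phi> z < \<epsilon> \<and> fst z \<noteq> 0 \<and> snd z \<noteq> 0) (nhds (u0, u0))"
  proof -
    have "eventually (\<lambda>z. \<Phi> z < \<epsilon>) (nhds (u0, u0))"
      using \<open>(\<Phi> \<longlongrightarrow> \<Phi> (u0, u0)) (nhds (u0, u0))\<close> \<open>\<Phi> (u0, u0) = 0\<close> assms(2)
      by (intro order_tendstoD) auto
    moreover have "eventually (\<lambda>z. fst z \<noteq> 0 \<and> snd z \<noteq> 0) (nhds (u0, u0))"
    proof -
      have "open ((- {0 :: 'a}) \<times> (- {0 :: 'a}))" by (intro open_Times) auto
      then show ?thesis using assms(1)
        by (auto simp: eventually_nhds intro!: exI[of _ "(- {0}) \<times> (- {0})"])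
    qed
    ultimately show ?thesis by eventually_elim auto
  qed
  then obtain P Q where P: "eventually P (nhds u0)" and Q: "eventually Q (nhds u0)"
    and PQ: "\<And>u v. P u \<Longrightarrow> Q v \<Longrightarrow> \<Phi> (u, v) < \<epsilon> \<and> u \<noteq> 0 \<and> v \<noteq> 0"
    unfolding nhds_prod eventually_prod_filter by auto
  have "eventually (\<lambda>u. P u \<and> Q u) (nhds u0)" using P Q by (rule eventually_conj)
  then obtain \<delta> where \<delta>: "\<delta> > 0" "\<And>u. dist u u0 < \<delta> \<Longrightarrow> P u \<and> Q u"
    by (auto simp: eventually_nhds_metric)
  show ?thesis
  proof (intro exI[of _ \<delta>] conjI ballI \<delta>(1))
    fix u v assume "u \<in> ball u0 \<delta>" "v \<in> ball u0 \<delta>"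
    then have \<Phi>: "\<Phi> (u, v) < \<epsilon>" and nz: "u \<noteq> 0" "v \<noteq> 0"
      using PQ[of u v] \<delta>(2)[of u] \<delta>(2)[of v] by (auto simp: dist_commute)
    define h where "h = u - v"
    define a where "a = norm u"
    define b where "b = norm v"
    define r where "r = norm u0"
    define w where "w = (u + v) /\<^sub>R (a + b)"
    have pos: "a > 0" "b > 0" "r > 0" using nz assms(1) by (auto simp: a_def b_def r_def)
    have hw: "h \<bullet> w = a - b"
    proof -
      have "h \<bullet> (u + v) = a\<^sup>2 - b\<^sup>2"
        by (simp add: h_def a_def b_def power2_norm_eq_inner inner_diff_left inner_add_right inner_commute[of v u])
      also have "a\<^sup>2 - b\<^sup>2 = (a - b) * (a + b)" by (simp add: power2_eq_square algebra_simps)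
      finally show ?thesis using pos by (simp add: w_def)
    qed
    have wle: "norm w \<le> 1"
    proof -
      have "norm w = norm (u + v) / (a + b)"
        using pos by (simp add: w_def divide_inverse_commute)
      also have "\<dots> \<le> 1"
        using pos norm_triangle_ineq[of u v] add_pos_pos[OF pos(1,2)]
        by (subst pos_divide_le_eq) (simp_all add: a_def b_def)
      finally show ?thesis .
    qed
    have sv: "v = b *\<^sub>R sgn v" using nz by (simp add: b_def sgn_div_norm)
    have "sgn u - sgn v = (h - (a - b) *\<^sub>R sgn v) /\<^sub>R a"
    proof -
      have "h - (a - b) *\<^sub>R sgn v = u - a *\<^sub>R sgn v"
        using sv by (simp add: h_def scaleR_diff_left)
      then show ?thesis using pos by (simp add: scaleR_diff_right a_def sgn_div_norm)
    qed
    then have "sgn u - sgn v - (h - (h \<bullet> sgn u0) *\<^sub>R sgn u0) /\<^sub>R r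
        = (inverse a - inverse r) *\<^sub>R h - ((h \<bullet> w) *\<^sub>R (sgn v /\<^sub>R a - sgn u0 /\<^sub>R r)
          + (h \<bullet> (w - sgn u0)) *\<^sub>R (sgn u0 /\<^sub>R r))"
      by (simp add: hw[symmetric] inner_diff_right algebra_simps)
    also have "norm \<dots> \<le> \<bar>inverse a - inverse r\<bar> * norm h
        + (norm h * norm (sgn v /\<^sub>R a - sgn u0 /\<^sub>R r) + norm h * norm (w - sgn u0) * (1 / r))"
    proof (intro order_trans[OF norm_triangle_ineq4] add_mono order_trans[OF norm_triangle_ineq])
      have "\<bar>h \<bullet> w\<bar> \<le> norm h * norm w" by (rule Cauchy_Schwarz_ineq2)
      also have "\<dots> \<le> norm h" using wle by (simp add: mult_left_le)
      finally show "norm ((h \<bullet> w) *\<^sub>R (sgn v /\<^sub>R a - sgn u0 /\<^sub>R r)) \<le> norm h * norm (sgn v /\<^sub>R a - sgn u0 /\<^sub>R r)"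
        by (simp add: mult_right_mono)
      show "norm ((h \<bullet> (w - sgn u0)) *\<^sub>R (sgn u0 /\<^sub>R r)) \<le> norm h * norm (w - sgn u0) * (1 / r)"
        using pos Cauchy_Schwarz_ineq2[of h "w - sgn u0"] assms(1)
        by (simp add: norm_sgn divide_inverse mult_right_mono abs_mult)
    qed simp
    also have "\<dots> = \<Phi> (u, v) * norm h"
      by (simp add: \<Phi>_def W_def w_def a_def b_def r_def algebra_simps divide_inverse)
    also have "\<dots> \<le> \<epsilon> * norm h" using \<Phi> by (intro mult_right_mono) auto
    finally show "norm (sgn u - sgn v - ((u - v) - ((u - v) \<bullet> sgn u0) *\<^sub>R sgn u0) /\<^sub>R norm u0) \<le> \<epsilon> * norm (u - v)"
      by (simp add: h_def r_def)
  qed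
qed

text \<open>Near \<open>y0\<close> the radial projection is compared, on pairs of points, with its
  derivative \<open>L\<close> after the orthogonal projection \<open>\<pi>\<close> to the tangent
  hyperplane. For that linear model the scaling factor is known:
  \<open>\<bar>p \<bullet> \<nu>\<bar>\<close> from projecting along \<open>p\<close>, and
  \<open>(1 / r) ^ d\<close> from the homothety.\<close>

lemma hausdorff_outer_radial_local:
  fixes S :: "(real ^ 'n) set" and K :: "nat \<Rightarrow> (real ^ 'n) set"
  defines "d \<equiv> CARD('n) - 1"
  assumes K: "\<And>n. compact (K n)" and S: "S = (\<Union>n. K n)" and "q > 1"
    and unit: "norm \<nu> = 1" and y0: "y0 \<noteq> x" and c: "sgn (y0 - x) \<bullet> \<nu> \<noteq> 0"
    and flat: "\<And>\<epsilon>. \<epsilon> > 0 \<Longrightarrow> \<exists>\<delta>>0. \<forall>y\<in>S \<inter> ball y0 \<delta>. \<forall>z\<in>S \<inter> ball y0 \<delta>. \<bar>\<nu> \<bullet> (y - z)\<bar> \<le> \<epsilon> * norm (y - z)"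
  shows "\<exists>\<delta>>0. \<forall>A\<in>sets borel. A \<subseteq> S \<inter> ball y0 \<delta> \<longrightarrow>
     hausdorff_outer d ((\<lambda>y. sgn (y - x)) ` A)
        \<le> ennreal (q ^ d) * (ennreal (\<bar>sgn (y0 - x) \<bullet> \<nu>\<bar> / norm (y0 - x) ^ d) * hausdorff_outer d A) \<and>
     ennreal (\<bar>sgn (y0 - x) \<bullet> \<nu>\<bar> / norm (y0 - x) ^ d) * hausdorff_outer d A
        \<le> ennreal (q ^ (2 * d)) * hausdorff_outer d ((\<lambda>y. sgn (y - x)) ` A)"
proof -
  define r where "r = norm (y0 - x)"
  define p where "p = sgn (y0 - x)"
  define c where "c = \<bar>p \<bullet> \<nu>\<bar>"
  have r: "r > 0" and c0: "c > 0" using y0 c by (auto simp: r_def c_def p_def)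
  have np: "norm p = 1" using y0 by (simp add: p_def norm_sgn)
  have pp: "p \<bullet> p = 1" "\<nu> \<bullet> \<nu> = 1" using np unit by (simp_all add: norm_eq_1)
  define L where "L v = (v - (v \<bullet> p) *\<^sub>R p) /\<^sub>R r" for v
  define \<pi> where "\<pi> v = v - (v \<bullet> \<nu>) *\<^sub>R \<nu>" for v
  have L_diff: "L (v - w) = L v - L w" for v w
    by (simp add: L_def inner_diff_left scaleR_diff_left scaleR_diff_right)
  have \<pi>_diff: "\<pi> (v - w) = \<pi> v - \<pi> w" for v w
    by (simp add: \<pi>_def inner_diff_left scaleR_diff_left)
  have \<pi>\<nu>: "\<pi> v \<bullet> \<nu> = 0" for v using pp by (simp add: \<pi>_def inner_diff_left)
  have proj_le: "norm (v - (v \<bullet> e) *\<^sub>R e) \<le> norm v" if "e \<bullet> e = 1" for v e :: "real ^ 'n"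
  proof -
    have "(norm (v - (v \<bullet> e) *\<^sub>R e))\<^sup>2 = (norm v)\<^sup>2 - (v \<bullet> e)\<^sup>2"
      unfolding power2_norm_eq_inner using that
      by (simp add: inner_diff_left inner_diff_right inner_commute power2_eq_square)
    then have "(norm (v - (v \<bullet> e) *\<^sub>R e))\<^sup>2 \<le> (norm v)\<^sup>2" by simp
    then show ?thesis by (rule power2_le_imp_le) simp
  qed
  have L_le: "norm (L v) \<le> norm v / r" for v
    using proj_le[OF pp(1), of v] r by (simp add: L_def divide_inverse_commute)
  \<comment> \<open>Cauchy-Schwarz against the tangential part of \<open>p\<close>, whose squared
    norm is \<open>1 - c\<^sup>2\<close>. Since \<open>c > 0\<close>, the bound allows errors
    proportional to \<open>norm h\<close> to be absorbed into
    \<open>norm (L (\<pi> h))\<close>.\<close>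
  have L_ge: "c / r * norm v \<le> norm (L v)" if "v \<bullet> \<nu> = 0" for v
  proof -
    define g where "g = p \<bullet> \<nu>"
    have "v \<bullet> p = v \<bullet> (p - g *\<^sub>R \<nu>)" using that by (simp add: inner_diff_right)
    then have "(v \<bullet> p)\<^sup>2 \<le> (v \<bullet> v) * ((p - g *\<^sub>R \<nu>) \<bullet> (p - g *\<^sub>R \<nu>))"
      using Cauchy_Schwarz_ineq[of v "p - g *\<^sub>R \<nu>"] by simp
    also have "(p - g *\<^sub>R \<nu>) \<bullet> (p - g *\<^sub>R \<nu>) = 1 - c\<^sup>2"
      using pp by (simp add: g_def c_def inner_diff_left inner_diff_right inner_commute power2_eq_square)
    finally have "(c * norm v)\<^sup>2 \<le> v \<bullet> v - (v \<bullet> p)\<^sup>2"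
      by (simp add: power_mult_distrib power2_norm_eq_inner algebra_simps)
    also have "\<dots> = (norm (v - (v \<bullet> p) *\<^sub>R p))\<^sup>2"
      unfolding power2_norm_eq_inner using pp
      by (simp add: inner_diff_left inner_diff_right inner_commute power2_eq_square)
    finally have "c * norm v \<le> norm (v - (v \<bullet> p) *\<^sub>R p)" by (rule power2_le_imp_le) simp
    then have "c * norm v / r \<le> norm (v - (v \<bullet> p) *\<^sub>R p) / r" using r by (simp add: divide_right_mono)
    then show ?thesis using r by (simp add: L_def divide_inverse_commute mult_ac)
  qed
  \<comment> \<open>The bound \<open>1 - 1/q\<close> makes the inverse of \<open>\<pi>\<close>
    q-Lipschitz on \<open>S\<close>. The last bound makes the error
    \<open>\<epsilon> * (1 + 1/r) * norm h\<close> at most \<open>(q - 1) / q\<close> times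
    \<open>norm (L (\<pi> h))\<close>; its factor 2 pays for replacing \<open>1 - \<epsilon>\<close>
    by 1/2.\<close>
  define \<epsilon> where "\<epsilon> = min (1/2) (min (1 - 1/q) ((q - 1) * (c / r) / (2 * q * (1 + 1/r))))"
  have \<epsilon>: "\<epsilon> > 0" "\<epsilon> \<le> 1/2" "\<epsilon> \<le> 1 - 1/q" "q * (\<epsilon> * (1 + 1/r)) \<le> (q - 1) * (c / r) * (1 - \<epsilon>)"
  proof -
    have p0: "2 * q * (1 + 1/r) > 0" using r \<open>q > 1\<close> by (simp add: add_pos_pos)
    show "\<epsilon> > 0" using r c0 \<open>q > 1\<close> p0 by (auto simp: \<epsilon>_def)
    show le: "\<epsilon> \<le> 1/2" "\<epsilon> \<le> 1 - 1/q"
      by (simp_all only: \<epsilon>_def min_le_iff_disj order_refl simp_thms)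
    have "\<epsilon> \<le> (q - 1) * (c / r) / (2 * q * (1 + 1/r))"
      by (simp only: \<epsilon>_def min_le_iff_disj order_refl simp_thms)
    then have "\<epsilon> * (2 * q * (1 + 1/r)) \<le> (q - 1) * (c / r)"
      using p0 by (simp only: pos_le_divide_eq)
    moreover have "\<epsilon> * (2 * q * (1 + 1/r)) = 2 * (q * (\<epsilon> * (1 + 1/r)))" by (simp only: mult_ac)
    moreover have "2 * X \<le> Y \<Longrightarrow> X \<le> Y * (1/2)" for X Y :: real by simp
    ultimately have "q * (\<epsilon> * (1 + 1/r)) \<le> (q - 1) * (c / r) * (1/2)" by metis
    also have "\<dots> \<le> (q - 1) * (c / r) * (1 - \<epsilon>)"
      using le \<open>q > 1\<close> c0 r by (intro mult_left_mono) auto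
    finally show "q * (\<epsilon> * (1 + 1/r)) \<le> (q - 1) * (c / r) * (1 - \<epsilon>)" .
  qed
  obtain \<delta>1 where \<delta>1: "\<delta>1 > 0"
    "\<And>y z. y \<in> S \<inter> ball y0 \<delta>1 \<Longrightarrow> z \<in> S \<inter> ball y0 \<delta>1 \<Longrightarrow> \<bar>\<nu> \<bullet> (y - z)\<bar> \<le> \<epsilon> * norm (y - z)"
    using flat[OF \<epsilon>(1)] by blast
  obtain \<delta>2 where \<delta>2: "\<delta>2 > 0" "\<And>u v. u \<in> ball (y0 - x) \<delta>2 \<Longrightarrow> v \<in> ball (y0 - x) \<delta>2 \<Longrightarrow>
      norm (sgn u - sgn v - L (u - v)) \<le> \<epsilon> * norm (u - v)"
    using sgn_strictly_differentiable[of "y0 - x" \<epsilon>] y0 \<epsilon>(1) unfolding L_def p_def r_def by force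
  \<comment> \<open>Halving leaves room for a closed ball, which keeps the pieces
    \<open>K n \<inter> cball y0 \<delta>\<close> compact and thereby the image under
    \<open>\<pi>\<close> Borel.\<close>
  define \<delta> where "\<delta> = min \<delta>1 \<delta>2 / 2"
  have \<delta>: "\<delta> > 0" "cball y0 \<delta> \<subseteq> ball y0 \<delta>1" "cball y0 \<delta> \<subseteq> ball y0 \<delta>2"
    using \<delta>1(1) \<delta>2(1) by (auto simp: \<delta>_def)
  define f where "f y = sgn (y - x)" for y
  have est: "norm (y - z) \<le> q * norm (\<pi> y - \<pi> z)" "norm (f y - f z) \<le> q * norm (L (\<pi> y) - L (\<pi> z))"
      "norm (L (\<pi> y) - L (\<pi> z)) \<le> q * norm (f y - f z)"
    if yz: "y \<in> S \<inter> cball y0 \<delta>" "z \<in> S \<inter> cball y0 \<delta>" for y z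
  proof -
    define h where "h = y - z"
    have "y \<in> S \<inter> ball y0 \<delta>1" "z \<in> S \<inter> ball y0 \<delta>1" "y \<in> ball y0 \<delta>2" "z \<in> ball y0 \<delta>2"
      using yz \<delta> by blast+
    then have fl: "\<bar>\<nu> \<bullet> h\<bar> \<le> \<epsilon> * norm h" and sd: "norm (f y - f z - L h) \<le> \<epsilon> * norm h"
      using \<delta>1(2)[of y z] \<delta>2(2)[of "y - x" "z - x"] by (auto simp: h_def f_def dist_norm)
    have hp: "norm (h - \<pi> h) \<le> \<epsilon> * norm h"
      using fl unit by (simp add: \<pi>_def inner_commute)
    have \<pi>ge: "(1 - \<epsilon>) * norm h \<le> norm (\<pi> h)"
      using hp norm_triangle_ineq2[of h "h - \<pi> h"] by (simp add: algebra_simps)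
    have "norm h = q * ((1/q) * norm h)" using \<open>q > 1\<close> by simp
    also have "\<dots> \<le> q * ((1 - \<epsilon>) * norm h)"
      using \<epsilon>(3) \<open>q > 1\<close> by (intro mult_left_mono mult_right_mono) auto
    also have "\<dots> \<le> q * norm (\<pi> h)" using \<pi>ge \<open>q > 1\<close> by (intro mult_left_mono) auto
    finally show "norm (y - z) \<le> q * norm (\<pi> y - \<pi> z)" by (simp add: h_def \<pi>_diff)
    have "norm (f y - f z - L (\<pi> h)) \<le> norm (f y - f z - L h) + norm (L (h - \<pi> h))"
      using norm_triangle_ineq[of "f y - f z - L h" "L h - L (\<pi> h)"] by (simp add: L_diff algebra_simps)
    also have "\<dots> \<le> \<epsilon> * norm h + \<epsilon> * norm h / r"
      using sd order_trans[OF L_le[of "h - \<pi> h"] divide_right_mono[OF hp, of r]] r by (intro add_mono) auto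
    also have "\<dots> = \<epsilon> * (1 + 1/r) * norm h" by (simp add: algebra_simps)
    finally have E: "norm (f y - f z - L (\<pi> h)) \<le> \<epsilon> * (1 + 1/r) * norm h" .
    have "q * (\<epsilon> * (1 + 1/r) * norm h) \<le> (q - 1) * (c / r) * (1 - \<epsilon>) * norm h"
      using mult_right_mono[OF \<epsilon>(4), of "norm h"] by (simp add: mult_ac)
    also have "\<dots> \<le> (q - 1) * (c / r) * norm (\<pi> h)"
      using mult_left_mono[OF \<pi>ge, of "(q - 1) * (c / r)"] \<open>q > 1\<close> c0 r by (simp add: mult_ac)
    also have "\<dots> \<le> (q - 1) * norm (L (\<pi> h))"
      using mult_left_mono[OF L_ge[OF \<pi>\<nu>[of h]], of "q - 1"] \<open>q > 1\<close> by (simp add: mult_ac)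
    finally have qE: "q * (\<epsilon> * (1 + 1/r) * norm h) \<le> (q - 1) * norm (L (\<pi> h))" .
    have E0: "0 \<le> \<epsilon> * (1 + 1/r) * norm h" using \<epsilon>(1) r by simp
    then have "\<epsilon> * (1 + 1/r) * norm h \<le> q * (\<epsilon> * (1 + 1/r) * norm h)"
      using mult_right_mono[of 1 q "\<epsilon> * (1 + 1/r) * norm h"] \<open>q > 1\<close> by simp
    then have "norm (f y - f z - L (\<pi> h)) \<le> (q - 1) * norm (L (\<pi> h))" using E qE by linarith
    then have "norm (f y - f z) \<le> q * norm (L (\<pi> h))"
      using norm_triangle_ineq[of "f y - f z - L (\<pi> h)" "L (\<pi> h)"] by (simp add: algebra_simps)
    then show "norm (f y - f z) \<le> q * norm (L (\<pi> y) - L (\<pi> z))" by (simp add: h_def \<pi>_diff L_diff)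
    have "norm (L (\<pi> h)) \<le> norm (f y - f z) + \<epsilon> * (1 + 1/r) * norm h"
      using E norm_triangle_ineq[of "f y - f z" "- (f y - f z - L (\<pi> h))"] by (simp add: norm_minus_commute)
    then have "q * norm (L (\<pi> h)) \<le> q * norm (f y - f z) + q * (\<epsilon> * (1 + 1/r) * norm h)"
      using mult_left_mono[of "norm (L (\<pi> h))" "norm (f y - f z) + \<epsilon> * (1 + 1/r) * norm h" q] \<open>q > 1\<close>
      by (simp add: distrib_left)
    with qE have "norm (L (\<pi> h)) \<le> q * norm (f y - f z)" by (simp add: algebra_simps)
    then show "norm (L (\<pi> y) - L (\<pi> z)) \<le> q * norm (f y - f z)" by (simp add: h_def \<pi>_diff L_diff)
  qed
  have main: "hausdorff_outer d (f ` A) \<le> ennreal (q ^ d) * (ennreal (c / r ^ d) * hausdorff_outer d A) \<and>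
     ennreal (c / r ^ d) * hausdorff_outer d A \<le> ennreal (q ^ (2 * d)) * hausdorff_outer d (f ` A)"
    if A: "A \<in> sets borel" "A \<subseteq> S \<inter> ball y0 \<delta>" for A
  proof -
    have Ac: "A \<subseteq> S \<inter> cball y0 \<delta>" using A(2) by auto
    have \<pi>A: "\<pi> ` A \<in> sets borel"
    proof -
      have "\<pi> ` (A \<inter> (S \<inter> cball y0 \<delta>)) \<in> sets borel"
      proof (rule borel_continuous_inj_image[OF _ _ _ _ A(1)])
        show "S \<inter> cball y0 \<delta> = (\<Union>n. K n \<inter> cball y0 \<delta>)" by (auto simp: S)
        show "continuous_on (S \<inter> cball y0 \<delta>) \<pi>" unfolding \<pi>_def by (intro continuous_intros)
        show "inj_on \<pi> (S \<inter> cball y0 \<delta>)" using est(1) by (intro inj_onI) fastforce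
      qed (use K in auto)
      then show ?thesis using Ac by (simp add: Int_absorb2)
    qed
    have L\<pi>: "hausdorff_outer d ((\<lambda>y. L (\<pi> y)) ` A) = ennreal (c / r ^ d) * hausdorff_outer d (\<pi> ` A)"
    proof -
      have "(\<lambda>y. L (\<pi> y)) ` A = (\<lambda>v. (1 / r) *\<^sub>R v) ` (\<lambda>v. v - (v \<bullet> p) *\<^sub>R p) ` (\<pi> ` A)"
        by (simp add: image_image L_def inverse_eq_divide)
      then have "hausdorff_outer d ((\<lambda>y. L (\<pi> y)) ` A)
          = ennreal ((1 / r) ^ d) * hausdorff_outer d ((\<lambda>v. v - (v \<bullet> p) *\<^sub>R p) ` (\<pi> ` A))"
        using r by (simp only: hausdorff_outer_scaleR[of "1 / r"] zero_less_divide_1_iff)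
      also have "\<dots> = ennreal ((1 / r) ^ d) * (ennreal c * hausdorff_outer d (\<pi> ` A))"
        unfolding d_def c_def using \<pi>\<nu> c
        by (subst hausdorff_outer_project[OF \<pi>A _ unit np]) (auto simp: p_def)
      finally show ?thesis
        using r c0 by (simp add: mult.assoc[symmetric] ennreal_mult'[symmetric] power_divide mult.commute)
    qed
    \<comment> \<open>The upper bound combines 1 and 4 and loses \<open>q ^ d\<close> once, as
      \<open>\<pi>\<close> does not increase distances. The lower bound combines 2 and 3 and loses
      it twice.\<close>
    have 1: "hausdorff_outer d (f ` A) \<le> ennreal (q ^ d) * hausdorff_outer d ((\<lambda>y. L (\<pi> y)) ` A)"
      using est(2) Ac \<open>q > 1\<close> by (intro hausdorff_outer_image_compare) (auto simp: dist_norm subset_iff)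
    have 2: "hausdorff_outer d ((\<lambda>y. L (\<pi> y)) ` A) \<le> ennreal (q ^ d) * hausdorff_outer d (f ` A)"
      using est(3) Ac \<open>q > 1\<close> by (intro hausdorff_outer_image_compare) (auto simp: dist_norm subset_iff)
    have 3: "hausdorff_outer d A \<le> ennreal (q ^ d) * hausdorff_outer d (\<pi> ` A)"
      using hausdorff_outer_image_compare[of q A "\<lambda>y. y" \<pi> d] est(1) Ac \<open>q > 1\<close> by (auto simp: dist_norm subset_iff)
    have 4: "hausdorff_outer d (\<pi> ` A) \<le> hausdorff_outer d A"
    proof -
      have "dist (\<pi> y) (\<pi> z) \<le> 1 * dist y z" for y z
        unfolding dist_norm \<pi>_diff[symmetric] unfolding \<pi>_def using proj_le[OF pp(2), of "y - z"] by simp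
      then show ?thesis using hausdorff_outer_image_le[of 1 A \<pi> d] by simp
    qed
    have "hausdorff_outer d (f ` A) \<le> ennreal (q ^ d) * (ennreal (c / r ^ d) * hausdorff_outer d A)"
      using 1 4 unfolding L\<pi> by (meson mult_left_mono order_trans zero_le)
    moreover have "ennreal (c / r ^ d) * hausdorff_outer d A \<le> ennreal (q ^ (2 * d)) * hausdorff_outer d (f ` A)"
    proof -
      have "ennreal (c / r ^ d) * hausdorff_outer d A \<le> ennreal (c / r ^ d) * (ennreal (q ^ d) * hausdorff_outer d (\<pi> ` A))"
        using 3 by (rule mult_left_mono) simp
      also have "\<dots> = ennreal (q ^ d) * hausdorff_outer d ((\<lambda>y. L (\<pi> y)) ` A)"
        by (simp add: L\<pi> mult.left_commute)
      also have "\<dots> \<le> ennreal (q ^ d) * (ennreal (q ^ d) * hausdorff_outer d (f ` A))"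
        using 2 by (rule mult_left_mono) simp
      also have "\<dots> = ennreal (q ^ (2 * d)) * hausdorff_outer d (f ` A)"
        using \<open>q > 1\<close> by (simp add: mult.assoc[symmetric] ennreal_mult'[symmetric] mult_2 power_add)
      finally show ?thesis .
    qed
    ultimately show ?thesis by blast
  qed
  show ?thesis
    using \<delta>(1) main unfolding f_def c_def p_def r_def by blast
qed

section \<open>Supporting hyperplanes and outward normals\<close>

text \<open>The convex counterpart of an outward normal. For fixed \<Omega> it is a closed condition
  on the pair \<open>(x, a)\<close>, unlike the definition by tangent curves; continuity of the
  normal rests on this.\<close>

definition supports :: "'a::real_inner set \<Rightarrow> 'a \<Rightarrow> 'a \<Rightarrow> bool" where
  "supports \<Omega> x a \<longleftrightarrow> norm a = 1 \<and> (\<forall>z\<in>\<Omega>. a \<bullet> (z - x) \<le> 0)"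

lemma supports_closure:
  assumes "supports \<Omega> x a" "z \<in> closure \<Omega>"
  shows "a \<bullet> (z - x) \<le> 0"
proof -
  have "closure \<Omega> \<subseteq> {z. a \<bullet> z \<le> a \<bullet> x}"
    using assms(1) by (intro closure_minimal closed_halfspace_le) (auto simp: supports_def inner_diff_right)
  then show ?thesis using assms(2) by (auto simp: inner_diff_right)
qed

lemma supports_interior:
  assumes "open \<Omega>" "supports \<Omega> x a" "z \<in> \<Omega>"
  shows "a \<bullet> (z - x) < 0"
proof -
  obtain e where e: "e > 0" "cball z e \<subseteq> \<Omega>"
    using assms(1,3) open_contains_cball by blast
  have na: "norm a = 1" using assms(2) by (simp add: supports_def)
  then have "z + e *\<^sub>R a \<in> \<Omega>" using e by (auto simp: dist_norm)
  then have "a \<bullet> (z + e *\<^sub>R a - x) \<le> 0" using assms(2) by (simp add: supports_def)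
  moreover have "a \<bullet> a = 1" using na by (simp add: norm_eq_1)
  ultimately show ?thesis using e(1) by (simp add: inner_add_right inner_diff_right)
qed

lemma exists_supports:
  fixes \<Omega> :: "'a::euclidean_space set"
  assumes "convex \<Omega>" "\<Omega> \<noteq> {}" "x \<notin> \<Omega>"
  shows "\<exists>a. supports \<Omega> x a"
proof -
  obtain a b where ab: "a \<noteq> 0" "\<forall>z\<in>\<Omega>. a \<bullet> z \<le> b" "b \<le> a \<bullet> x"
    using separating_hyperplane_sets[of \<Omega> "{x}"] assms by auto
  have "sgn a \<bullet> (z - x) \<le> 0" if "z \<in> \<Omega>" for z
  proof -
    have "a \<bullet> (z - x) \<le> 0" using ab that by (auto simp: inner_diff_right)
    then show ?thesis by (simp add: sgn_div_norm mult_nonneg_nonpos)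
  qed
  then show ?thesis using ab(1) by (auto simp: supports_def norm_sgn intro!: exI[of _ "sgn a"])
qed

text \<open>\<open>m\<close> is the gradient of the graph equation, pointing away from \<Omega> and
  pulled back by the rigid motion. An inward segment and a full hyperplane of tangent vectors are
  all that later arguments take from the smoothness assumption.\<close>

lemma C1_boundary_local:
  fixes \<Omega> :: "(real ^ 'n) set"
  assumes "open \<Omega>" "C1_boundary \<Omega>" and x: "x \<in> frontier \<Omega>"
  shows "\<exists>m \<delta>. m \<noteq> 0 \<and> \<delta> > 0 \<and> (\<forall>t. 0 < t \<and> t < \<delta> \<longrightarrow> x - t *\<^sub>R m \<in> \<Omega>) \<and>
    (\<forall>v. v \<bullet> m = 0 \<longrightarrow> tangent_vector (frontier \<Omega>) x v)"
proof -
  have "\<exists>r>0. \<exists>T k g. rigid_motion T \<and> C1_function g \<and>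
        (\<forall>u t. g (u + t *\<^sub>R axis k 1) = g u) \<and>
        \<Omega> \<inter> ball x r = {y \<in> ball x r. T y $ k > g (T y)}"
    using assms(2) x unfolding C1_boundary_def by (rule bspec)
  then obtain r T k g where "r > 0" and T: "rigid_motion T" and g: "C1_function g"
    and ginv: "\<And>u t. g (u + t *\<^sub>R axis k 1) = g u"
    and loc: "\<Omega> \<inter> ball x r = {y \<in> ball x r. T y $ k > g (T y)}"
    by auto
  obtain f a where f: "orthogonal_transformation f" and Tf: "T = (\<lambda>y. f y + a)"
    using T unfolding rigid_motion_def by blast
  obtain G where G: "\<And>u. (g has_derivative (\<lambda>h. G u \<bullet> h)) (at u)"
    using g unfolding C1_function_def by blast
  define F where "F = inv f"
  have F: "orthogonal_transformation F" unfolding F_def by (rule orthogonal_transformation_inv[OF f])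
  have fF: "f (F w) = w" and Ff: "F (f w) = w" for w
    using orthogonal_transformation_surj[OF f] orthogonal_transformation_inj[OF f]
    by (simp_all add: F_def surj_f_inv_f inv_f_f)
  have lin: "linear f" "linear F" using f F by (simp_all add: orthogonal_transformation_linear)
  have contT: "continuous_on UNIV T"
    unfolding Tf using lin(1) by (intro continuous_intros linear_continuous_on) (simp add: linear_linear)
  have contg: "continuous_on UNIV g"
    using G by (intro continuous_at_imp_continuous_on ballI has_derivative_continuous) blast
  let ?e = "axis k 1 :: real ^ 'n"
  define z0 where "z0 = T x"
  \<comment> \<open>Removing the k-th component makes that component of \<open>G' - ?e\<close> equal
    to -1, so \<open>m\<close> cannot vanish.\<close>
  define G' where "G' = drop_coord k (G z0)"
  have front: "frontier \<Omega> = closure \<Omega> - \<Omega>"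
    using assms(1) by (simp add: frontier_def interior_open)
  have graph: "y \<in> frontier \<Omega>" if y: "y \<in> ball x r" "T y $ k = g (T y)" for y
  proof -
    have "y \<in> closure \<Omega>"
      unfolding closure_approachable
    proof (intro allI impI)
      fix e :: real assume "e > 0"
      define t where "t = min e (r - dist x y) / 2"
      have t: "t > 0" "t < e" "t < r - dist x y" using y \<open>e > 0\<close> by (auto simp: t_def)
      define y' where "y' = y + t *\<^sub>R F ?e"
      have d: "dist y' y = t" using t(1) orthogonal_transformation_norm[OF F, of ?e] by (simp add: y'_def dist_norm)
      have "T y' = T y + t *\<^sub>R ?e"
        using lin(1) by (simp add: Tf y'_def linear_add linear_scale fF)
      then have "T y' $ k > g (T y')" using y(2) t(1) by (simp add: ginv)
      moreover have "y' \<in> ball x r"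
        using dist_triangle[of x y' y] d t(3) by (simp add: dist_commute)
      ultimately have "y' \<in> \<Omega>" using loc by blast
      show "\<exists>z\<in>\<Omega>. dist z y < e" using \<open>y' \<in> \<Omega>\<close> d t(2) by auto
    qed
    moreover have "y \<notin> \<Omega> \<inter> ball x r" unfolding loc using y(2) by simp
    then have "y \<notin> \<Omega>" using y(1) by blast
    ultimately show ?thesis by (simp add: front)
  qed
  have x0: "z0 $ k = g z0"
  proof -
    have xb: "x \<in> ball x r" using \<open>r > 0\<close> by simp
    have "x \<notin> \<Omega>" using x by (simp add: front)
    then have "x \<notin> {y \<in> ball x r. T y $ k > g (T y)}" unfolding loc[symmetric] by simp
    then have le: "T x $ k \<le> g (T x)" using xb by simp
    \<comment> \<open>Strictly below the graph, a whole neighbourhood of \<open>x\<close> would miss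
      \<Omega>, although \<open>x\<close> lies in its closure.\<close>
    have False if lt: "T x $ k < g (T x)"
    proof -
      define N where "N = {y \<in> ball x r. T y $ k < g (T y)}"
      have "open {y. T y $ k < g (T y)}"
        using contT continuous_on_compose2[OF contg contT]
        by (intro open_Collect_less continuous_intros) auto
      then have "open (ball x r \<inter> {y. T y $ k < g (T y)})" by (intro open_Int) auto
      moreover have "N = ball x r \<inter> {y. T y $ k < g (T y)}" by (auto simp: N_def)
      ultimately have "open N" by simp
      moreover have "y \<notin> N" if "y \<in> \<Omega>" for y
      proof
        assume y: "y \<in> N"
        then have "y \<in> \<Omega> \<inter> ball x r" using that by (simp add: N_def)
        then show False unfolding loc using y by (simp add: N_def)
      qed
      then have "N \<inter> \<Omega> = {}" by blast
      ultimately have "N \<inter> closure \<Omega> = {}" by (simp add: open_Int_closure_eq_empty)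
      moreover have "x \<in> N" using xb lt by (simp add: N_def)
      ultimately show False using x by (auto simp: front)
    qed
    with le show ?thesis unfolding z0_def by force
  qed
  have line: "((\<lambda>t. g (z0 + t *\<^sub>R w)) has_real_derivative (G z0 \<bullet> w)) (at 0)" for w
  proof -
    have "((\<lambda>t. z0 + t *\<^sub>R w) has_derivative (\<lambda>t. t *\<^sub>R w)) (at (0::real))"
      by (auto intro!: derivative_eq_intros)
    moreover have "(g has_derivative (\<lambda>h. G z0 \<bullet> h)) (at (z0 + 0 *\<^sub>R w))" using G by simp
    ultimately have "((\<lambda>t. g (z0 + t *\<^sub>R w)) has_derivative (\<lambda>t. G z0 \<bullet> (t *\<^sub>R w))) (at 0)"
      by (rule has_derivative_compose)
    then show ?thesis by (simp add: has_field_derivative_def mult_commute_abs)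
  qed
  have sym: "G' \<bullet> w = G z0 \<bullet> drop_coord k w" for w
    by (simp add: G'_def drop_coord_def inner_diff_left inner_diff_right inner_axis inner_axis')
  define m where "m = F (G' - ?e)"
  have "G' - ?e \<noteq> 0"
  proof
    assume "G' - ?e = 0"
    then have "(G' - ?e) $ k = 0" by simp
    then show False by (simp add: G'_def)
  qed
  then have m0: "m \<noteq> 0" unfolding m_def using orthogonal_transformation_norm[OF F, of "G' - ?e"] by auto
  have inside: "\<exists>\<delta>>0. \<forall>t. 0 < t \<and> t < \<delta> \<longrightarrow> x - t *\<^sub>R m \<in> \<Omega>"
  proof -
    \<comment> \<open>Up to a constant, the height of \<open>T (x - t *\<^sub>R m)\<close> above the
      graph. Its derivative at 0 is \<open>1 + G' \<bullet> G'\<close>, so the height is positive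
      for small positive \<open>t\<close>.\<close>
    define \<phi> where "\<phi> t = t - g (z0 + t *\<^sub>R (- G'))" for t
    have "(\<phi> has_real_derivative (1 - G z0 \<bullet> (- G'))) (at 0)"
      unfolding \<phi>_def by (intro derivative_intros line)
    moreover have "1 - G z0 \<bullet> (- G') > 0"
    proof -
      have "G z0 \<bullet> G' = G' \<bullet> G'" unfolding sym[of G'] by (simp add: G'_def drop_coord_id)
      then show ?thesis using inner_ge_zero[of G'] by (simp add: add_pos_nonneg)
    qed
    ultimately obtain d where d: "d > 0" "\<And>h. 0 < h \<Longrightarrow> h < d \<Longrightarrow> \<phi> 0 < \<phi> (0 + h)"
      using DERIV_pos_inc_right by blast
    define \<delta> where "\<delta> = min d (r / norm m)"
    have "x - t *\<^sub>R m \<in> \<Omega>" if t: "0 < t" "t < \<delta>" for t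
    proof -
      have "t * norm m < r" using t m0 by (simp add: \<delta>_def pos_less_divide_eq)
      then have b: "x - t *\<^sub>R m \<in> ball x r" using t by (simp add: dist_norm)
      have Tt: "T (x - t *\<^sub>R m) = (z0 + t *\<^sub>R (- G')) + t *\<^sub>R ?e"
        using lin(1) by (simp add: Tf z0_def m_def linear_diff linear_scale fF algebra_simps)
      have "- g z0 < t - g (z0 + t *\<^sub>R (- G'))" using d(2)[of t] t by (simp add: \<phi>_def \<delta>_def)
      moreover have "T (x - t *\<^sub>R m) $ k = g z0 + t"
        unfolding Tt using x0 by (simp add: G'_def)
      moreover have "g (T (x - t *\<^sub>R m)) = g (z0 + t *\<^sub>R (- G'))" unfolding Tt by (rule ginv)
      ultimately have "T (x - t *\<^sub>R m) $ k > g (T (x - t *\<^sub>R m))" by linarith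
      then show ?thesis using b loc by blast
    qed
    moreover have "\<delta> > 0" using d(1) \<open>r > 0\<close> m0 by (simp add: \<delta>_def)
    ultimately show ?thesis by blast
  qed
  have tangent: "tangent_vector (frontier \<Omega>) x v" if v: "v \<bullet> m = 0" for v
  proof -
    define w where "w = f v"
    define w' where "w' = drop_coord k w"
    have "w \<bullet> (G' - ?e) = 0"
      using v orthogonal_transformation_inner[OF f, of v m] by (simp add: w_def m_def fF)
    then have "w $ k = G z0 \<bullet> w'"
      using sym[of w] by (simp add: w'_def inner_diff_right inner_axis inner_commute)
    then have ww: "w = w' + (G z0 \<bullet> w') *\<^sub>R ?e" by (simp add: w'_def drop_coord_def)
    \<comment> \<open>A line lifted to the graph. Its velocity at 0 is \<open>w\<close> precisely
      because \<open>v\<close> is orthogonal to \<open>m\<close>; \<open>\<gamma>\<close> pulls the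
      curve back by the inverse of \<open>T\<close>.\<close>
    define c where "c t = z0 + t *\<^sub>R w' + (g (z0 + t *\<^sub>R w') - g z0) *\<^sub>R ?e" for t :: real
    define \<gamma> where "\<gamma> t = F (c t - a)" for t
    have Tc: "T (\<gamma> t) = c t" for t by (simp add: Tf \<gamma>_def fF)
    have on_graph: "T (\<gamma> t) $ k = g (T (\<gamma> t))" for t
    proof -
      have "c t $ k = g (z0 + t *\<^sub>R w')" using x0 by (simp add: c_def w'_def)
      moreover have "g (c t) = g (z0 + t *\<^sub>R w')" unfolding c_def by (rule ginv)
      ultimately show ?thesis by (simp add: Tc)
    qed
    have \<gamma>0: "\<gamma> 0 = x" by (simp add: \<gamma>_def c_def z0_def Tf Ff)
    have "(c has_vector_derivative w' + (G z0 \<bullet> w') *\<^sub>R ?e) (at 0)"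
    proof -
      have "((\<lambda>t. (g (z0 + t *\<^sub>R w') - g z0) *\<^sub>R ?e) has_vector_derivative (G z0 \<bullet> w') *\<^sub>R ?e) (at 0)"
      proof (rule bounded_linear.has_vector_derivative[OF bounded_linear_scaleR_left])
        show "((\<lambda>t. g (z0 + t *\<^sub>R w') - g z0) has_vector_derivative G z0 \<bullet> w') (at 0)"
          using DERIV_diff[OF line[of w'] DERIV_const[of "g z0"]]
          by (simp add: has_real_derivative_iff_has_vector_derivative)
      qed
      moreover have "((\<lambda>t. z0 + t *\<^sub>R w') has_vector_derivative w') (at 0)"
        using has_vector_derivative_add[OF has_vector_derivative_const[of z0]
            bounded_linear.has_vector_derivative[OF bounded_linear_scaleR_left has_vector_derivative_id, of w']]
        by simp
      ultimately show ?thesis unfolding c_def by (intro has_vector_derivative_add)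
    qed
    then have "((\<lambda>t. c t - a) has_vector_derivative w) (at 0)"
      using has_vector_derivative_diff[OF _ has_vector_derivative_const[of a], of c] ww by simp
    then have "(\<gamma> has_vector_derivative F w) (at 0)"
      unfolding \<gamma>_def by (rule bounded_linear.has_vector_derivative[OF lin(2)[unfolded linear_conv_bounded_linear]])
    then have der: "(\<gamma> has_vector_derivative v) (at 0)" by (simp add: w_def Ff)
    then have "isCont \<gamma> 0" by (rule has_vector_derivative_continuous)
    then obtain \<epsilon> where \<epsilon>: "\<epsilon> > 0" "\<And>t. dist t 0 < \<epsilon> \<Longrightarrow> dist (\<gamma> t) (\<gamma> 0) < r"
      using \<open>r > 0\<close> unfolding continuous_at_eps_delta by blast
    have "\<gamma> t \<in> frontier \<Omega>" if "\<bar>t\<bar> < \<epsilon>" for t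
      using graph[OF _ on_graph] \<epsilon>(2)[of t] that by (simp add: \<gamma>0 dist_commute)
    then show ?thesis
      unfolding tangent_vector_def using \<epsilon>(1) \<gamma>0 der by blast
  qed
  show ?thesis using m0 inside tangent by blast
qed

text \<open>Along a curve in the boundary, \<open>a \<bullet> \<gamma> t\<close> has a local maximum
  at 0, so its derivative vanishes there.\<close>

lemma supports_tangent_vector:
  assumes "supports \<Omega> x a" "tangent_vector (frontier \<Omega>) x v"
  shows "a \<bullet> v = 0"
proof -
  obtain \<gamma> \<epsilon> where \<epsilon>: "\<epsilon> > 0" and \<gamma>0: "\<gamma> 0 = x" and fr: "\<And>t. \<bar>t\<bar> < \<epsilon> \<Longrightarrow> \<gamma> t \<in> frontier \<Omega>"
    and der: "(\<gamma> has_vector_derivative v) (at 0)"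
    using assms(2) unfolding tangent_vector_def by blast
  have "((\<lambda>t. a \<bullet> \<gamma> t) has_vector_derivative a \<bullet> v) (at 0)"
    by (rule bounded_linear.has_vector_derivative[OF bounded_linear_inner_right der])
  then have "DERIV (\<lambda>t. a \<bullet> \<gamma> t) 0 :> a \<bullet> v" by (simp add: has_real_derivative_iff_has_vector_derivative)
  moreover have "\<forall>t. \<bar>0 - t\<bar> < \<epsilon> \<longrightarrow> a \<bullet> \<gamma> t \<le> a \<bullet> \<gamma> 0"
    using supports_closure[OF assms(1)] fr \<gamma>0 by (auto simp: frontier_def inner_diff_right)
  ultimately show ?thesis using DERIV_local_max \<epsilon> by blast
qed

text \<open>A unit vector orthogonal to all tangent vectors is \<open>sgn m\<close> or its negative,
  and the inward segment excludes the negative both for supporting vectors and for outward normals.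
  This gives uniqueness for the definite description and for supporting hyperplanes
  together.\<close>

lemma supports_eq_outward_unit_normal:
  fixes \<Omega> :: "(real ^ 'n) set"
  assumes \<Omega>: "open \<Omega>" "C1_boundary \<Omega>" and x: "x \<in> frontier \<Omega>" and a: "supports \<Omega> x a"
  shows "outward_unit_normal \<Omega> x = a"
proof -
  obtain m \<delta> where m: "m \<noteq> 0" "\<delta> > 0" and inside: "\<And>t. 0 < t \<Longrightarrow> t < \<delta> \<Longrightarrow> x - t *\<^sub>R m \<in> \<Omega>"
    and tan: "\<And>v. v \<bullet> m = 0 \<Longrightarrow> tangent_vector (frontier \<Omega>) x v"
    using C1_boundary_local[OF \<Omega> x] by blast
  have m_sgn: "norm (sgn m) = 1" using m by (simp add: norm_sgn)
  then have ss: "sgn m \<bullet> sgn m = 1" by (simp add: norm_eq_1)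
  have pm: "b = sgn m \<or> b = - sgn m"
    if b: "norm b = 1" "\<And>v. tangent_vector (frontier \<Omega>) x v \<Longrightarrow> b \<bullet> v = 0" for b
  proof -
    define v where "v = b - (b \<bullet> sgn m) *\<^sub>R sgn m"
    have vs: "v \<bullet> sgn m = 0" using ss by (simp add: v_def inner_diff_left)
    then have "v \<bullet> m = 0" using m by (simp add: sgn_div_norm)
    then have "b \<bullet> v = 0" using b(2) tan by blast
    then have "v \<bullet> v = 0" using vs by (simp add: v_def inner_diff_left inner_commute)
    then have eq: "b = (b \<bullet> sgn m) *\<^sub>R sgn m" by (simp add: v_def)
    then have "\<bar>b \<bullet> sgn m\<bar> = 1" using b(1) m_sgn by (metis mult.right_neutral norm_scaleR)
    then have "b \<bullet> sgn m = 1 \<or> b \<bullet> sgn m = -1" by linarith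
    then show ?thesis using eq by (metis scaleR_minus1_left scaleR_one)
  qed
  have na: "norm a = 1" using a by (simp add: supports_def)
  have "a = sgn m"
  proof -
    have "a \<noteq> - sgn m"
    proof
      assume am: "a = - sgn m"
      have "a \<bullet> (x - (\<delta>/2) *\<^sub>R m - x) < 0"
        using supports_interior[OF \<Omega>(1) a inside[of "\<delta>/2"]] m(2) by simp
      moreover have "sgn m \<bullet> m > 0" using m by (simp add: sgn_div_norm)
      ultimately show False using am m(2) by (simp add: mult_less_0_iff)
    qed
    then show ?thesis using pm[OF na supports_tangent_vector[OF a]] by blast
  qed
  show ?thesis
    unfolding outward_unit_normal_def
  proof (rule the_equality)
    have "x + t *\<^sub>R a \<notin> closure \<Omega>" if "t > 0" for t
    proof
      assume "x + t *\<^sub>R a \<in> closure \<Omega>"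
      then have "a \<bullet> (x + t *\<^sub>R a - x) \<le> 0" by (rule supports_closure[OF a])
      moreover have "a \<bullet> a = 1" using na by (simp add: norm_eq_1)
      ultimately show False using that by simp
    qed
    then have "\<forall>\<^sub>F t in at_right 0. x + t *\<^sub>R a \<notin> closure \<Omega>"
      unfolding eventually_at_right_field by (auto intro!: exI[of _ 1])
    then show "is_outward_unit_normal \<Omega> x a"
      using na supports_tangent_vector[OF a] by (simp add: is_outward_unit_normal_def)
  next
    fix b assume b: "is_outward_unit_normal \<Omega> x b"
    then have "b = sgn m \<or> b = - sgn m" by (intro pm) (auto simp: is_outward_unit_normal_def)
    moreover have "b \<noteq> - sgn m"
    proof
      assume bm: "b = - sgn m"
      obtain d where d: "d > 0" "\<And>t. 0 < t \<Longrightarrow> t < d \<Longrightarrow> x + t *\<^sub>R b \<notin> closure \<Omega>"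
        using b unfolding is_outward_unit_normal_def eventually_at_right_field by blast
      \<comment> \<open>Small enough for the same point to be outside the closure as
        \<open>x + t *\<^sub>R b\<close> and inside \<Omega> on the segment in direction
        \<open>- m\<close>.\<close>
      define t where "t = min d (\<delta> * norm m) / 2"
      have t: "0 < t" "t < d" "t < \<delta> * norm m"
        using d(1) m mult_pos_pos[of \<delta> "norm m"] by (auto simp: t_def min_def)
      have "x - (t / norm m) *\<^sub>R m \<in> \<Omega>"
        using t m by (intro inside) (auto simp: pos_divide_less_eq)
      moreover have "x - (t / norm m) *\<^sub>R m = x + t *\<^sub>R b"
        by (simp add: bm sgn_div_norm divide_inverse)
      ultimately show False using d(2)[OF t(1,2)] closure_subset by (metis subsetD)
    qed
    ultimately show "b = a" using \<open>a = sgn m\<close> by blast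
  qed
qed

lemma supports_outward_unit_normal:
  fixes \<Omega> :: "(real ^ 'n) set"
  assumes "open \<Omega>" "convex \<Omega>" "C1_boundary \<Omega>" and x: "x \<in> frontier \<Omega>"
  shows "supports \<Omega> x (outward_unit_normal \<Omega> x)"
proof -
  have "\<Omega> \<noteq> {}" "x \<notin> \<Omega>" using x assms(1) by (auto simp: frontier_def interior_open)
  then obtain a where "supports \<Omega> x a" using exists_supports[OF assms(2)] by blast
  then show ?thesis using supports_eq_outward_unit_normal[OF assms(1,3) x] by metis
qed

text \<open>Existence and uniqueness identify the graph of the normal with the set of supporting
  pairs, which is closed; a closed graph with values in a compact set gives continuity.\<close>

lemma continuous_on_outward_unit_normal:
  fixes \<Omega> :: "(real ^ 'n) set"
  assumes "open \<Omega>" "convex \<Omega>" "C1_boundary \<Omega>"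
  shows "continuous_on (frontier \<Omega>) (outward_unit_normal \<Omega>)"
proof (rule continuous_from_closed_graph)
  show "compact (sphere 0 1 :: (real ^ 'n) set)" by simp
  show "outward_unit_normal \<Omega> \<in> frontier \<Omega> \<rightarrow> sphere 0 1"
    using supports_outward_unit_normal[OF assms] by (auto simp: supports_def)
  have "(\<lambda>x. (x, outward_unit_normal \<Omega> x)) ` frontier \<Omega>
      = frontier \<Omega> \<times> sphere 0 1 \<inter> (\<Inter>z\<in>\<Omega>. {p. snd p \<bullet> (z - fst p) \<le> 0})"
    using supports_outward_unit_normal[OF assms] supports_eq_outward_unit_normal[OF assms(1,3)]
    by (fastforce simp: supports_def image_iff)
  also have "closed \<dots>"
    by (intro closed_Int closed_Times closed_INT ballI closed_Collect_le continuous_intros) auto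
  finally show "closed ((\<lambda>x. (x, outward_unit_normal \<Omega> x)) ` frontier \<Omega>)" .
qed

text \<open>Support at \<open>y\<close> bounds the inner product with \<open>z - y\<close> from
  above, support at \<open>z\<close> does so with the opposite sign. Continuity allows both normals
  to be replaced by the one at \<open>y0\<close> at the price of \<epsilon>.\<close>

lemma frontier_flat:
  fixes \<Omega> :: "(real ^ 'n) set"
  assumes \<Omega>: "open \<Omega>" "convex \<Omega>" "C1_boundary \<Omega>" and y0: "y0 \<in> frontier \<Omega>" and "\<epsilon> > 0"
  shows "\<exists>\<delta>>0. \<forall>y\<in>frontier \<Omega> \<inter> ball y0 \<delta>. \<forall>z\<in>frontier \<Omega> \<inter> ball y0 \<delta>.
    \<bar>outward_unit_normal \<Omega> y0 \<bullet> (y - z)\<bar> \<le> \<epsilon> * norm (y - z)"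
proof -
  let ?\<nu> = "outward_unit_normal \<Omega>"
  obtain \<delta> where \<delta>: "\<delta> > 0" "\<And>y. y \<in> frontier \<Omega> \<Longrightarrow> dist y y0 < \<delta> \<Longrightarrow> dist (?\<nu> y) (?\<nu> y0) < \<epsilon>"
    using continuous_on_outward_unit_normal[OF \<Omega>] y0 \<open>\<epsilon> > 0\<close> unfolding continuous_on_iff by blast
  have one: "?\<nu> y0 \<bullet> (z - y) \<le> \<epsilon> * norm (y - z)"
    if y: "y \<in> frontier \<Omega>" "dist y y0 < \<delta>" and z: "z \<in> frontier \<Omega>" for y z
  proof -
    have "?\<nu> y \<bullet> (z - y) \<le> 0"
      using supports_closure[OF supports_outward_unit_normal[OF \<Omega> y(1)]] z by (simp add: frontier_def)
    then have "?\<nu> y0 \<bullet> (z - y) \<le> (?\<nu> y0 - ?\<nu> y) \<bullet> (z - y)" by (simp add: inner_diff_left)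
    also have "\<dots> \<le> norm (?\<nu> y0 - ?\<nu> y) * norm (z - y)" by (rule norm_cauchy_schwarz)
    also have "\<dots> \<le> \<epsilon> * norm (z - y)"
      using \<delta>(2)[OF y] by (intro mult_right_mono) (auto simp: dist_norm norm_minus_commute)
    finally show ?thesis by (simp add: norm_minus_commute)
  qed
  show ?thesis
  proof (intro exI[of _ \<delta>] conjI ballI \<delta>(1))
    fix y z assume "y \<in> frontier \<Omega> \<inter> ball y0 \<delta>" "z \<in> frontier \<Omega> \<inter> ball y0 \<delta>"
    then have "?\<nu> y0 \<bullet> (z - y) \<le> \<epsilon> * norm (y - z)" "?\<nu> y0 \<bullet> (y - z) \<le> \<epsilon> * norm (y - z)"
      using one[of y z] one[of z y] by (auto simp: dist_commute norm_minus_commute)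
    then show "\<bar>?\<nu> y0 \<bullet> (y - z)\<bar> \<le> \<epsilon> * norm (y - z)" by (simp add: abs_le_iff inner_diff_right)
  qed
qed

section \<open>Radial projection of a convex boundary\<close>

lemma open_star_union:
  assumes "open \<Omega>" "\<And>t. continuous_on UNIV (h t)"
  shows "open {y. \<exists>t>0 :: real. h t y \<in> \<Omega>}"
proof -
  have "{y. \<exists>t>0. h t y \<in> \<Omega>} = (\<Union>t\<in>{0<..}. h t -` \<Omega>)" by auto
  moreover have "open (h t -` \<Omega>)" for t using assms by (simp add: open_vimage)
  ultimately show ?thesis by auto
qed

lemma segment_from_closure:
  assumes "open \<Omega>" "convex \<Omega>" and x: "x \<in> closure \<Omega>" and c: "c \<in> \<Omega>" and e: "0 < e" "e \<le> 1"
  shows "x + e *\<^sub>R (c - x) \<in> (\<Omega> :: 'a::euclidean_space set)"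
  using mem_interior_closure_convex_shrink[OF assms(2) _ x e, of c] c assms(1)
  by (simp add: interior_open algebra_simps)

text \<open>From a point \<open>x\<close> of the closure, the boundary points lying in directions that enter \<open>\<Omega>\<close> are
  seen bijectively through radial projection.  For \<open>x\<close> inside \<open>\<Omega>\<close> these are all boundary points, for
  \<open>x\<close> on the boundary they are those off the tangent hyperplane at \<open>x\<close>.\<close>

definition visible :: "'a::real_normed_vector set \<Rightarrow> 'a \<Rightarrow> 'a set" where
  "visible \<Omega> x = {y \<in> frontier \<Omega>. \<exists>t>0. x + t *\<^sub>R (y - x) \<in> \<Omega>}"

definition entering :: "'a::real_normed_vector set \<Rightarrow> 'a \<Rightarrow> 'a set" where
  "entering \<Omega> x = {v \<in> sphere 0 1. \<exists>t>0. x + t *\<^sub>R v \<in> \<Omega>}"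

text \<open>For \<open>t \<ge> 1\<close> the point \<open>y\<close> would lie between a point of the
  closure and a point of \<Omega>, hence in \<Omega>.\<close>

lemma visible_parameter:
  fixes \<Omega> :: "'a::euclidean_space set"
  assumes \<Omega>: "open \<Omega>" "convex \<Omega>" and x: "x \<in> closure \<Omega>" and y: "y \<in> visible \<Omega> x"
  obtains t where "0 < t" "t < 1" "x + t *\<^sub>R (y - x) \<in> \<Omega>"
proof -
  obtain t where t: "t > 0" "x + t *\<^sub>R (y - x) \<in> \<Omega>" and fr: "y \<in> frontier \<Omega>"
    using y by (auto simp: visible_def)
  have "t < 1"
  proof (rule ccontr)
    assume "\<not> t < 1"
    then have "x + (1 / t) *\<^sub>R (x + t *\<^sub>R (y - x) - x) \<in> \<Omega>"
      by (intro segment_from_closure[OF \<Omega> x t(2)]) auto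
    moreover have "x + (1 / t) *\<^sub>R (x + t *\<^sub>R (y - x) - x) = y" using t(1) by simp
    ultimately show False using fr \<Omega>(1) by (simp add: frontier_def interior_open)
  qed
  with t show ?thesis using that by blast
qed

lemma visible_neq:
  assumes "open \<Omega>" "y \<in> visible \<Omega> x"
  shows "y \<noteq> x"
  using assms by (auto simp: visible_def frontier_def interior_open)

lemma norm_scaleR_sgn: "norm v *\<^sub>R sgn v = v"
  by (cases "v = 0") (simp_all add: sgn_div_norm)

text \<open>Of two visible points on one ray, the nearer would lie between a point of \<Omega>
  closer to \<open>x\<close> and the farther point, which is in the closure; by convexity it would
  belong to \<Omega>.\<close>

lemma inj_on_radial_projection:
  fixes \<Omega> :: "'a::euclidean_space set"
  assumes \<Omega>: "open \<Omega>" "convex \<Omega>" and x: "x \<in> closure \<Omega>"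
  shows "inj_on (\<lambda>y. sgn (y - x)) (visible \<Omega> x)"
proof (rule inj_onI)
  have less: False
    if yz: "y \<in> visible \<Omega> x" "z \<in> visible \<Omega> x" "sgn (y - x) = sgn (z - x)" "norm (y - x) < norm (z - x)" for y z
  proof -
    define v where "v = sgn (y - x)"
    define \<alpha> where "\<alpha> = norm (y - x)"
    define \<beta> where "\<beta> = norm (z - x)"
    have pos: "\<alpha> > 0" "\<alpha> < \<beta>"
      using visible_neq[OF \<Omega>(1) yz(1)] yz(4) by (auto simp: \<alpha>_def \<beta>_def)
    have yv: "y = x + \<alpha> *\<^sub>R v" by (simp add: v_def \<alpha>_def norm_scaleR_sgn)
    have zv: "z = x + \<beta> *\<^sub>R v" unfolding v_def yz(3) by (simp add: \<beta>_def norm_scaleR_sgn)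
    obtain t where t: "0 < t" "t < 1" "x + t *\<^sub>R (y - x) \<in> \<Omega>"
      using visible_parameter[OF \<Omega> x yz(1)] .
    define s where "s = t * \<alpha>"
    have s: "0 < s" "s < \<alpha>" using t pos by (auto simp: s_def)
    have c: "x + s *\<^sub>R v \<in> \<Omega>" using t(3) by (simp add: yv s_def)
    \<comment> \<open>Solves \<open>\<beta> - e * (\<beta> - s) = \<alpha>\<close>, so that the
      convex combination is \<open>y\<close>.\<close>
    define e where "e = (\<beta> - \<alpha>) / (\<beta> - s)"
    have e: "0 < e" "e \<le> 1" using s pos by (auto simp: e_def)
    have zc: "z \<in> closure \<Omega>" using yz(2) by (simp add: visible_def frontier_def)
    have "z + e *\<^sub>R (x + s *\<^sub>R v - z) \<in> \<Omega>" by (rule segment_from_closure[OF \<Omega> zc c e])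
    moreover have "z + e *\<^sub>R (x + s *\<^sub>R v - z) = y"
    proof -
      have "e * (\<beta> - s) = \<beta> - \<alpha>" using s pos by (simp add: e_def)
      then have "\<beta> - e * (\<beta> - s) = \<alpha>" by simp
      have "z + e *\<^sub>R (x + s *\<^sub>R v - z) = x + (\<beta> - e * (\<beta> - s)) *\<^sub>R v"
        by (simp add: zv algebra_simps)
      then show ?thesis by (simp add: \<open>\<beta> - e * (\<beta> - s) = \<alpha>\<close> yv)
    qed
    moreover have "y \<notin> \<Omega>" using yz(1) \<Omega>(1) by (simp add: visible_def frontier_def interior_open)
    ultimately show False by simp
  qed
  fix y z assume yz: "y \<in> visible \<Omega> x" "z \<in> visible \<Omega> x" "sgn (y - x) = sgn (z - x)"
  then have "norm (y - x) = norm (z - x)"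
    using less[of y z] less[of z y] by force
  then have "norm (y - x) *\<^sub>R sgn (y - x) = norm (z - x) *\<^sub>R sgn (z - x)" using yz by simp
  then show "y = z"
    unfolding norm_scaleR_sgn by simp
qed

text \<open>Boundedness makes a ray that has reached \<Omega> leave it again, and the exit point is
  visible.\<close>

lemma radial_projection_image:
  fixes \<Omega> :: "'a::euclidean_space set"
  assumes \<Omega>: "open \<Omega>" "convex \<Omega>" "bounded \<Omega>"
  shows "(\<lambda>y. sgn (y - x)) ` visible \<Omega> x = entering \<Omega> x"
proof (intro equalityI subsetI)
  fix v assume "v \<in> (\<lambda>y. sgn (y - x)) ` visible \<Omega> x"
  then obtain y where y: "y \<in> visible \<Omega> x" "v = sgn (y - x)" by blast
  then obtain t where t: "t > 0" "x + t *\<^sub>R (y - x) \<in> \<Omega>" by (auto simp: visible_def)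
  have n: "norm (y - x) > 0" using visible_neq[OF \<Omega>(1) y(1)] by simp
  have "x + (t * norm (y - x)) *\<^sub>R v \<in> \<Omega>"
    using t by (simp add: y(2) norm_scaleR_sgn scaleR_scaleR[symmetric] del: scaleR_scaleR)
  moreover have "t * norm (y - x) > 0" "norm v = 1" using t n by (auto simp: y(2) norm_sgn)
  ultimately show "v \<in> entering \<Omega> x" by (auto simp: entering_def)
next
  fix v assume "v \<in> entering \<Omega> x"
  then obtain t where t: "t > 0" "x + t *\<^sub>R v \<in> \<Omega>" and v: "norm v = 1" by (auto simp: entering_def)
  have "v \<noteq> 0" using v by auto
  then obtain r where r: "r > 0" "x + t *\<^sub>R v + r *\<^sub>R v \<in> frontier \<Omega>"
    using ray_to_frontier[OF \<Omega>(3), of "x + t *\<^sub>R v" v] t \<Omega>(1) by (metis interior_open)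
  define y where "y = x + (t + r) *\<^sub>R v"
  have "x + (t / (t + r)) *\<^sub>R (y - x) \<in> \<Omega>" using t r by (simp add: y_def)
  moreover have "t / (t + r) > 0" using t r by simp
  moreover have "y \<in> frontier \<Omega>" using r by (simp add: y_def algebra_simps)
  ultimately have "y \<in> visible \<Omega> x" unfolding visible_def by blast
  moreover have "sgn (y - x) = v" using v t r by (simp add: y_def sgn_div_norm)
  ultimately show "v \<in> (\<lambda>y. sgn (y - x)) ` visible \<Omega> x" by force
qed

lemma borel_entering: "open \<Omega> \<Longrightarrow> entering \<Omega> x \<in> sets (borel :: 'a::euclidean_space measure)"
proof -
  assume "open \<Omega>"
  then have "open {v. \<exists>t>0. x + t *\<^sub>R v \<in> \<Omega>}"
    by (rule open_star_union) (intro continuous_intros)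
  moreover have "entering \<Omega> x = sphere 0 1 \<inter> {v. \<exists>t>0. x + t *\<^sub>R v \<in> \<Omega>}"
    by (auto simp: entering_def)
  ultimately show ?thesis by (auto intro: borel_open borel_closed)
qed

text \<open>Visibility is an open condition on \<open>y\<close>, and open sets are countable unions
  of compact sets; intersecting with the closed frontier keeps them compact.\<close>

lemma visible_sigma_compact:
  fixes \<Omega> :: "'a::euclidean_space set"
  assumes "open \<Omega>" "bounded \<Omega>"
  shows "\<exists>K :: nat \<Rightarrow> 'a set. (\<forall>n. compact (K n)) \<and> visible \<Omega> x = (\<Union>n. K n)"
proof -
  define Q where "Q = {y. \<exists>t>0. x + t *\<^sub>R (y - x) \<in> \<Omega>}"
  have "open Q" unfolding Q_def using assms(1)
    by (rule open_star_union) (intro continuous_intros)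
  then have "\<exists>C :: nat \<Rightarrow> 'a set. (\<forall>n. compact (C n)) \<and> \<Union>(range C) = Q"
  proof (rule open_Union_compact_subsets)
    fix C :: "nat \<Rightarrow> 'a set" assume "\<And>n. compact (C n)" "\<Union>(range C) = Q"
    then show ?thesis by blast
  qed
  then obtain C :: "nat \<Rightarrow> 'a set" where C: "\<And>n. compact (C n)" and Q: "\<Union>(range C) = Q" by auto
  have "compact (frontier \<Omega> \<inter> C n)" for n
    using C by (intro closed_Int_compact) auto
  moreover have "visible \<Omega> x = (\<Union>n. frontier \<Omega> \<inter> C n)"
    using Q by (auto simp: visible_def Q_def)
  ultimately show ?thesis by (intro exI[of _ "\<lambda>n. frontier \<Omega> \<inter> C n"]) simp
qed

text \<open>The segment from \<open>x\<close> to \<open>y\<close> contains a point of \<Omega>,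
  which lies strictly inside the supporting half-space at \<open>y\<close>. Hence rays meet the
  visible boundary transversally and the Jacobian is nonzero there.\<close>

lemma normal_radial_pos:
  fixes \<Omega> :: "(real ^ 'n) set"
  assumes \<Omega>: "open \<Omega>" "convex \<Omega>" "C1_boundary \<Omega>" and x: "x \<in> closure \<Omega>" and y: "y \<in> visible \<Omega> x"
  shows "sgn (y - x) \<bullet> outward_unit_normal \<Omega> y > 0"
proof -
  obtain t where t: "0 < t" "t < 1" "x + t *\<^sub>R (y - x) \<in> \<Omega>"
    using visible_parameter[OF \<Omega>(1,2) x y] .
  have "y \<in> frontier \<Omega>" using y by (simp add: visible_def)
  then have "outward_unit_normal \<Omega> y \<bullet> (x + t *\<^sub>R (y - x) - y) < 0"
    by (intro supports_interior[OF \<Omega>(1) supports_outward_unit_normal[OF \<Omega>] t(3)])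
  moreover have "x + t *\<^sub>R (y - x) - y = - ((1 - t) *\<^sub>R (y - x))" by (simp add: algebra_simps)
  ultimately have "(1 - t) * (outward_unit_normal \<Omega> y \<bullet> (y - x)) > 0" by simp
  then have "outward_unit_normal \<Omega> y \<bullet> (y - x) > 0" using t(2) by (simp add: zero_less_mult_iff)
  then show ?thesis
    using visible_neq[OF \<Omega>(1) y] by (simp add: sgn_div_norm inner_commute)
qed

definition radial_jacobian :: "(real ^ 'n) set \<Rightarrow> real ^ 'n \<Rightarrow> real ^ 'n \<Rightarrow> real" where
  "radial_jacobian \<Omega> x y = \<bar>sgn (y - x) \<bullet> outward_unit_normal \<Omega> y\<bar> / norm (y - x) ^ (CARD('n) - 1)"

lemma radial_jacobian_nonneg: "radial_jacobian \<Omega> x y \<ge> 0"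
  by (simp add: radial_jacobian_def)

text \<open>The local comparison uses the Jacobian frozen at \<open>y0\<close>; continuity of the
  Jacobian costs one further factor q, whence the exponent
  \<open>2 * (CARD('n) - 1) + 1\<close>.\<close>

lemma radial_area_formula:
  fixes \<Omega> :: "(real ^ 'n) set"
  assumes \<Omega>: "open \<Omega>" "convex \<Omega>" "bounded \<Omega>" "C1_boundary \<Omega>" and x: "x \<in> closure \<Omega>"
    and A: "A \<in> sets borel" "A \<subseteq> visible \<Omega> x"
  shows "hausdorff_outer (CARD('n) - 1) ((\<lambda>y. sgn (y - x)) ` A)
       = (\<integral>\<^sup>+y. ennreal (radial_jacobian \<Omega> x y) * indicator A y \<partial>hausdorff_measure (CARD('n) - 1))"
    (is "_ = ?I A")
    and "(\<lambda>y. ennreal (radial_jacobian \<Omega> x y) * indicator (visible \<Omega> x) y) \<in> borel_measurable borel"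
proof -
  let ?d = "CARD('n) - 1"
  define S where "S = visible \<Omega> x"
  define J where "J = radial_jacobian \<Omega> x"
  define f where "f y = sgn (y - x)" for y
  obtain K :: "nat \<Rightarrow> (real ^ 'n) set" where K: "\<And>n. compact (K n)" "S = (\<Union>n. K n)"
    using visible_sigma_compact[OF \<Omega>(1,3), of x] unfolding S_def by blast
  have Sb: "S \<in> sets borel"
    unfolding K(2) using K(1) by (intro sets.countable_UN) (auto intro: borel_compact)
  have SF: "S \<subseteq> frontier \<Omega>" by (auto simp: S_def visible_def)
  have nx: "y \<noteq> x" if "y \<in> S" for y using visible_neq[OF \<Omega>(1)] that by (simp add: S_def)
  have cf: "continuous_on S f"
    unfolding f_def sgn_div_norm using nx by (intro continuous_intros) auto
  have inj: "inj_on f S"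
    unfolding f_def S_def by (rule inj_on_radial_projection[OF \<Omega>(1,2) x])
  have c\<nu>: "continuous_on S (outward_unit_normal \<Omega>)"
    using continuous_on_outward_unit_normal[OF \<Omega>(1,2,4)] SF by (rule continuous_on_subset)
  have cJ: "continuous_on S J"
  proof -
    have "J = (\<lambda>y. \<bar>f y \<bullet> outward_unit_normal \<Omega> y\<bar> / norm (y - x) ^ ?d)"
      by (simp add: J_def radial_jacobian_def f_def fun_eq_iff)
    then show ?thesis using cf c\<nu> nx by (auto intro!: continuous_intros)
  qed
  have Jpos: "J y > 0" if "y \<in> S" for y
    using normal_radial_pos[OF \<Omega>(1,2,4) x, of y] nx[OF that] that
    by (simp add: S_def J_def radial_jacobian_def)
  have "(\<lambda>y. indicator S y *\<^sub>R J y) \<in> borel_measurable borel"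
    using cJ Sb by (intro borel_measurable_continuous_on_indicator) auto
  then have "(\<lambda>y. ennreal (indicator S y *\<^sub>R J y)) \<in> borel_measurable borel" by measurable
  moreover have "(\<lambda>y. ennreal (indicator S y *\<^sub>R J y)) = (\<lambda>y. ennreal (J y) * indicator S y)"
    by (auto split: split_indicator)
  ultimately have Jm: "(\<lambda>y. ennreal (J y) * indicator S y) \<in> borel_measurable borel" by simp
  then show "(\<lambda>y. ennreal (radial_jacobian \<Omega> x y) * indicator (visible \<Omega> x) y) \<in> borel_measurable borel"
    by (simp add: J_def S_def)
  have "hausdorff_outer ?d (f ` A) = (\<integral>\<^sup>+y. ennreal (J y) * indicator A y \<partial>hausdorff_measure ?d)"
  proof (rule hausdorff_area_formula[OF K cf inj Jm _ A[folded S_def], where m = "2 * ?d + 1"])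
    fix y0 and q :: real assume y0: "y0 \<in> S" and q: "q > 1"
    define J0 where "J0 = J y0"
    have J0: "J0 > 0" using Jpos[OF y0] by (simp add: J0_def)
    have "\<exists>\<delta>>0. \<forall>A\<in>sets borel. A \<subseteq> S \<inter> ball y0 \<delta> \<longrightarrow>
       hausdorff_outer ?d (f ` A) \<le> ennreal (q ^ ?d) * (ennreal J0 * hausdorff_outer ?d A) \<and>
       ennreal J0 * hausdorff_outer ?d A \<le> ennreal (q ^ (2 * ?d)) * hausdorff_outer ?d (f ` A)"
      unfolding J0_def J_def radial_jacobian_def f_def
    proof (rule hausdorff_outer_radial_local[OF K q])
      show "norm (outward_unit_normal \<Omega> y0) = 1"
        using supports_outward_unit_normal[OF \<Omega>(1,2,4)] y0 SF by (auto simp: supports_def)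
      show "y0 \<noteq> x" by (rule nx[OF y0])
      show "sgn (y0 - x) \<bullet> outward_unit_normal \<Omega> y0 \<noteq> 0"
        using normal_radial_pos[OF \<Omega>(1,2,4) x, of y0] y0 by (simp add: S_def)
      fix \<epsilon> :: real assume "\<epsilon> > 0"
      obtain \<delta> where \<delta>: "\<delta> > 0" "\<And>y z. y \<in> frontier \<Omega> \<inter> ball y0 \<delta> \<Longrightarrow> z \<in> frontier \<Omega> \<inter> ball y0 \<delta> \<Longrightarrow>
          \<bar>outward_unit_normal \<Omega> y0 \<bullet> (y - z)\<bar> \<le> \<epsilon> * norm (y - z)"
        using frontier_flat[OF \<Omega>(1,2,4) subsetD[OF SF y0] \<open>\<epsilon> > 0\<close>] by blast
      show "\<exists>\<delta>>0. \<forall>y\<in>S \<inter> ball y0 \<delta>. \<forall>z\<in>S \<inter> ball y0 \<delta>.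
          \<bar>outward_unit_normal \<Omega> y0 \<bullet> (y - z)\<bar> \<le> \<epsilon> * norm (y - z)"
      proof (intro exI[of _ \<delta>] conjI ballI \<delta>(1))
        fix y z assume "y \<in> S \<inter> ball y0 \<delta>" "z \<in> S \<inter> ball y0 \<delta>"
        then show "\<bar>outward_unit_normal \<Omega> y0 \<bullet> (y - z)\<bar> \<le> \<epsilon> * norm (y - z)"
          using SF by (intro \<delta>(2)) auto
      qed
    qed
    then obtain \<delta>1 where \<delta>1: "\<delta>1 > 0" "\<And>A. A \<in> sets borel \<Longrightarrow> A \<subseteq> S \<inter> ball y0 \<delta>1 \<Longrightarrow>
       hausdorff_outer ?d (f ` A) \<le> ennreal (q ^ ?d) * (ennreal J0 * hausdorff_outer ?d A) \<and>
       ennreal J0 * hausdorff_outer ?d A \<le> ennreal (q ^ (2 * ?d)) * hausdorff_outer ?d (f ` A)"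
      by blast
    \<comment> \<open>Within this distance of \<open>J0\<close>, which is positive,
      \<open>J y\<close> and \<open>J0\<close> agree up to the factor q in both directions.\<close>
    have "min (q * J0 - J0) (J0 - J0 / q) > 0" using q J0 by (simp add: field_simps)
    then obtain \<delta>2 where \<delta>2: "\<delta>2 > 0"
      "\<And>y. y \<in> S \<Longrightarrow> dist y y0 < \<delta>2 \<Longrightarrow> dist (J y) J0 < min (q * J0 - J0) (J0 - J0 / q)"
      using cJ y0 unfolding continuous_on_iff J0_def by blast
    have Jq: "J y \<le> q * J0" "J0 \<le> q * J y" if "y \<in> S" "dist y y0 < \<delta>2" for y
    proof -
      have "J y < q * J0" "J0 / q < J y" using \<delta>2(2)[OF that] by (auto simp: dist_real_def)
      then show "J y \<le> q * J0" "J0 \<le> q * J y"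
        using q by (simp_all add: pos_divide_less_eq mult.commute less_imp_le)
    qed
    define U where "U = ball y0 (min \<delta>1 \<delta>2)"
    have "hausdorff_outer ?d (f ` A) \<le> ennreal (q ^ (2 * ?d + 1)) * (\<integral>\<^sup>+y. ennreal (J y) * indicator A y \<partial>hausdorff_measure ?d) \<and>
        (\<integral>\<^sup>+y. ennreal (J y) * indicator A y \<partial>hausdorff_measure ?d) \<le> ennreal (q ^ (2 * ?d + 1)) * hausdorff_outer ?d (f ` A)"
      if A: "A \<in> sets borel" "A \<subseteq> S \<inter> U" for A
    proof -
      have HA: "emeasure (hausdorff_measure ?d) A = hausdorff_outer ?d A"
        by (rule emeasure_hausdorff_measure[OF A(1)])
      have A1: "A \<subseteq> S \<inter> ball y0 \<delta>1" using A(2) by (auto simp: U_def)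
      have AJ: "J y \<le> q * J0" "J0 \<le> q * J y" if "y \<in> A" for y
        using Jq[of y] subsetD[OF A(2) that] by (auto simp: U_def dist_commute)
      have "(\<integral>\<^sup>+y. ennreal (J y) * indicator A y \<partial>hausdorff_measure ?d)
          \<le> (\<integral>\<^sup>+y. ennreal (q * J0) * indicator A y \<partial>hausdorff_measure ?d)"
        using AJ(1) by (intro nn_integral_mono) (auto split: split_indicator intro: ennreal_leI)
      also have "\<dots> = ennreal (q * J0) * hausdorff_outer ?d A"
        using A(1) by (subst nn_integral_cmult_indicator) (simp_all add: HA del: One_nat_def)
      also have "\<dots> = ennreal q * (ennreal J0 * hausdorff_outer ?d A)"
        using q J0 by (simp add: ennreal_mult' mult.assoc)
      finally have up: "(\<integral>\<^sup>+y. ennreal (J y) * indicator A y \<partial>hausdorff_measure ?d)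
          \<le> ennreal q * (ennreal J0 * hausdorff_outer ?d A)" .
      have JAm: "(\<lambda>y. ennreal (J y) * indicator A y) \<in> borel_measurable borel"
      proof -
        have "(\<lambda>y. (ennreal (J y) * indicator S y) * indicator A y) \<in> borel_measurable borel"
          using Jm A(1) by measurable
        moreover have "(\<lambda>y. (ennreal (J y) * indicator S y) * indicator A y) = (\<lambda>y. ennreal (J y) * indicator A y)"
          using A(2) by (intro ext) (auto split: split_indicator)
        ultimately show ?thesis by simp
      qed
      have "ennreal J0 * hausdorff_outer ?d A = (\<integral>\<^sup>+y. ennreal J0 * indicator A y \<partial>hausdorff_measure ?d)"
        using A(1) by (subst nn_integral_cmult_indicator) (simp_all add: HA del: One_nat_def)
      also have "\<dots> \<le> (\<integral>\<^sup>+y. ennreal q * (ennreal (J y) * indicator A y) \<partial>hausdorff_measure ?d)"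
        using AJ(2) q by (intro nn_integral_mono) (auto split: split_indicator simp: ennreal_mult'[symmetric] intro: ennreal_leI)
      also have "\<dots> = ennreal q * (\<integral>\<^sup>+y. ennreal (J y) * indicator A y \<partial>hausdorff_measure ?d)"
        using JAm by (subst nn_integral_cmult) auto
      finally have lo: "ennreal J0 * hausdorff_outer ?d A \<le> ennreal q * (\<integral>\<^sup>+y. ennreal (J y) * indicator A y \<partial>hausdorff_measure ?d)" .
      have qm: "ennreal (q ^ i) * (ennreal (q ^ j) * X) = ennreal (q ^ (i + j)) * X" for i j X
        using q by (simp add: mult.assoc[symmetric] ennreal_mult'[symmetric] power_add)
      have "hausdorff_outer ?d (f ` A) \<le> ennreal (q ^ ?d) * (ennreal J0 * hausdorff_outer ?d A)"
        using \<delta>1(2)[OF A(1) A1] by blast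
      also have "\<dots> \<le> ennreal (q ^ ?d) * (ennreal (q ^ 1) * (\<integral>\<^sup>+y. ennreal (J y) * indicator A y \<partial>hausdorff_measure ?d))"
        using lo by (intro mult_left_mono) auto
      also have "\<dots> = ennreal (q ^ (?d + 1)) * (\<integral>\<^sup>+y. ennreal (J y) * indicator A y \<partial>hausdorff_measure ?d)"
        by (rule qm)
      also have "\<dots> \<le> ennreal (q ^ (2 * ?d + 1)) * (\<integral>\<^sup>+y. ennreal (J y) * indicator A y \<partial>hausdorff_measure ?d)"
        using q by (intro mult_right_mono ennreal_leI power_increasing) auto
      finally have 1: "hausdorff_outer ?d (f ` A) \<le> ennreal (q ^ (2 * ?d + 1)) * (\<integral>\<^sup>+y. ennreal (J y) * indicator A y \<partial>hausdorff_measure ?d)" .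
      have "(\<integral>\<^sup>+y. ennreal (J y) * indicator A y \<partial>hausdorff_measure ?d) \<le> ennreal (q ^ 1) * (ennreal J0 * hausdorff_outer ?d A)"
        using up by simp
      also have "\<dots> \<le> ennreal (q ^ 1) * (ennreal (q ^ (2 * ?d)) * hausdorff_outer ?d (f ` A))"
        using \<delta>1(2)[OF A(1) A1] by (intro mult_left_mono) auto
      also have "\<dots> = ennreal (q ^ (1 + 2 * ?d)) * hausdorff_outer ?d (f ` A)" by (rule qm)
      finally show ?thesis using 1 by (simp only: add.commute[of 1])
    qed
    moreover have "open U" "y0 \<in> U" using \<delta>1(1) \<delta>2(1) by (auto simp: U_def)
    ultimately show "\<exists>U. open U \<and> y0 \<in> U \<and> (\<forall>A\<in>sets borel. A \<subseteq> S \<inter> U \<longrightarrow>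
        hausdorff_outer ?d (f ` A) \<le> ennreal (q ^ (2 * ?d + 1)) * (\<integral>\<^sup>+y. ennreal (J y) * indicator A y \<partial>hausdorff_measure ?d) \<and>
        (\<integral>\<^sup>+y. ennreal (J y) * indicator A y \<partial>hausdorff_measure ?d) \<le> ennreal (q ^ (2 * ?d + 1)) * hausdorff_outer ?d (f ` A))"
      by blast
  qed
  then show "hausdorff_outer ?d ((\<lambda>y. sgn (y - x)) ` A) = ?I A" by (simp add: f_def J_def)
qed

section \<open>Integrals over the sphere\<close>

text \<open>The area formula identifies the image under the projection of the measure with density
  \<open>J\<close> as the Hausdorff measure on the entering directions; integrating \<open>g\<close>
  is then change of variables.\<close>

lemma nn_integral_radial_projection:
  fixes \<Omega> :: "(real ^ 'n) set"
  assumes \<Omega>: "open \<Omega>" "convex \<Omega>" "bounded \<Omega>" "C1_boundary \<Omega>" and x: "x \<in> closure \<Omega>"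
    and g: "g \<in> borel_measurable borel"
  shows "(\<integral>\<^sup>+y. ennreal (radial_jacobian \<Omega> x y) * g (sgn (y - x)) * indicator (visible \<Omega> x) y \<partial>hausdorff_measure (CARD('n) - 1))
       = (\<integral>\<^sup>+v. g v * indicator (entering \<Omega> x) v \<partial>hausdorff_measure (CARD('n) - 1))"
proof -
  let ?\<sigma> = "hausdorff_measure (CARD('n) - 1) :: (real ^ 'n) measure"
  define S where "S = visible \<Omega> x"
  define W where "W = entering \<Omega> x"
  define J where "J y = ennreal (radial_jacobian \<Omega> x y) * indicator S y" for y
  define f where "f y = sgn (y - x)" for y
  have [measurable]: "J \<in> borel_measurable borel"
    using radial_area_formula(2)[OF \<Omega> x, of "{}"] by (simp add: J_def[abs_def] S_def)
  have [measurable]: "f \<in> borel_measurable borel"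
    unfolding f_def sgn_div_norm by measurable
  have [measurable]: "W \<in> sets borel" unfolding W_def by (rule borel_entering[OF \<Omega>(1)])
  have Sb: "S \<in> sets borel"
  proof -
    obtain K :: "nat \<Rightarrow> (real ^ 'n) set" where K: "\<And>n. compact (K n)" "S = (\<Union>n. K n)"
      using visible_sigma_compact[OF \<Omega>(1,3), of x] unfolding S_def by blast
    then show ?thesis by (auto intro!: sets.countable_UN intro: borel_compact)
  qed
  note [measurable] = g
  have "distr (density ?\<sigma> J) borel f = density ?\<sigma> (indicator W)"
  proof (rule measure_eqI)
    fix B :: "(real ^ 'n) set" assume "B \<in> sets (distr (density ?\<sigma> J) borel f)"
    then have [measurable]: "B \<in> sets borel" by simp
    have fB: "f -` B \<in> sets borel" by (rule measurable_sets_borel) measurable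
    have "emeasure (distr (density ?\<sigma> J) borel f) B = emeasure (density ?\<sigma> J) (f -` B)"
      by (subst emeasure_distr) auto
    also have "\<dots> = (\<integral>\<^sup>+y. J y * indicator (f -` B) y \<partial>?\<sigma>)"
      using fB by (subst emeasure_density) auto
    also have "\<dots> = (\<integral>\<^sup>+y. ennreal (radial_jacobian \<Omega> x y) * indicator (S \<inter> f -` B) y \<partial>?\<sigma>)"
      by (intro nn_integral_cong) (auto simp: J_def split: split_indicator)
    also have "\<dots> = hausdorff_outer (CARD('n) - 1) (f ` (S \<inter> f -` B))"
      unfolding f_def using Sb fB[unfolded f_def]
      by (intro radial_area_formula(1)[OF \<Omega> x, symmetric]) (auto simp: S_def)
    also have "f ` (S \<inter> f -` B) = f ` S \<inter> B" by blast
    also have "f ` S = W"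
      unfolding S_def W_def f_def by (rule radial_projection_image[OF \<Omega>(1-3)])
    also have "hausdorff_outer (CARD('n) - 1) (W \<inter> B) = emeasure (density ?\<sigma> (indicator W)) B"
      by (simp add: emeasure_restricted emeasure_hausdorff_measure)
    finally show "emeasure (distr (density ?\<sigma> J) borel f) B = emeasure (density ?\<sigma> (indicator W)) B" .
  qed simp
  then have "(\<integral>\<^sup>+v. g v \<partial>distr (density ?\<sigma> J) borel f) = (\<integral>\<^sup>+v. g v \<partial>density ?\<sigma> (indicator W))"
    by simp
  moreover have "(\<integral>\<^sup>+v. g v \<partial>distr (density ?\<sigma> J) borel f) = (\<integral>\<^sup>+y. J y * g (f y) \<partial>?\<sigma>)"
    by (subst nn_integral_distr) (auto simp: nn_integral_density)
  moreover have "(\<integral>\<^sup>+v. g v \<partial>density ?\<sigma> (indicator W)) = (\<integral>\<^sup>+v. indicator W v * g v \<partial>?\<sigma>)"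
    by (subst nn_integral_density) auto
  ultimately show ?thesis by (simp add: J_def S_def W_def f_def mult_ac)
qed

section \<open>Symmetries of the spherical integral\<close>

lemma nn_integral_hausdorff_orthogonal:
  fixes f :: "'a::euclidean_space \<Rightarrow> 'a"
  assumes f: "orthogonal_transformation f" and g: "g \<in> borel_measurable borel"
  shows "(\<integral>\<^sup>+v. g (f v) \<partial>hausdorff_measure d) = (\<integral>\<^sup>+v. g v \<partial>hausdorff_measure d)"
proof -
  have [measurable]: "f \<in> borel_measurable borel"
    using orthogonal_transformation_linear[OF f]
    by (intro borel_measurable_continuous_onI linear_continuous_on) (simp add: linear_linear)
  have "distr (hausdorff_measure d) borel f = hausdorff_measure d"
  proof (rule measure_eqI)
    fix B assume "B \<in> sets (distr (hausdorff_measure d) borel f)"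
    then have [measurable]: "B \<in> sets borel" by simp
    have "f -` B \<in> sets borel" by (rule measurable_sets_borel) measurable
    then have "emeasure (distr (hausdorff_measure d) borel f) B = hausdorff_outer d (f -` B)"
      by (subst emeasure_distr) (auto simp: emeasure_hausdorff_measure)
    also have "\<dots> = hausdorff_outer d (f ` (f -` B))"
      by (rule hausdorff_outer_orthogonal_image[OF f, symmetric])
    also have "f ` (f -` B) = B"
      by (rule surj_image_vimage_eq[OF orthogonal_transformation_surj[OF f]])
    finally show "emeasure (distr (hausdorff_measure d) borel f) B = emeasure (hausdorff_measure d) B"
      by (simp add: emeasure_hausdorff_measure)
  qed simp
  moreover have "(\<integral>\<^sup>+v. g v \<partial>distr (hausdorff_measure d) borel f) = (\<integral>\<^sup>+v. g (f v) \<partial>hausdorff_measure d)"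
    using g by (intro nn_integral_distr) auto
  ultimately show ?thesis by simp
qed

lemma nn_integral_sphere_inner:
  fixes w :: "real ^ 'n"
  assumes "norm w = 1"
  shows "(\<integral>\<^sup>+v. ennreal \<bar>w \<bullet> v\<bar> * indicator (sphere 0 1) v \<partial>hausdorff_measure (CARD('n) - 1))
       = (\<integral>\<^sup>+v. ennreal \<bar>v $ k\<bar> * indicator (sphere 0 1) (v :: real ^ 'n) \<partial>hausdorff_measure (CARD('n) - 1))"
    (is "?L = ?R")
proof -
  have [measurable]: "sphere 0 1 \<in> sets (borel :: (real ^ 'n) measure)" by (intro borel_closed) simp
  obtain f :: "real ^ 'n \<Rightarrow> real ^ 'n" where f: "orthogonal_transformation f" "f w = axis k 1"
    using orthogonal_transformation_swap[of w "axis k 1"] assms by auto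
  have "?R = (\<integral>\<^sup>+v. ennreal \<bar>f v $ k\<bar> * indicator (sphere 0 1) (f v) \<partial>hausdorff_measure (CARD('n) - 1))"
    by (rule nn_integral_hausdorff_orthogonal[OF f(1), symmetric]) measurable
  also have "\<dots> = ?L"
  proof (intro nn_integral_cong)
    fix v
    have "f v $ k = w \<bullet> v"
      using orthogonal_transformation_inner[OF f(1), of v w] by (simp add: f(2) inner_axis inner_commute)
    then show "ennreal \<bar>f v $ k\<bar> * indicator (sphere 0 1) (f v) = ennreal \<bar>w \<bullet> v\<bar> * indicator (sphere 0 1) v"
      using orthogonal_transformation_norm[OF f(1), of v] by (auto split: split_indicator)
  qed
  finally show ?thesis ..
qed

text \<open>Negation exchanges the open hemispheres, and on the equator the integrand is 0, so its
  measure need not be known.\<close>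

lemma nn_integral_hemisphere_inner:
  fixes w :: "real ^ 'n"
  shows "2 * (\<integral>\<^sup>+v. ennreal \<bar>w \<bullet> v\<bar> * indicator {v \<in> sphere 0 1. w \<bullet> v < 0} v \<partial>hausdorff_measure d)
       = (\<integral>\<^sup>+v. ennreal \<bar>w \<bullet> v\<bar> * indicator (sphere 0 1) v \<partial>hausdorff_measure d)"
proof -
  have [measurable]: "{v \<in> sphere 0 1. w \<bullet> v < 0} \<in> sets borel" "{v \<in> sphere 0 1. w \<bullet> v > 0} \<in> sets borel"
  proof -
    have "{v \<in> sphere 0 1. w \<bullet> v < 0} = sphere 0 1 \<inter> {v. w \<bullet> v < 0}"
      "{v \<in> sphere 0 1. w \<bullet> v > 0} = sphere 0 1 \<inter> {v. w \<bullet> v > 0}" by auto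
    then show "{v \<in> sphere 0 1. w \<bullet> v < 0} \<in> sets borel" "{v \<in> sphere 0 1. w \<bullet> v > 0} \<in> sets borel"
      by (auto intro!: sets.Int borel_open[OF open_halfspace_lt] borel_open[OF open_halfspace_gt] borel_closed)
  qed
  have neg: "orthogonal_transformation (\<lambda>v :: real ^ 'n. - v)"
    by (simp add: orthogonal_transformation_def linear_iff)
  have "(\<integral>\<^sup>+v. ennreal \<bar>w \<bullet> v\<bar> * indicator {v \<in> sphere 0 1. w \<bullet> v > 0} v \<partial>hausdorff_measure d)
      = (\<integral>\<^sup>+v. ennreal \<bar>w \<bullet> (- v)\<bar> * indicator {v \<in> sphere 0 1. w \<bullet> v > 0} (- v) \<partial>hausdorff_measure d)"
    by (rule nn_integral_hausdorff_orthogonal[OF neg, symmetric]) measurable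
  also have "\<dots> = (\<integral>\<^sup>+v. ennreal \<bar>w \<bullet> v\<bar> * indicator {v \<in> sphere 0 1. w \<bullet> v < 0} v \<partial>hausdorff_measure d)"
    by (intro nn_integral_cong) (auto split: split_indicator)
  finally have flip: "(\<integral>\<^sup>+v. ennreal \<bar>w \<bullet> v\<bar> * indicator {v \<in> sphere 0 1. w \<bullet> v > 0} v \<partial>hausdorff_measure d)
      = (\<integral>\<^sup>+v. ennreal \<bar>w \<bullet> v\<bar> * indicator {v \<in> sphere 0 1. w \<bullet> v < 0} v \<partial>hausdorff_measure d)" .
  have "(\<integral>\<^sup>+v. ennreal \<bar>w \<bullet> v\<bar> * indicator (sphere 0 1) v \<partial>hausdorff_measure d)
     = (\<integral>\<^sup>+v. ennreal \<bar>w \<bullet> v\<bar> * indicator {v \<in> sphere 0 1. w \<bullet> v < 0} v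
          + ennreal \<bar>w \<bullet> v\<bar> * indicator {v \<in> sphere 0 1. w \<bullet> v > 0} v \<partial>hausdorff_measure d)"
    by (intro nn_integral_cong) (auto split: split_indicator)
  also have "\<dots> = (\<integral>\<^sup>+v. ennreal \<bar>w \<bullet> v\<bar> * indicator {v \<in> sphere 0 1. w \<bullet> v < 0} v \<partial>hausdorff_measure d)
     + (\<integral>\<^sup>+v. ennreal \<bar>w \<bullet> v\<bar> * indicator {v \<in> sphere 0 1. w \<bullet> v > 0} v \<partial>hausdorff_measure d)"
    by (rule nn_integral_add) auto
  finally show ?thesis by (simp only: flip mult_2)
qed

text \<open>Passage to the Bochner integral: a finite nonnegative integral yields integrability and
  the value together.\<close>

lemma set_integral_eq_if_nn_integral_eq:
  fixes f :: "'a \<Rightarrow> real"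
  assumes "(\<lambda>x. indicator A x * f x) \<in> borel_measurable M" "\<And>x. x \<in> A \<Longrightarrow> f x \<ge> 0" "c \<ge> 0"
    and "(\<integral>\<^sup>+x. ennreal (f x) * indicator A x \<partial>M) = ennreal c"
  shows "set_integrable M A f \<and> (LINT x:A|M. f x) = c"
proof -
  have "(\<integral>\<^sup>+x. ennreal (indicator A x * f x) \<partial>M) = (\<integral>\<^sup>+x. ennreal (f x) * indicator A x \<partial>M)"
    by (intro nn_integral_cong) (auto split: split_indicator)
  then have "(\<integral>\<^sup>+x. ennreal (indicator A x * f x) \<partial>M) = ennreal c" using assms(4) by simp
  moreover have "AE x in M. 0 \<le> indicator A x * f x" using assms(2) by (auto split: split_indicator)
  ultimately show ?thesis
    using nn_integral_eq_integrable[OF assms(1) _ assms(3)]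
    by (simp add: set_integrable_def set_lebesgue_integral_def)
qed

text \<open>If the ray missed \<Omega>, a hyperplane would separate them. It supports \<Omega> at
  \<open>x\<close>, so by uniqueness its normal is the outward one; but that normal would then have
  nonnegative inner product with \<open>u\<close>.\<close>

lemma direction_enters:
  fixes \<Omega> :: "(real ^ 'n) set"
  assumes \<Omega>: "open \<Omega>" "convex \<Omega>" "C1_boundary \<Omega>" and x: "x \<in> frontier \<Omega>"
    and u: "outward_unit_normal \<Omega> x \<bullet> u < 0"
  shows "\<exists>t>0. x + t *\<^sub>R u \<in> \<Omega>"
proof (rule ccontr)
  assume no: "\<not> ?thesis"
  define R where "R = (\<lambda>t. x + t *\<^sub>R u) ` {0..}"
  have xc: "x \<in> closure \<Omega>" "x \<notin> \<Omega>" using x \<Omega>(1) by (simp_all add: frontier_def interior_open)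
  have "convex R"
  proof -
    have "R = (\<lambda>z. x + z) ` (\<lambda>t. t *\<^sub>R u) ` {0..}" by (simp add: R_def image_image)
    then show ?thesis
      by (simp add: convex_translation convex_linear_image linear_scaleR_left del: image_image)
  qed
  moreover have "\<Omega> \<inter> R = {}"
    using no xc(2) by (force simp: R_def le_less)
  moreover have "\<Omega> \<noteq> {}" using xc(1) by auto
  moreover have "R \<noteq> {}" by (auto simp: R_def)
  ultimately obtain a b where ab: "a \<noteq> 0" "\<And>z. z \<in> \<Omega> \<Longrightarrow> a \<bullet> z \<le> b" "\<And>z. z \<in> R \<Longrightarrow> b \<le> a \<bullet> z"
    using separating_hyperplane_sets[OF \<Omega>(2), of R] by blast
  have "x \<in> R" unfolding R_def by (rule image_eqI[of _ _ 0]) auto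
  have "sgn a \<bullet> (z - x) \<le> 0" if "z \<in> \<Omega>" for z
  proof -
    have "a \<bullet> (z - x) \<le> 0" using ab(2)[OF that] ab(3)[OF \<open>x \<in> R\<close>] by (simp add: inner_diff_right)
    then show ?thesis by (simp add: sgn_div_norm mult_nonneg_nonpos)
  qed
  then have "supports \<Omega> x (sgn a)" using ab(1) by (simp add: supports_def norm_sgn)
  then have n: "outward_unit_normal \<Omega> x = sgn a"
    by (rule supports_eq_outward_unit_normal[OF \<Omega>(1,3) x])
  have "closure \<Omega> \<subseteq> {z. a \<bullet> z \<le> b}" using ab(2) by (intro closure_minimal closed_halfspace_le) auto
  then have "a \<bullet> x \<le> b" using xc(1) by auto
  moreover have "x + 1 *\<^sub>R u \<in> R" unfolding R_def by (rule image_eqI[of _ _ 1]) auto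
  then have "b \<le> a \<bullet> (x + u)" using ab(3) by force
  ultimately have "a \<bullet> u \<ge> 0" by (simp add: inner_add_right)
  then have "sgn a \<bullet> u \<ge> 0" by (simp add: sgn_div_norm)
  then show False using u n by simp
qed

lemma entering_interior:
  fixes \<Omega> :: "'a::real_normed_vector set"
  assumes "open \<Omega>" "x \<in> \<Omega>"
  shows "\<exists>t>0. x + t *\<^sub>R u \<in> \<Omega>"
proof -
  obtain e where e: "e > 0" "ball x e \<subseteq> \<Omega>" using assms open_contains_ball by blast
  define N where "N = norm u + 1"
  define t where "t = e / N"
  have "N > 0" by (simp add: N_def add_nonneg_pos)
  then have t: "t > 0" using e by (simp add: t_def)
  then have "t * norm u < t * N" by (simp add: N_def)
  also have "\<dots> = e" using \<open>N > 0\<close> by (simp add: t_def)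
  finally have "x + t *\<^sub>R u \<in> ball x e" using t by (simp add: dist_norm)
  then show ?thesis using t e by blast
qed

theorem mainTheorem2:
  fixes \<Omega> :: "(real ^ 'n) set" and k :: 'n and \<sigma> :: "(real ^ 'n) measure"
    and \<nu> :: "real ^ 'n \<Rightarrow> real ^ 'n" and c :: real
  defines "\<sigma> \<equiv> hausdorff_measure (CARD('n) - 1)"
    and "\<nu> \<equiv> outward_unit_normal \<Omega>"
    and "c \<equiv> 1 / 2 * (LINT w:sphere 0 1|\<sigma>. \<bar>w $ k\<bar>)"
  assumes "open \<Omega>" and "connected \<Omega>" and "\<Omega> \<noteq> {}"
    and "convex \<Omega>" and "bounded \<Omega>" and "C1_boundary \<Omega>"
  shows "(\<forall>x\<in>frontier \<Omega>.
            set_integrable \<sigma> (frontier \<Omega> - {x})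
              (\<lambda>y. \<bar>(\<nu> x \<bullet> (y - x)) * ((y - x) \<bullet> \<nu> y)\<bar> / norm (x - y) ^ (CARD('n) + 1)) \<and>
            (LINT y:frontier \<Omega> - {x}|\<sigma>.
              \<bar>(\<nu> x \<bullet> (y - x)) * ((y - x) \<bullet> \<nu> y)\<bar> / norm (x - y) ^ (CARD('n) + 1)) = c) \<and>
         (\<forall>x\<in>\<Omega> - frontier \<Omega>. \<forall>w\<in>sphere 0 1.
            set_integrable \<sigma> (frontier \<Omega>)
              (\<lambda>y. \<bar>(w \<bullet> (y - x)) * ((y - x) \<bullet> \<nu> y)\<bar> / norm (x - y) ^ (CARD('n) + 1)) \<and>
            (LINT y:frontier \<Omega>|\<sigma>.
              \<bar>(w \<bullet> (y - x)) * ((y - x) \<bullet> \<nu> y)\<bar> / norm (x - y) ^ (CARD('n) + 1)) = 2 * c)"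
proof -
  note \<Omega> = \<open>open \<Omega>\<close> \<open>convex \<Omega>\<close> \<open>bounded \<Omega>\<close> \<open>C1_boundary \<Omega>\<close>
  define F where "F x w y = \<bar>(w \<bullet> (y - x)) * ((y - x) \<bullet> \<nu> y)\<bar> / norm (x - y) ^ (CARD('n) + 1)" for x w y
  define M where "M = (\<integral>\<^sup>+v. ennreal \<bar>v $ k\<bar> * indicator (sphere 0 1) v \<partial>\<sigma>)"
  have s\<sigma> [simp]: "measurable \<sigma> N = measurable borel N" for N by (simp add: \<sigma>_def)
  \<comment> \<open>Finiteness of \<open>M\<close> prevents the integral defining \<open>c\<close>
    from being the default value 0.\<close>
  have "M \<le> (\<integral>\<^sup>+v. indicator (sphere 0 1) v \<partial>\<sigma>)"
    unfolding M_def
  proof (rule nn_integral_mono)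
    fix v :: "real ^ 'n"
    show "ennreal \<bar>v $ k\<bar> * indicator (sphere 0 1) v \<le> indicator (sphere 0 1) v"
      using component_le_norm_cart[of v k] by (auto split: split_indicator)
  qed
  also have "\<dots> = hausdorff_outer (CARD('n) - 1) (sphere (0 :: real ^ 'n) 1)"
    unfolding \<sigma>_def by (subst nn_integral_indicator) (auto intro!: emeasure_hausdorff_measure)
  also have "\<dots> < \<infinity>" by (rule hausdorff_outer_sphere_finite)
  finally have Mfin: "M < \<infinity>" .
  define m where "m = enn2real M"
  have Mm: "M = ennreal m" and m0: "m \<ge> 0" using Mfin by (simp_all add: m_def)
  have [measurable]: "sphere 0 1 \<in> sets (borel :: (real ^ 'n) measure)" by (intro borel_closed) simp
  have "(\<lambda>w :: real ^ 'n. indicat_real (sphere 0 1) w * \<bar>w $ k\<bar>) \<in> borel_measurable borel" by measurable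
  then have "(LINT w:sphere 0 1|\<sigma>. \<bar>w $ k\<bar>) = m"
    using set_integral_eq_if_nn_integral_eq[of "sphere 0 1" "\<lambda>w. \<bar>w $ k\<bar>" \<sigma> m] m0 Mm
    by (simp add: M_def)
  then have c: "c = m / 2" by (simp add: c_def)
  have c0: "c \<ge> 0" using m0 c by simp
  have wM: "(\<integral>\<^sup>+v. ennreal \<bar>w \<bullet> v\<bar> * indicator (sphere 0 1) v \<partial>\<sigma>) = M" if "norm w = 1" for w
    unfolding M_def \<sigma>_def by (rule nn_integral_sphere_inner[OF that])
  have wM2: "(\<integral>\<^sup>+v. ennreal \<bar>w \<bullet> v\<bar> * indicator {v \<in> sphere 0 1. w \<bullet> v < 0} v \<partial>\<sigma>) = ennreal c"
    if "norm w = 1" for w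
  proof -
    have "2 * (\<integral>\<^sup>+v. ennreal \<bar>w \<bullet> v\<bar> * indicator {v \<in> sphere 0 1. w \<bullet> v < 0} v \<partial>\<sigma>) = ennreal m"
      unfolding \<sigma>_def nn_integral_hemisphere_inner using wM[OF that] Mm by (simp add: \<sigma>_def)
    also have "\<dots> = 2 * ennreal c" using c0 by (simp add: c ennreal_mult'[symmetric] flip: ennreal_numeral)
    finally show ?thesis by (simp add: ennreal_mult_cancel_left)
  qed
  have int: "(\<integral>\<^sup>+y. ennreal (F x w y) * indicator (visible \<Omega> x) y \<partial>\<sigma>)
      = (\<integral>\<^sup>+v. ennreal \<bar>w \<bullet> v\<bar> * indicator (entering \<Omega> x) v \<partial>\<sigma>)" if x: "x \<in> closure \<Omega>" for x w
  proof -
    have "(\<integral>\<^sup>+y. ennreal (F x w y) * indicator (visible \<Omega> x) y \<partial>\<sigma>)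
        = (\<integral>\<^sup>+y. ennreal (radial_jacobian \<Omega> x y) * ennreal \<bar>w \<bullet> sgn (y - x)\<bar> * indicator (visible \<Omega> x) y \<partial>\<sigma>)"
    proof (intro nn_integral_cong)
      fix y
      have "F x w y = radial_jacobian \<Omega> x y * \<bar>w \<bullet> sgn (y - x)\<bar>"
      proof (cases "y = x")
        case False
        define \<rho> where "\<rho> = norm (y - x)"
        have "\<rho> > 0" using False by (simp add: \<rho>_def)
        \<comment> \<open>Two of the \<open>n + 1\<close> powers normalise \<open>y - x\<close> in
          the two inner products; the other \<open>n - 1\<close> belong to the Jacobian.\<close>
        have "\<rho> ^ (CARD('n) + 1) = \<rho> * \<rho> * \<rho> ^ (CARD('n) - 1)"
          by (metis One_nat_def Suc_pred add.commute mult.assoc plus_1_eq_Suc power_Suc zero_less_card_finite)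
        moreover have "norm (x - y) = \<rho>" by (simp add: \<rho>_def norm_minus_commute)
        ultimately show ?thesis
          using \<open>\<rho> > 0\<close>
          by (simp add: F_def radial_jacobian_def sgn_div_norm \<nu>_def \<rho>_def[symmetric] abs_mult divide_inverse)
      qed (simp add: F_def)
      then show "ennreal (F x w y) * indicator (visible \<Omega> x) y
          = ennreal (radial_jacobian \<Omega> x y) * ennreal \<bar>w \<bullet> sgn (y - x)\<bar> * indicator (visible \<Omega> x) y"
        by (simp add: ennreal_mult radial_jacobian_nonneg)
    qed
    also have "\<dots> = (\<integral>\<^sup>+v. ennreal \<bar>w \<bullet> v\<bar> * indicator (entering \<Omega> x) v \<partial>\<sigma>)"
      unfolding \<sigma>_def by (rule nn_integral_radial_projection[OF \<Omega> x]) measurable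
    finally show ?thesis .
  qed
  \<comment> \<open>Away from \<open>x\<close> the integrand is continuous on the frontier, which
    settles measurability.\<close>
  have Fm: "(\<lambda>y. indicator A y * F x w y) \<in> borel_measurable \<sigma>"
    if A: "A \<in> sets borel" "A \<subseteq> frontier \<Omega> - {x}" for A x w
  proof -
    have "continuous_on A \<nu>"
      unfolding \<nu>_def using A(2)
      by (intro continuous_on_subset[OF continuous_on_outward_unit_normal[OF \<Omega>(1,2,4)]]) auto
    then have "continuous_on A (F x w)"
      unfolding F_def using A(2) by (intro continuous_intros) auto
    then have "(\<lambda>y. indicator A y *\<^sub>R F x w y) \<in> borel_measurable borel"
      using A(1) by (intro borel_measurable_continuous_on_indicator) auto
    then show ?thesis by simp
  qed
  have F0: "F x w y \<ge> 0" for x w y by (simp add: F_def)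
  have bfr: "frontier \<Omega> \<in> sets borel" by (intro borel_closed) simp
  have boundary: "set_integrable \<sigma> (frontier \<Omega> - {x}) (F x (\<nu> x)) \<and> (LINT y:frontier \<Omega> - {x}|\<sigma>. F x (\<nu> x) y) = c"
    if x: "x \<in> frontier \<Omega>" for x
  proof (rule set_integral_eq_if_nn_integral_eq[OF Fm F0 c0])
    have sup: "supports \<Omega> x (\<nu> x)"
      unfolding \<nu>_def by (rule supports_outward_unit_normal[OF \<Omega>(1,2,4) x])
    have ent: "entering \<Omega> x = {v \<in> sphere 0 1. \<nu> x \<bullet> v < 0}"
    proof -
      have "\<nu> x \<bullet> v < 0" if "t > 0" "x + t *\<^sub>R v \<in> \<Omega>" for v t
        using supports_interior[OF \<Omega>(1) sup that(2)] that(1) by (simp add: mult_less_0_iff)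
      then show ?thesis
        using direction_enters[OF \<Omega>(1,2,4) x] by (auto simp: entering_def \<nu>_def)
    qed
    \<comment> \<open>If \<open>y\<close> is not visible, the direction \<open>y - x\<close> does
      not enter \<Omega>, so its inner product with the normal is not negative; support makes it
      nonpositive, hence 0.\<close>
    have "F x (\<nu> x) y = 0" if "y \<in> frontier \<Omega>" "y \<notin> visible \<Omega> x" for y
    proof -
      have "\<not> \<nu> x \<bullet> (y - x) < 0"
        using direction_enters[OF \<Omega>(1,2,4) x, of "y - x"] that by (auto simp: visible_def \<nu>_def)
      moreover have "\<nu> x \<bullet> (y - x) \<le> 0"
        using supports_closure[OF sup, of y] that(1) by (simp add: frontier_def)
      ultimately show ?thesis by (simp add: F_def)
    qed
    then have "(\<integral>\<^sup>+y. ennreal (F x (\<nu> x) y) * indicator (frontier \<Omega> - {x}) y \<partial>\<sigma>)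
        = (\<integral>\<^sup>+y. ennreal (F x (\<nu> x) y) * indicator (visible \<Omega> x) y \<partial>\<sigma>)"
      using visible_neq[OF \<Omega>(1), of _ x]
      by (intro nn_integral_cong) (auto simp: visible_def split: split_indicator)
    also have "\<dots> = (\<integral>\<^sup>+v. ennreal \<bar>\<nu> x \<bullet> v\<bar> * indicator (entering \<Omega> x) v \<partial>\<sigma>)"
      using x by (intro int) (simp add: frontier_def)
    also have "\<dots> = ennreal c"
      unfolding ent using sup by (intro wM2) (simp add: supports_def)
    finally show "(\<integral>\<^sup>+y. ennreal (F x (\<nu> x) y) * indicator (frontier \<Omega> - {x}) y \<partial>\<sigma>) = ennreal c" .
  qed (use bfr in auto)
  have interior: "set_integrable \<sigma> (frontier \<Omega>) (F x w) \<and> (LINT y:frontier \<Omega>|\<sigma>. F x w y) = 2 * c"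
    if x: "x \<in> \<Omega>" and w: "norm w = 1" for x w
  proof (rule set_integral_eq_if_nn_integral_eq[OF Fm F0])
    have "x \<notin> frontier \<Omega>" using x \<Omega>(1) by (simp add: frontier_def interior_open)
    then show "frontier \<Omega> \<subseteq> frontier \<Omega> - {x}" by auto
    \<comment> \<open>From an interior point every direction enters, so the full sphere occurs and
      the value is twice that of a hemisphere.\<close>
    have "visible \<Omega> x = frontier \<Omega>" "entering \<Omega> x = sphere 0 1"
      using entering_interior[OF \<Omega>(1) x] by (auto simp: visible_def entering_def)
    then show "(\<integral>\<^sup>+y. ennreal (F x w y) * indicator (frontier \<Omega>) y \<partial>\<sigma>) = ennreal (2 * c)"
      using int[of x w] wM[OF w] x closure_subset Mm by (auto simp: c)
  qed (use bfr c0 in auto)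
  show ?thesis
    using boundary interior unfolding F_def by auto
qed

end
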